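(* Let $K$ be a field, $R=K[x_1,\ldots,x_n]$, and let $I$ and $J$ be monomial ideals in $R$ such that $IJ=I\cap J$. Let $\mathbb{M}(I)_{\bullet}$ and $\mathbb{M}(J)_{\bullet}$ denote minimal free resolutions of $I$ and $J$ respectively. Then $\mathbb{M}(I)_{\bullet}\otimes_R \mathbb{M}(J)_{\bullet}$ is a minimal free resolution of the ideal $I+J$.
   Context: A monomial ideal is an ideal generated by monomials. A (minimal) free resolution of a monomial ideal $M$ means a (minimal) multigraded free resolution of the $R$-module $R/M$, where $R$ carries its $\mathbb{N}^n$-grading by exponent vectors of monomials; minimal means that the image of each differential is contained in $(x_1,\ldots,x_n)$ times the next module. The tensor product is the usual tensor product of complexes. *)

theory Defs
  imports Complex_Main "HOL-Library.Poly_Mapping" "HOL-Library.Set_Algebras"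
begin

section \<open>Polynomials and monomial ideals\<close>

text \<open>
  \<open>R = K[x\<^sub>v | v :: 'v]\<close>, with \<open>'v\<close> a finite type of variables and \<open>K\<close> the type \<open>'k\<close>.
  The ring structure is the convolution product of \<^theory>\<open>HOL-Library.Poly_Mapping\<close>;
  exponent vectors (multidegrees) are elements of \<open>'v \<Rightarrow>\<^sub>0 nat\<close>, and
  \<open>Poly_Mapping.single \<alpha> c\<close> is the term \<open>c x\<^sup>\<alpha>\<close>.
  Regarding \<open>R\<close> as a module over itself, ideals are the submodules (\<open>module.subspace (*)\<close>)
  and the ideal generated by a set is its \<open>module.span (*)\<close>.
\<close>

type_synonym ('v, 'k) mpoly = "('v \<Rightarrow>\<^sub>0 nat) \<Rightarrow>\<^sub>0 'k"

definition monomial :: "('v \<Rightarrow>\<^sub>0 nat) \<Rightarrow> ('v, 'k::comm_ring_1) mpoly"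
  where "monomial \<alpha> = Poly_Mapping.single \<alpha> 1"

definition monomial_ideal :: "('v, 'k::comm_ring_1) mpoly set \<Rightarrow> bool"
  where "monomial_ideal I \<longleftrightarrow> (\<exists>S. I = module.span (*) (monomial ` S))"

text \<open>Here \<open>I * J\<close> is the set of products \<open>a * b\<close> with \<open>a \<in> I\<close> and \<open>b \<in> J\<close>.\<close>

definition ideal_prod ::
  "('v, 'k::comm_ring_1) mpoly set \<Rightarrow> ('v, 'k) mpoly set \<Rightarrow> ('v, 'k) mpoly set"
  where "ideal_prod I J = module.span (*) (I * J)"

definition irrelevant_ideal :: "('v, 'k::comm_ring_1) mpoly set"
  where "irrelevant_ideal = module.span (*) (range (\<lambda>v. monomial (Poly_Mapping.single v 1)))"


section \<open>Multigraded modules\<close>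

text \<open>
  Modules are submodules \<open>M\<close> of some ambient module, given by a type and a scalar multiplication \<open>s\<close>.
\<close>

definition linear_map_on ::
  "('r::comm_ring_1 \<Rightarrow> 'a::ab_group_add \<Rightarrow> 'a) \<Rightarrow> ('r \<Rightarrow> 'b::ab_group_add \<Rightarrow> 'b) \<Rightarrow>
   'a set \<Rightarrow> 'b set \<Rightarrow> ('a \<Rightarrow> 'b) \<Rightarrow> bool"
  where "linear_map_on s s' M N f \<longleftrightarrow>
    (\<forall>x\<in>M. f x \<in> N) \<and>
    (\<forall>x\<in>M. \<forall>y\<in>M. f (x + y) = f x + f y) \<and>
    (\<forall>r. \<forall>x\<in>M. f (s r x) = s' r (f x))"

definition ideal_smult ::
  "('r::comm_ring_1 \<Rightarrow> 'a::ab_group_add \<Rightarrow> 'a) \<Rightarrow> 'r set \<Rightarrow> 'a set \<Rightarrow> 'a set"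
  where "ideal_smult s I M = module.span s {s r x | r x. r \<in> I \<and> x \<in> M}"

text \<open>
  \<open>H \<alpha>\<close> is the homogeneous component \<open>M\<^sub>\<alpha>\<close>, so that \<open>M = \<Oplus>\<^sub>\<alpha> M\<^sub>\<alpha>\<close> and \<open>x\<^sup>\<beta> M\<^sub>\<alpha> \<subseteq> M\<^bsub>\<beta> + \<alpha>\<^esub>\<close>.
\<close>

definition multigraded_module ::
  "(('v, 'k::comm_ring_1) mpoly \<Rightarrow> 'm::ab_group_add \<Rightarrow> 'm) \<Rightarrow> 'm set \<Rightarrow>
   (('v \<Rightarrow>\<^sub>0 nat) \<Rightarrow> 'm set) \<Rightarrow> bool"
  where "multigraded_module s M H \<longleftrightarrow>
    module s \<and> module.subspace s M \<and>
    (\<forall>\<alpha>. H \<alpha> \<subseteq> M \<and> 0 \<in> H \<alpha> \<and> (\<forall>x\<in>H \<alpha>. \<forall>y\<in>H \<alpha>. x + y \<in> H \<alpha>)) \<and>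
    (\<forall>\<alpha> \<beta> c. \<forall>x\<in>H \<alpha>. s (Poly_Mapping.single \<beta> c) x \<in> H (\<beta> + \<alpha>)) \<and>
    (\<forall>x\<in>M. \<exists>!h :: ('v \<Rightarrow>\<^sub>0 nat) \<Rightarrow>\<^sub>0 'm.
       (\<forall>\<alpha>. Poly_Mapping.lookup h \<alpha> \<in> H \<alpha>) \<and>
       x = (\<Sum>\<alpha>\<in>Poly_Mapping.keys h. Poly_Mapping.lookup h \<alpha>))"

definition multigraded_free_module ::
  "(('v, 'k::comm_ring_1) mpoly \<Rightarrow> 'm::ab_group_add \<Rightarrow> 'm) \<Rightarrow> 'm set \<Rightarrow>
   (('v \<Rightarrow>\<^sub>0 nat) \<Rightarrow> 'm set) \<Rightarrow> bool"
  where "multigraded_free_module s M H \<longleftrightarrow>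
    multigraded_module s M H \<and>
    (\<exists>B \<subseteq> (\<Union>\<alpha>. H \<alpha>). \<not> module.dependent s B \<and> module.span s B = M)"


section \<open>Complexes and resolutions\<close>

text \<open>
  A complex \<open>\<cdots> \<rightarrow> C\<^sub>2 \<rightarrow> C\<^sub>1 \<rightarrow> C\<^sub>0\<close>: \<open>chain C i\<close> is \<open>C\<^sub>i\<close>, \<open>hcomp C i \<alpha>\<close> is its component of
  multidegree \<open>\<alpha>\<close>, and \<open>bd C i\<close> is the differential out of \<open>C\<^sub>i\<close>. All \<open>C\<^sub>i\<close> live in one ambient
  module (for instance their direct sum) with scalar multiplication \<open>smul C\<close>.
  The differential out of \<open>C\<^sub>0\<close> is zero by convention; this is why
  \<open>bd C i\<close> may be typed as a map \<open>C\<^sub>i \<rightarrow> C\<^bsub>i - 1\<^esub>\<close> with truncated subtraction.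
\<close>

record (overloaded) ('v, 'k::zero, 'm) mg_complex =
  smul :: "('v, 'k) mpoly \<Rightarrow> 'm \<Rightarrow> 'm"
  chain :: "nat \<Rightarrow> 'm set"
  hcomp :: "nat \<Rightarrow> ('v \<Rightarrow>\<^sub>0 nat) \<Rightarrow> 'm set"
  bd :: "nat \<Rightarrow> 'm \<Rightarrow> 'm"

definition is_mg_complex :: "('v, 'k::comm_ring_1, 'm::ab_group_add) mg_complex \<Rightarrow> bool"
  where "is_mg_complex C \<longleftrightarrow>
    (\<forall>i. multigraded_module (smul C) (chain C i) (hcomp C i)) \<and>
    (\<forall>i. linear_map_on (smul C) (smul C) (chain C i) (chain C (i - 1)) (bd C i)) \<and>
    (\<forall>i \<alpha>. \<forall>x\<in>hcomp C i \<alpha>. bd C i x \<in> hcomp C (i - 1) \<alpha>) \<and>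
    (\<forall>i. \<forall>x\<in>chain C i. bd C (i - 1) (bd C i x) = 0) \<and>
    (\<forall>x\<in>chain C 0. bd C 0 x = 0)"

text \<open>
  \<open>e\<close> is a surjective multidegree-preserving \<open>R\<close>-linear map \<open>M \<rightarrow> R/A\<close> with kernel \<open>N\<close>, where the
  elements of \<open>R/A\<close> are the cosets \<open>a +o A\<close>. The sum of two cosets is their elementwise sum,
  the product of a coset \<open>Z\<close> by a scalar \<open>r\<close> is \<open>r *o Z + A\<close>, the zero coset is \<open>A\<close>, and
  \<open>(R/A)\<^sub>\<alpha>\<close> consists of the cosets of the terms \<open>c x\<^sup>\<alpha>\<close>.
\<close>

definition mg_surj_quotient ::
  "(('v, 'k::comm_ring_1) mpoly \<Rightarrow> 'm::ab_group_add \<Rightarrow> 'm) \<Rightarrow> 'm set \<Rightarrow>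
   (('v \<Rightarrow>\<^sub>0 nat) \<Rightarrow> 'm set) \<Rightarrow> ('v, 'k) mpoly set \<Rightarrow> 'm set \<Rightarrow>
   ('m \<Rightarrow> ('v, 'k) mpoly set) \<Rightarrow> bool"
  where "mg_surj_quotient s M H A N e \<longleftrightarrow>
    e ` M = range (\<lambda>a. a +o A) \<and>
    (\<forall>x\<in>M. \<forall>y\<in>M. e (x + y) = e x + e y) \<and>
    (\<forall>r. \<forall>x\<in>M. e (s r x) = r *o e x + A) \<and>
    (\<forall>\<alpha>. \<forall>x\<in>H \<alpha>. \<exists>c. e x = Poly_Mapping.single \<alpha> c +o A) \<and>
    {x \<in> M. e x = A} = N"

text \<open>Following the usual convention, a resolution of an ideal \<open>A\<close> is a resolution of \<open>R/A\<close>.\<close>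

definition mg_free_resolution ::
  "('v, 'k::comm_ring_1) mpoly set \<Rightarrow> ('v, 'k, 'm::ab_group_add) mg_complex \<Rightarrow> bool"
  where "mg_free_resolution A C \<longleftrightarrow>
    is_mg_complex C \<and>
    (\<forall>i. multigraded_free_module (smul C) (chain C i) (hcomp C i)) \<and>
    (\<forall>i\<ge>1. {x \<in> chain C i. bd C i x = 0} = bd C (i + 1) ` chain C (i + 1)) \<and>
    (\<exists>e. mg_surj_quotient (smul C) (chain C 0) (hcomp C 0) A (bd C 1 ` chain C 1) e)"

definition minimal_mg_free_resolution ::
  "('v, 'k::comm_ring_1) mpoly set \<Rightarrow> ('v, 'k, 'm::ab_group_add) mg_complex \<Rightarrow> bool"
  where "minimal_mg_free_resolution A C \<longleftrightarrow>
    mg_free_resolution A C \<and>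
    (\<forall>i\<ge>1. bd C i ` chain C i \<subseteq> ideal_smult (smul C) irrelevant_ideal (chain C (i - 1)))"


section \<open>Tensor products\<close>

text \<open>
  \<open>free_smul\<close> is the scalar multiplication of the free module \<open>R\<^bsup>(X)\<^esup>\<close> on a set \<open>X\<close>, whose
  elements are the \<open>p :: 'x \<Rightarrow>\<^sub>0 'r\<close> with \<open>Poly_Mapping.keys p \<subseteq> X\<close>.
\<close>

definition free_smul :: "'r::comm_ring_1 \<Rightarrow> ('x \<Rightarrow>\<^sub>0 'r) \<Rightarrow> ('x \<Rightarrow>\<^sub>0 'r)"
  where "free_smul r p = Poly_Mapping.map (\<lambda>c. r * c) p"

text \<open>
  The bilinearity relations in \<open>R\<^bsup>(M \<times> N)\<^esup>\<close>; the tensor product \<open>M \<otimes>\<^sub>R N\<close> is by definition the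
  quotient of \<open>R\<^bsup>(M \<times> N)\<^esup>\<close> by the submodule that they span.
\<close>

definition tensor_relations ::
  "('r::comm_ring_1 \<Rightarrow> 'a::ab_group_add \<Rightarrow> 'a) \<Rightarrow> 'a set \<Rightarrow>
   ('r \<Rightarrow> 'b::ab_group_add \<Rightarrow> 'b) \<Rightarrow> 'b set \<Rightarrow> ('a \<times> 'b \<Rightarrow>\<^sub>0 'r) set"
  where "tensor_relations s M s' N =
    (let g = (\<lambda>x y. Poly_Mapping.single (x, y) 1) in
      {g (x + x') y - g x y - g x' y | x x' y. x \<in> M \<and> x' \<in> M \<and> y \<in> N} \<union>
      {g x (y + y') - g x y - g x y' | x y y'. x \<in> M \<and> y \<in> N \<and> y' \<in> N} \<union>
      {g (s r x) y - free_smul r (g x y) | r x y. x \<in> M \<and> y \<in> N} \<union>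
      {g x (s' r y) - free_smul r (g x y) | r x y. x \<in> M \<and> y \<in> N})"

text \<open>
  The submodule \<open>T\<close> (scalar multiplication \<open>s''\<close>) together with \<open>t x y = x \<otimes> y\<close> is a tensor
  product of \<open>M\<close> and \<open>N\<close>: the linear map \<open>R\<^bsup>(M \<times> N)\<^esup> \<rightarrow> T\<close> sending the generator at \<open>(x, y)\<close> to
  \<open>t x y\<close> is surjective and its kernel is the submodule spanned by the bilinearity relations.
  Equivalently, it induces an isomorphism from the quotient above onto \<open>T\<close>. In particular
  \<open>t\<close> is bilinear on \<open>M \<times> N\<close>.
\<close>

definition is_tensor_product ::
  "('r::comm_ring_1 \<Rightarrow> 'a::ab_group_add \<Rightarrow> 'a) \<Rightarrow> 'a set \<Rightarrow>
   ('r \<Rightarrow> 'b::ab_group_add \<Rightarrow> 'b) \<Rightarrow> 'b set \<Rightarrow>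
   ('r \<Rightarrow> 'c::ab_group_add \<Rightarrow> 'c) \<Rightarrow> 'c set \<Rightarrow> ('a \<Rightarrow> 'b \<Rightarrow> 'c) \<Rightarrow> bool"
  where "is_tensor_product s M s' N s'' T t \<longleftrightarrow>
    (let P = {p :: 'a \<times> 'b \<Rightarrow>\<^sub>0 'r. Poly_Mapping.keys p \<subseteq> M \<times> N};
         \<phi> = (\<lambda>p. \<Sum>z\<in>Poly_Mapping.keys p. s'' (Poly_Mapping.lookup p z) (t (fst z) (snd z)))
     in module s'' \<and> \<phi> ` P = T \<and>
        {p \<in> P. \<phi> p = 0} = module.span free_smul (tensor_relations s M s' N))"

text \<open>
  \<open>T\<close> is (a model of) the complex \<open>F \<otimes>\<^sub>R G\<close>: with \<open>t i j x y = x \<otimes> y\<close> for \<open>x \<in> F\<^sub>i\<close>, \<open>y \<in> G\<^sub>j\<close>,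
  \<^item> \<open>S i j\<close> is a tensor product of \<open>F\<^sub>i\<close> and \<open>G\<^sub>j\<close>, and \<open>T\<^sub>k\<close> is the internal direct sum of
    the \<open>S i j\<close> with \<open>i + j = k\<close>;
  \<^item> \<open>(T\<^sub>k)\<^sub>\<alpha>\<close> is the \<open>K\<close>-span of the \<open>x \<otimes> y\<close> with \<open>x\<close>, \<open>y\<close> homogeneous of degrees adding up
    to \<open>\<alpha>\<close> (\<open>Poly_Mapping.single 0 c\<close> is the constant polynomial \<open>c\<close>);
  \<^item> \<open>d (x \<otimes> y) = d x \<otimes> y + (-1)\<^sup>i x \<otimes> d y\<close>. When \<open>i = 0\<close> or \<open>j = 0\<close> the corresponding summand
    vanishes, since the differential out of degree zero is zero.
\<close>

definition is_tensor_complex ::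
  "('v, 'k::comm_ring_1, 'f::ab_group_add) mg_complex \<Rightarrow> ('v, 'k, 'g::ab_group_add) mg_complex \<Rightarrow>
   ('v, 'k, 'h::ab_group_add) mg_complex \<Rightarrow> bool"
  where "is_tensor_complex F G T \<longleftrightarrow>
    (\<exists>(S :: nat \<Rightarrow> nat \<Rightarrow> 'h set) (t :: nat \<Rightarrow> nat \<Rightarrow> 'f \<Rightarrow> 'g \<Rightarrow> 'h).
      (\<forall>i j. is_tensor_product (smul F) (chain F i) (smul G) (chain G j) (smul T) (S i j) (t i j)) \<and>
      (\<forall>k. chain T k = {\<Sum>i\<le>k. u i | u. \<forall>i\<le>k. u i \<in> S i (k - i)}) \<and>
      (\<forall>k u. (\<forall>i\<le>k. u i \<in> S i (k - i)) \<and> (\<Sum>i\<le>k. u i) = 0 \<longrightarrow> (\<forall>i\<le>k. u i = 0)) \<and>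
      (\<forall>k \<alpha>. hcomp T k \<alpha> =
         module.span (\<lambda>c. smul T (Poly_Mapping.single 0 c))
           {t i j x y | i j x y \<beta> \<gamma>.
              i + j = k \<and> \<beta> + \<gamma> = \<alpha> \<and> x \<in> hcomp F i \<beta> \<and> y \<in> hcomp G j \<gamma>}) \<and>
      (\<forall>k. linear_map_on (smul T) (smul T) (chain T k) (chain T (k - 1)) (bd T k)) \<and>
      (\<forall>i j. \<forall>x\<in>chain F i. \<forall>y\<in>chain G j.
         bd T (i + j) (t i j x y) =
           t (i - 1) j (bd F i x) y + smul T ((- 1) ^ i) (t i (j - 1) x (bd G j y))))"

end

theory Submission
  imports Defs
begin

text \<open>
  Write \<open>I\<close> and \<open>J\<close> as the sets of polynomials with exponents in upsets \<open>A\<close> and \<open>B\<close>. If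
  \<open>IJ = I \<inter> J\<close>, the minimal generators of \<open>I\<close> and \<open>J\<close> involve disjoint sets of variables, so every
  variable is a nonzerodivisor modulo \<open>I\<close> or modulo \<open>J\<close>. Minimality of \<open>F\<close> then forces
  the degrees of its basis elements to avoid the variables that are nonzerodivisors modulo \<open>I\<close>,
  whereas membership in \<open>J\<close> only depends on these variables. Hence \<open>F/JF\<close> is exact in positive
  degrees, that is, \<open>Tor\<^sub>i(R/I, R/J) = 0\<close> for \<open>i \<ge> 1\<close>, and the double complex \<open>F \<otimes> G\<close> with exact rows
  \<open>F\<^sub>i \<otimes> G\<close> gives the acyclicity of the total complex. Minimality of \<open>F \<otimes> G\<close> is inherited from
  that of \<open>F\<close> and \<open>G\<close>.
\<close>


section \<open>Upsets of exponent vectors\<close>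

text \<open>The hypothesis says only that Tor_1(R/I, R/J) = (I \<inter> J)/IJ vanishes. The higher
  Tor vanish because the two ideals separate the variables. With W the variables that are
  nonzerodivisors modulo I, F is extended from a complex F' over the polynomial ring in the
  variables outside W, while J is extended from an ideal J' of K[W]. Thus F/JF is F' tensored over K
  with K[W]/J', and tensoring over a field is exact. In coordinates: a monomial outside J stays
  outside J after multiplication by any term of a matrix entry of F, so the smaller rings never have
  to be constructed. F and G are arbitrary, not an explicit model such as the Taylor complex, so the
  degrees of F can only be controlled through minimality; a nonminimal resolution may have basis
  elements in other degrees. Likewise T is any model of the tensor product, so its bases and the
  maps out of it have to come from the universal property.\<close>

lemma upset_exists_minimal:
  fixes A :: "('v::finite \<Rightarrow> nat) set"
  assumes "a \<in> A"
  obtains m where "m \<in> A" "m \<le> a" "\<And>m'. m' \<in> A \<Longrightarrow> m' \<le> m \<Longrightarrow> m' = m"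
proof -
  let ?P = "\<lambda>m. m \<in> A \<and> m \<le> a"
  \<comment> \<open>Total degree is strictly monotone on a finite set of variables, so an element of
    least degree below \<open>a\<close> has nothing of \<open>A\<close> strictly below it.\<close>
  obtain m where m: "?P m" and min: "\<And>m'. ?P m' \<Longrightarrow> (\<Sum>v\<in>UNIV. m v) \<le> (\<Sum>v\<in>UNIV. m' v)"
    using ex_has_least_nat[of ?P a "\<lambda>m. \<Sum>v\<in>UNIV. m v"] assms by auto
  show thesis
  proof (rule that)
    show "m \<in> A" "m \<le> a" using m by auto
    fix m' assume m': "m' \<in> A" "m' \<le> m"
    have le: "m' v \<le> m v" for v using m'(2) by (simp add: le_fun_def)
    have "(\<Sum>v\<in>UNIV. m v) \<le> (\<Sum>v\<in>UNIV. m' v)"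
      using min m m' by (meson order_trans)
    then have "\<not> (\<exists>v. m' v < m v)"
      using sum_strict_mono_ex1[of UNIV m' m] le by auto
    then show "m' = m" using le by (auto simp: less_le)
  qed
qed

text \<open>
  If the claim fails for \<open>v\<close>, some minimal elements \<open>m\<close> of \<open>A\<close> and \<open>n\<close> of \<open>B\<close> have overlapping
  supports. Take such a pair with \<open>sup m n\<close> of least total degree, and minimal \<open>m'\<close>, \<open>n'\<close> with
  \<open>m' + n' \<le> sup m n\<close>. Leastness makes \<open>m'\<close>, \<open>n'\<close> disjoint and then forces \<open>m' = m\<close>, while
  \<open>m\<close> and \<open>n'\<close> overlap.
\<close>

lemma upset_saturated_cases:
  fixes A B :: "('v::finite \<Rightarrow> nat) set"
  assumes A: "\<And>a a'. a \<in> A \<Longrightarrow> a \<le> a' \<Longrightarrow> a' \<in> A"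
    and B: "\<And>b b'. b \<in> B \<Longrightarrow> b \<le> b' \<Longrightarrow> b' \<in> B"
    and AB: "\<And>c. c \<in> A \<Longrightarrow> c \<in> B \<Longrightarrow> \<exists>a\<in>A. \<exists>b\<in>B. \<forall>v. a v + b v \<le> c v"
  shows "(\<forall>a. a(v := Suc (a v)) \<in> A \<longrightarrow> a \<in> A) \<or> (\<forall>b. b(v := Suc (b v)) \<in> B \<longrightarrow> b \<in> B)"
proof (rule ccontr)
  define minl where "minl X m \<longleftrightarrow> m \<in> X \<and> (\<forall>m'\<in>X. m' \<le> m \<longrightarrow> m' = m)"
    for X :: "('v \<Rightarrow> nat) set" and m
  have ex_minl: "\<exists>m. minl X m \<and> m \<le> a" if "a \<in> X" for X a
    by (rule upset_exists_minimal[OF that]) (auto simp: minl_def)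
  \<comment> \<open>If raising coordinate \<open>v\<close> moves \<open>a\<close> into the upset, a
    minimal element below the raised point must involve \<open>v\<close>; otherwise it would already
    lie below \<open>a\<close>.\<close>
  have occurs: "\<exists>m. minl X m \<and> m v > 0"
    if X: "\<forall>a\<in>X. \<forall>a'\<ge>a. a' \<in> X"
      and a: "a(v := Suc (a v)) \<in> X" "a \<notin> X" for X a
  proof -
    obtain m where m: "minl X m" "m \<le> a(v := Suc (a v))" using ex_minl[OF a(1)] by blast
    have "\<not> m \<le> a" using m(1) X a(2) unfolding minl_def by blast
    moreover have "m w \<le> a w" if "m v = 0" for w
      using le_funD[OF m(2), of w] that by (cases "w = v") auto
    ultimately have "m v > 0" by (auto simp: le_fun_def)
    with m show ?thesis by blast
  qed
  assume "\<not> ?thesis"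
  then obtain a b where "a(v := Suc (a v)) \<in> A" "a \<notin> A" "b(v := Suc (b v)) \<in> B" "b \<notin> B"
    by blast
  moreover have "\<forall>a\<in>A. \<forall>a'\<ge>a. a' \<in> A" "\<forall>b\<in>B. \<forall>b'\<ge>b. b' \<in> B"
    using A B by blast+
  ultimately obtain m0 n0 where "minl A m0" "m0 v > 0" "minl B n0" "n0 v > 0"
    using occurs[of A a] occurs[of B b] by blast
  define P where "P p \<longleftrightarrow> minl A (fst p) \<and> minl B (snd p) \<and> (\<exists>v. fst p v > 0 \<and> snd p v > 0)" for p
  define f where "f p = (\<Sum>v\<in>UNIV. max (fst p v) (snd p v))" for p :: "('v \<Rightarrow> nat) \<times> ('v \<Rightarrow> nat)"
  have "P (m0, n0)" unfolding P_def using \<open>minl A m0\<close> \<open>m0 v > 0\<close> \<open>minl B n0\<close> \<open>n0 v > 0\<close> by auto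
  then obtain p where p: "P p" and least: "\<And>p'. P p' \<Longrightarrow> f p \<le> f p'"
    using ex_has_least_nat[of P "(m0, n0)" f] by blast
  obtain m n where mn: "p = (m, n)" by (cases p)
  define L where "L v = max (m v) (n v)" for v
  have "L \<in> A" "L \<in> B"
    using p A[of m L] B[of n L] unfolding P_def mn minl_def L_def by (auto simp: le_fun_def)
  then obtain a b where ab: "a \<in> A" "b \<in> B" "\<And>v. a v + b v \<le> L v" using AB by blast
  obtain m' n' where m': "minl A m'" "m' \<le> a" and n': "minl B n'" "n' \<le> b"
    using ex_minl[OF ab(1)] ex_minl[OF ab(2)] by auto
  have L: "m' v + n' v \<le> L v" for v
    using ab(3)[of v] le_funD[OF m'(2), of v] le_funD[OF n'(2), of v] by simp
  have fL: "f (m, n) = sum L UNIV" unfolding f_def L_def by simp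
  \<comment> \<open>Leastness in usable form: an overlapping minimal pair whose join is below
    \<open>L\<close> has join exactly \<open>L\<close>.\<close>
  have eq: "max (x v) (y v) = L v" if "P (x, y)" "\<And>v. max (x v) (y v) \<le> L v" for x y v
  proof (rule ccontr)
    assume "max (x v) (y v) \<noteq> L v"
    with that(2)[of v] have "max (x v) (y v) < L v" by (rule le_neq_implies_less)
    then have "(\<Sum>v\<in>UNIV. max (x v) (y v)) < sum L UNIV"
      using that(2) by (intro sum_strict_mono_ex1) auto
    then have "f (x, y) < sum L UNIV" unfolding f_def by simp
    then show False using least[OF that(1)] fL mn by simp
  qed
  \<comment> \<open>If they overlapped, their join would be \<open>L\<close>; but where both are
    positive the join is smaller than the sum, which is at most \<open>L\<close>.\<close>
  have disj: "m' v = 0 \<or> n' v = 0" for v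
  proof (rule ccontr)
    assume c: "\<not> (m' v = 0 \<or> n' v = 0)"
    have "max (m' v) (n' v) = L v"
    proof (rule eq)
      show "P (m', n')" unfolding P_def using c m' n' by auto
      show "max (m' v) (n' v) \<le> L v" for v using L[of v] by simp
    qed
    then show False using L[of v] c by (auto simp: max_def split: if_splits)
  qed
  have mL: "m v \<le> L v" for v unfolding L_def by simp
  have n'L: "n' v \<le> L v" for v using L[of v] by simp
  show False
  proof (cases "\<exists>v. m v > 0 \<and> n' v > 0")
    case True
    have mx: "max (m v) (n' v) = L v" for v
    proof (rule eq)
      show "P (m, n')" unfolding P_def using True p n'(1) by (simp add: P_def mn)
      show "max (m v) (n' v) \<le> L v" for v using mL[of v] n'L[of v] by simp
    qed
    \<comment> \<open>Where \<open>n'\<close> vanishes, \<open>m\<close> equals \<open>L\<close> and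
      so bounds \<open>m'\<close>; elsewhere \<open>m'\<close> vanishes.\<close>
    have "m' v \<le> m v" for v
      using disj[of v] L[of v] mx[of v] by (auto simp: max_def split: if_splits)
    then have "m' = m" using p m'(1) unfolding P_def mn minl_def by (auto simp: le_fun_def)
    then show False using True disj by (metis less_not_refl)
  next
    case False
    \<comment> \<open>Without overlap of \<open>m\<close> and \<open>n'\<close>, \<open>L\<close>
      equals \<open>n\<close> wherever \<open>n'\<close> is positive. So \<open>n'\<close> is
      \<open>n\<close>, which does overlap \<open>m\<close>.\<close>
    have "n' v \<le> n v" for v
    proof (cases "n' v = 0")
      case c: False
      then have "m v = 0" using False by auto
      then show ?thesis using n'L[of v] by (simp add: L_def)
    qed simp
    then have "n' = n" using p n'(1) unfolding P_def mn minl_def by (auto simp: le_fun_def)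
    moreover obtain w where "m w > 0" "n w > 0" using p unfolding P_def mn by auto
    ultimately show False using False by blast
  qed
qed

text \<open>The same dichotomy for finitely supported exponents; with finitely many variables every
  function is one. For ideals it says that x_v is a nonzerodivisor modulo I or modulo J.\<close>

lemma exponent_saturated_cases:
  fixes A B :: "('v::finite \<Rightarrow>\<^sub>0 nat) set"
  assumes A: "\<And>\<alpha> \<beta>. \<alpha> \<in> A \<Longrightarrow> \<alpha> + \<beta> \<in> A" and B: "\<And>\<alpha> \<beta>. \<alpha> \<in> B \<Longrightarrow> \<alpha> + \<beta> \<in> B"
    and AB: "\<And>\<gamma>. \<gamma> \<in> A \<Longrightarrow> \<gamma> \<in> B \<Longrightarrow> \<exists>\<alpha>\<in>A. \<exists>\<beta>\<in>B. \<gamma> = \<alpha> + \<beta>"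
  shows "(\<forall>\<alpha>. \<alpha> + Poly_Mapping.single v 1 \<in> A \<longrightarrow> \<alpha> \<in> A) \<or>
         (\<forall>\<beta>. \<beta> + Poly_Mapping.single v 1 \<in> B \<longrightarrow> \<beta> \<in> B)"
proof -
  let ?l = "Poly_Mapping.lookup :: ('v \<Rightarrow>\<^sub>0 nat) \<Rightarrow> _"
  have surj: "\<exists>\<alpha>. a = ?l \<alpha>" for a :: "'v \<Rightarrow> nat"
    by (rule exI[of _ "Abs_poly_mapping a"]) simp
  have mem: "?l \<alpha> \<in> ?l ` X \<longleftrightarrow> \<alpha> \<in> X" for \<alpha> and X :: "('v \<Rightarrow>\<^sub>0 nat) set"
    by (auto simp: poly_mapping_eq_iff[symmetric])
  have up: "a' \<in> ?l ` X" if X: "\<And>\<alpha> \<beta>. \<alpha> \<in> X \<Longrightarrow> \<alpha> + \<beta> \<in> X" and a: "a \<in> ?l ` X" "a \<le> a'" for X a a'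
  proof -
    obtain \<alpha> where \<alpha>: "\<alpha> \<in> X" "a = ?l \<alpha>" using a by auto
    obtain \<beta> where \<beta>: "(\<lambda>v. a' v - a v) = ?l \<beta>" using surj by blast
    have "a' = ?l (\<alpha> + \<beta>)"
      using a(2) \<alpha>(2) fun_cong[OF \<beta>] by (auto simp: lookup_add le_fun_def fun_eq_iff simp flip: \<beta>)
    then show ?thesis using X[OF \<alpha>(1)] by blast
  qed
  have shift: "(?l \<alpha>)(v := Suc (?l \<alpha> v)) = ?l (\<alpha> + Poly_Mapping.single v 1)" for \<alpha>
    by (auto simp: lookup_add lookup_single fun_eq_iff when_def)
  have "(\<forall>a. a(v := Suc (a v)) \<in> ?l ` A \<longrightarrow> a \<in> ?l ` A) \<or>
        (\<forall>b. b(v := Suc (b v)) \<in> ?l ` B \<longrightarrow> b \<in> ?l ` B)"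
  proof (rule upset_saturated_cases)
    show "a' \<in> ?l ` A" if "a \<in> ?l ` A" "a \<le> a'" for a a' using up[OF A that] .
    show "a' \<in> ?l ` B" if "a \<in> ?l ` B" "a \<le> a'" for a a' using up[OF B that] .
    fix c assume c: "c \<in> ?l ` A" "c \<in> ?l ` B"
    then obtain \<gamma> where \<gamma>: "c = ?l \<gamma>" "\<gamma> \<in> A" by blast
    have "\<gamma> \<in> B" using c(2) mem[of \<gamma> B] \<gamma>(1) by simp
    then obtain \<alpha> \<beta> where "\<alpha> \<in> A" "\<beta> \<in> B" "\<gamma> = \<alpha> + \<beta>" using AB \<gamma>(2) by blast
    then have "?l \<alpha> \<in> ?l ` A" "?l \<beta> \<in> ?l ` B" "\<forall>v. ?l \<alpha> v + ?l \<beta> v \<le> c v"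
      using \<gamma>(1) by (auto simp: lookup_add)
    then show "\<exists>a\<in>?l ` A. \<exists>b\<in>?l ` B. \<forall>v. a v + b v \<le> c v" by blast
  qed
  then show ?thesis using shift mem by (metis (lifting))
qed

text \<open>\<open>\<delta>\<close> only involves variables outside \<open>W\<close>, and saturation
  cancels them one at a time; the induction is on the total degree of
  \<open>\<delta>\<close>.\<close>

lemma saturated_remove_exponent:
  fixes B :: "('v::finite \<Rightarrow>\<^sub>0 nat) set"
  assumes sat: "\<And>v \<beta>. v \<notin> W \<Longrightarrow> \<beta> + Poly_Mapping.single v 1 \<in> B \<Longrightarrow> \<beta> \<in> B"
    and "\<And>v. v \<in> W \<Longrightarrow> Poly_Mapping.lookup \<delta> v = 0" and "\<gamma> + \<delta> \<in> B"
  shows "\<gamma> \<in> B"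
  using assms(2,3)
proof (induction n \<equiv> "\<Sum>v\<in>UNIV. Poly_Mapping.lookup \<delta> v" arbitrary: \<delta>)
  case 0
  then have "\<delta> = 0" by (auto intro: poly_mapping_eqI)
  then show ?case using 0 by simp
next
  case (Suc n)
  then have "\<exists>v. Poly_Mapping.lookup \<delta> v \<noteq> 0"
    by (metis (no_types, lifting) nat.distinct(1) sum.neutral)
  then obtain v where v: "Poly_Mapping.lookup \<delta> v \<noteq> 0" by blast
  define \<delta>' where "\<delta>' = \<delta> - Poly_Mapping.single v 1"
  have \<delta>: "\<delta> = \<delta>' + Poly_Mapping.single v 1"
    using v unfolding \<delta>'_def
    by (intro poly_mapping_eqI) (auto simp: lookup_add lookup_minus lookup_single when_def)
  have "v \<notin> W" using v Suc.prems(1)[of v] by auto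
  moreover have "(\<gamma> + \<delta>') + Poly_Mapping.single v 1 \<in> B" using Suc.prems(2) \<delta> by (simp add: ac_simps)
  ultimately have "\<gamma> + \<delta>' \<in> B" using sat by blast
  moreover have "Suc n = (\<Sum>v\<in>UNIV. Poly_Mapping.lookup \<delta>' v) + 1"
    using Suc.hyps(2) by (subst (asm) \<delta>) (simp add: lookup_add sum.distrib lookup_single when_def)
  moreover have "Poly_Mapping.lookup \<delta>' w = 0" if "w \<in> W" for w
    using Suc.prems(1)[OF that] by (simp add: \<delta>'_def lookup_minus)
  ultimately show ?case using Suc.hyps(1)[of \<delta>'] by simp
qed


section \<open>Monomial ideals\<close>

lemma module_mult: "module ((*) :: 'r::comm_ring_1 \<Rightarrow> 'r \<Rightarrow> 'r)"
  by unfold_locales (auto simp: algebra_simps)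

lemma poly_mapping_sum_single:
  "(\<Sum>\<alpha>\<in>Poly_Mapping.keys f. Poly_Mapping.single \<alpha> (Poly_Mapping.lookup f \<alpha>)) = f"
  by (rule poly_mapping_eqI)
    (auto simp: lookup_sum lookup_single when_def in_keys_iff sum.delta' cong: if_cong)

lemma subspace_keys:
  fixes A :: "'a::comm_monoid_add set"
  assumes "\<And>\<alpha> \<beta>. \<alpha> \<in> A \<Longrightarrow> \<alpha> + \<beta> \<in> A"
  shows "module.subspace (*) {f :: 'a \<Rightarrow>\<^sub>0 'k::comm_ring_1. Poly_Mapping.keys f \<subseteq> A}"
proof (rule module.subspaceI[OF module_mult])
  fix f g :: "'a \<Rightarrow>\<^sub>0 'k" assume "f \<in> {f. Poly_Mapping.keys f \<subseteq> A}" "g \<in> {f. Poly_Mapping.keys f \<subseteq> A}"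
  then show "f + g \<in> {f. Poly_Mapping.keys f \<subseteq> A}"
    using keys_add[of f g] by blast
next
  fix c f :: "'a \<Rightarrow>\<^sub>0 'k" assume f: "f \<in> {f. Poly_Mapping.keys f \<subseteq> A}"
  show "c * f \<in> {f. Poly_Mapping.keys f \<subseteq> A}"
  proof -
    have "\<gamma> \<in> A" if \<gamma>: "\<gamma> \<in> Poly_Mapping.keys (c * f)" for \<gamma>
    proof -
      obtain \<alpha> \<beta> where "\<gamma> = \<beta> + \<alpha>" "\<alpha> \<in> A" using subsetD[OF keys_mult \<gamma>] f by blast
      then show ?thesis using assms by (simp add: add.commute)
    qed
    then show ?thesis by blast
  qed
qed auto

text \<open>\<open>A\<close> consists of the multiples of the generating exponents. Membership
  becomes a condition on each exponent separately, which is what later allows a polynomial to be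
  split into terms inside and outside the ideal.\<close>

lemma monomial_ideal_exponents:
  assumes "monomial_ideal (I :: ('v, 'k::comm_ring_1) mpoly set)"
  obtains A where "\<And>\<alpha> \<beta>. \<alpha> \<in> A \<Longrightarrow> \<alpha> + \<beta> \<in> A" and "I = {f. Poly_Mapping.keys f \<subseteq> A}"
proof -
  interpret R: module "(*) :: ('v, 'k) mpoly \<Rightarrow> _" by (rule module_mult)
  obtain S where S: "I = R.span (monomial ` S)" using assms unfolding monomial_ideal_def by blast
  define A where "A = {\<sigma> + \<beta> | \<sigma> \<beta>. \<sigma> \<in> S}"
  have up: "\<alpha> + \<beta> \<in> A" if "\<alpha> \<in> A" for \<alpha> \<beta>
    using that unfolding A_def by (force simp: add.assoc)
  have "I \<subseteq> {f. Poly_Mapping.keys f \<subseteq> A}"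
    unfolding S
  proof (rule R.span_minimal[OF _ subspace_keys])
    have "\<sigma> \<in> A" if "\<sigma> \<in> S" for \<sigma> unfolding A_def using that by (intro CollectI exI[of _ \<sigma>] exI[of _ 0]) simp
    then show "monomial ` S \<subseteq> {f. Poly_Mapping.keys f \<subseteq> A}" by (auto simp: monomial_def)
  qed (use up in auto)
  moreover have "f \<in> I" if "Poly_Mapping.keys f \<subseteq> A" for f
  proof -
    have "Poly_Mapping.single \<alpha> c \<in> I" if "\<alpha> \<in> A" for \<alpha> c
    proof -
      obtain \<sigma> \<beta> where "\<sigma> \<in> S" "\<alpha> = \<sigma> + \<beta>" using \<open>\<alpha> \<in> A\<close> unfolding A_def by blast
      then have "Poly_Mapping.single \<alpha> c = Poly_Mapping.single \<beta> c * monomial \<sigma>"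
        by (simp add: monomial_def mult_single add.commute)
      then show ?thesis unfolding S using \<open>\<sigma> \<in> S\<close> by (auto intro: R.span_scale R.span_base)
    qed
    then have "(\<Sum>\<alpha>\<in>Poly_Mapping.keys f. Poly_Mapping.single \<alpha> (Poly_Mapping.lookup f \<alpha>)) \<in> I"
      unfolding S using that by (intro R.span_sum) auto
    then show ?thesis by (simp add: poly_mapping_sum_single)
  qed
  ultimately show thesis using that[OF up] by blast
qed

text \<open>The polynomials with all exponents in A + B form an ideal, as \<open>A\<close> absorbs
  further exponents, and this ideal contains all products. It turns IJ = I \<inter> J into a
  splitting of every exponent common to both upsets.\<close>

lemma ideal_prod_exponents:
  fixes A B :: "('v \<Rightarrow>\<^sub>0 nat) set"
  assumes A: "\<And>\<alpha> \<beta>. \<alpha> \<in> A \<Longrightarrow> \<alpha> + \<beta> \<in> A"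
    and "monomial \<gamma> \<in> ideal_prod {f :: ('v, 'k::{comm_ring_1, zero_neq_one}) mpoly. Poly_Mapping.keys f \<subseteq> A}
                              {f. Poly_Mapping.keys f \<subseteq> B}"
  shows "\<exists>\<alpha>\<in>A. \<exists>\<beta>\<in>B. \<gamma> = \<alpha> + \<beta>"
proof -
  interpret R: module "(*) :: ('v, 'k) mpoly \<Rightarrow> _" by (rule module_mult)
  let ?C = "{\<alpha> + \<beta> | \<alpha> \<beta>. \<alpha> \<in> A \<and> \<beta> \<in> B}"
  have "R.subspace {f :: ('v, 'k) mpoly. Poly_Mapping.keys f \<subseteq> ?C}"
  proof (rule subspace_keys)
    fix \<alpha> \<beta> assume "\<alpha> \<in> ?C"
    then obtain a b where "a \<in> A" "b \<in> B" "\<alpha> = a + b" by blast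
    then have "a + \<beta> \<in> A" "b \<in> B" "\<alpha> + \<beta> = (a + \<beta>) + b" using A[of a \<beta>] by (simp_all add: ac_simps)
    then show "\<alpha> + \<beta> \<in> ?C" by blast
  qed
  moreover have "{f :: ('v, 'k) mpoly. Poly_Mapping.keys f \<subseteq> A} * {f. Poly_Mapping.keys f \<subseteq> B}
      \<subseteq> {f. Poly_Mapping.keys f \<subseteq> ?C}"
  proof
    fix h :: "('v, 'k) mpoly"
    assume "h \<in> {f. Poly_Mapping.keys f \<subseteq> A} * {f. Poly_Mapping.keys f \<subseteq> B}"
    then obtain f g where "h = f * g" "Poly_Mapping.keys f \<subseteq> A" "Poly_Mapping.keys g \<subseteq> B"
      by (auto elim!: set_times_elim)
    then show "h \<in> {f. Poly_Mapping.keys f \<subseteq> ?C}" using keys_mult[of f g] by blast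
  qed
  ultimately have "ideal_prod {f :: ('v, 'k) mpoly. Poly_Mapping.keys f \<subseteq> A} {f. Poly_Mapping.keys f \<subseteq> B}
      \<subseteq> {f. Poly_Mapping.keys f \<subseteq> ?C}"
    unfolding ideal_prod_def by (rule R.span_minimal[rotated])
  then have "monomial \<gamma> \<in> {f :: ('v, 'k) mpoly. Poly_Mapping.keys f \<subseteq> ?C}" using assms(2) by blast
  then show ?thesis by (auto simp: monomial_def)
qed

text \<open>The nonzero exponents form an upset that contains the variables. This is how the
  coefficient 1 of a basis element is seen to lie outside the irrelevant ideal.\<close>

lemma irrelevant_ideal_lookup_0:
  assumes "f \<in> irrelevant_ideal"
  shows "Poly_Mapping.lookup f 0 = 0"
proof -
  let ?A = "{\<alpha> :: 'a \<Rightarrow>\<^sub>0 nat. \<alpha> \<noteq> 0}"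
  have "irrelevant_ideal \<subseteq> {f :: ('a, 'b) mpoly. Poly_Mapping.keys f \<subseteq> ?A}"
    unfolding irrelevant_ideal_def
  proof (rule module.span_minimal[OF module_mult _ subspace_keys])
    have "Poly_Mapping.single v (1::nat) \<noteq> 0" for v :: 'a
      by (metis lookup_single_eq lookup_zero zero_neq_one)
    then show "range (\<lambda>v. monomial (Poly_Mapping.single v 1)) \<subseteq> {f :: ('a, 'b) mpoly. Poly_Mapping.keys f \<subseteq> ?A}"
      by (auto simp: monomial_def)
    show "\<alpha> + \<beta> \<in> ?A" if "\<alpha> \<in> ?A" for \<alpha> \<beta> :: "'a \<Rightarrow>\<^sub>0 nat"
    proof -
      obtain v where "Poly_Mapping.lookup \<alpha> v \<noteq> 0" using \<open>\<alpha> \<in> ?A\<close> by (metis (mono_tags) lookup_zero mem_Collect_eq poly_mapping_eqI)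
      then have "Poly_Mapping.lookup (\<alpha> + \<beta>) v \<noteq> Poly_Mapping.lookup 0 v" by (simp add: lookup_add)
      then show ?thesis by auto
    qed
  qed
  then have "Poly_Mapping.keys f \<subseteq> ?A" using assms by blast
  then show ?thesis by (auto simp: in_keys_iff)
qed



section \<open>Submodules and linear maps\<close>

text \<open>Packs the axioms of the ambient module with the closure conditions, so that the facts
  below apply as plain rules to several scalar multiplications at once.\<close>

definition submodule :: "('r::comm_ring_1 \<Rightarrow> 'm::ab_group_add \<Rightarrow> 'm) \<Rightarrow> 'm set \<Rightarrow> bool"
  where "submodule s M \<longleftrightarrow> module s \<and> module.subspace s M"

lemma submodule_module: "submodule s M \<Longrightarrow> module s"
  and submodule_zero: "submodule s M \<Longrightarrow> 0 \<in> M"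
  and submodule_add: "submodule s M \<Longrightarrow> x \<in> M \<Longrightarrow> y \<in> M \<Longrightarrow> x + y \<in> M"
  and submodule_scale: "submodule s M \<Longrightarrow> x \<in> M \<Longrightarrow> s r x \<in> M"
  and submodule_neg: "submodule s M \<Longrightarrow> x \<in> M \<Longrightarrow> - x \<in> M"
  and submodule_diff: "submodule s M \<Longrightarrow> x \<in> M \<Longrightarrow> y \<in> M \<Longrightarrow> x - y \<in> M"
  and submodule_sum: "submodule s M \<Longrightarrow> (\<And>i. i \<in> A \<Longrightarrow> g i \<in> M) \<Longrightarrow> sum g A \<in> M"
  unfolding submodule_def
  by (auto intro: module.subspace_0 module.subspace_add module.subspace_scale module.subspace_neg
      module.subspace_diff module.subspace_sum)

lemma submoduleI:
  assumes "module s" "0 \<in> M" "\<And>x y. x \<in> M \<Longrightarrow> y \<in> M \<Longrightarrow> x + y \<in> M" "\<And>r x. x \<in> M \<Longrightarrow> s r x \<in> M"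
  shows "submodule s M"
  using assms unfolding submodule_def by (auto intro!: module.subspaceI)

lemma submodule_span: "module s \<Longrightarrow> submodule s (module.span s X)"
  unfolding submodule_def by (simp add: module.subspace_span)

lemma span_subset_submodule: "submodule s M \<Longrightarrow> X \<subseteq> M \<Longrightarrow> module.span s X \<subseteq> M"
  unfolding submodule_def by (blast intro: module.span_minimal[THEN subsetD])

lemma linear_map_onD:
  assumes "linear_map_on s s' M N f"
  shows linear_map_on_mem: "x \<in> M \<Longrightarrow> f x \<in> N"
    and linear_map_on_add: "x \<in> M \<Longrightarrow> y \<in> M \<Longrightarrow> f (x + y) = f x + f y"
    and linear_map_on_scale: "x \<in> M \<Longrightarrow> f (s r x) = s' r (f x)"
  using assms unfolding linear_map_on_def by auto

lemma linear_map_onI: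
  assumes "\<And>x. x \<in> M \<Longrightarrow> f x \<in> N" "\<And>x y. x \<in> M \<Longrightarrow> y \<in> M \<Longrightarrow> f (x + y) = f x + f y"
    "\<And>r x. x \<in> M \<Longrightarrow> f (s r x) = s' r (f x)"
  shows "linear_map_on s s' M N f"
  using assms unfolding linear_map_on_def by auto

context
  fixes s :: "'r::comm_ring_1 \<Rightarrow> 'm::ab_group_add \<Rightarrow> 'm" and s' :: "'r \<Rightarrow> 'n::ab_group_add \<Rightarrow> 'n"
    and M :: "'m set" and N :: "'n set" and f :: "'m \<Rightarrow> 'n"
  assumes lin: "linear_map_on s s' M N f" and M: "submodule s M" and s': "module s'"
begin

interpretation s: module s using M by (rule submodule_module)
interpretation s': module s' by (rule s')

lemma linear_map_on_zero: "f 0 = 0"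
  using linear_map_on_scale[OF lin submodule_zero[OF M], of 0] by simp

lemma linear_map_on_neg: "x \<in> M \<Longrightarrow> f (- x) = - f x"
  using linear_map_on_scale[OF lin, of x "- 1"] by simp

lemma linear_map_on_diff: "x \<in> M \<Longrightarrow> y \<in> M \<Longrightarrow> f (x - y) = f x - f y"
  using linear_map_on_add[OF lin, of x "- y"] linear_map_on_neg[of y] submodule_neg[OF M, of y] by simp

lemma linear_map_on_sum: "(\<And>i. i \<in> A \<Longrightarrow> g i \<in> M) \<Longrightarrow> f (sum g A) = (\<Sum>i\<in>A. f (g i))"
proof (induction A rule: infinite_finite_induct)
  case (insert i A)
  then show ?case
    using linear_map_on_add[OF lin, of "g i" "sum g A"] submodule_sum[OF M, of A g] by simp
qed (simp_all add: linear_map_on_zero)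

lemma linear_map_on_vimage: "submodule s' N' \<Longrightarrow> submodule s {x \<in> M. f x \<in> N'}"
  by (intro submoduleI)
    (auto simp: s.module_axioms linear_map_on_zero linear_map_onD[OF lin] submodule_zero
      submodule_add[OF M] submodule_scale[OF M] submodule_add submodule_scale submodule_zero[OF M])

lemma linear_map_on_equalizer:
  assumes g: "linear_map_on s s' M N g" and "g 0 = 0"
  shows "submodule s {x \<in> M. f x = g x}"
  by (intro submoduleI)
    (auto simp: s.module_axioms linear_map_on_zero linear_map_onD[OF lin] linear_map_onD[OF g] assms(2)
      submodule_add[OF M] submodule_scale[OF M] submodule_zero[OF M])

lemma linear_map_on_image: "submodule s' (f ` M)"
proof (intro submoduleI)
  show "0 \<in> f ` M" using linear_map_on_zero submodule_zero[OF M] by (metis imageI)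
  fix x y assume "x \<in> f ` M" "y \<in> f ` M"
  then show "x + y \<in> f ` M"
    using submodule_add[OF M] by (auto simp: linear_map_on_add[OF lin, symmetric])
next
  fix r x assume "x \<in> f ` M"
  then show "s' r x \<in> f ` M"
    using submodule_scale[OF M] by (auto simp: linear_map_on_scale[OF lin, symmetric])
qed (rule s')

end


section \<open>Free modules\<close>

text \<open>\<open>k u x\<close> is the coefficient of \<open>u\<close> at the basis element \<open>e x\<close>.\<close>

locale free_basis = module s for s :: "'r::comm_ring_1 \<Rightarrow> 'm::ab_group_add \<Rightarrow> 'm" +
  fixes M :: "'m set" and X :: "'x set" and e :: "'x \<Rightarrow> 'm" and k :: "'m \<Rightarrow> 'x \<Rightarrow> 'r"
  assumes subspace: "subspace M"
    and basis_mem: "x \<in> X \<Longrightarrow> e x \<in> M"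
    and coord_linear: "linear_map_on s (*) M UNIV (\<lambda>u. k u x)"
    and coord_outside: "u \<in> M \<Longrightarrow> x \<notin> X \<Longrightarrow> k u x = 0"
    and coord_basis: "x \<in> X \<Longrightarrow> k (e x) y = (if y = x then 1 else 0)"
    and coord_finite: "u \<in> M \<Longrightarrow> finite {x. k u x \<noteq> 0}"
    and expand: "u \<in> M \<Longrightarrow> (\<Sum>x | k u x \<noteq> 0. s (k u x) (e x)) = u"
begin

lemma submodule: "submodule s M"
  using subspace module_axioms by (simp add: submodule_def)

lemmas coord_add = linear_map_on_add[OF coord_linear]
  and coord_scale = linear_map_on_scale[OF coord_linear]
  and coord_zero = linear_map_on_zero[OF coord_linear submodule module_mult]
  and coord_diff = linear_map_on_diff[OF coord_linear submodule module_mult]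
  and coord_sum = linear_map_on_sum[OF coord_linear submodule module_mult]

lemma coord_ext: "u \<in> M \<Longrightarrow> v \<in> M \<Longrightarrow> (\<And>x. x \<in> X \<Longrightarrow> k u x = k v x) \<Longrightarrow> u = v"
  using expand[of u] expand[of v] coord_outside by (metis (mono_tags, lifting) Collect_cong sum.cong)

lemma sum_basis_mem: "A \<subseteq> X \<Longrightarrow> (\<Sum>x\<in>A. s (c x) (e x)) \<in> M"
  using basis_mem by (intro submodule_sum[OF submodule] submodule_scale[OF submodule]) auto

lemma coord_sum_basis:
  assumes "finite A" "A \<subseteq> X"
  shows "k (\<Sum>x\<in>A. s (c x) (e x)) y = (if y \<in> A then c y else 0)"
proof -
  have "k (\<Sum>x\<in>A. s (c x) (e x)) y = (\<Sum>x\<in>A. k (s (c x) (e x)) y)"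
    using assms basis_mem by (intro coord_sum) (auto intro: submodule_scale[OF submodule])
  also have "\<dots> = (\<Sum>x\<in>A. if y = x then c x else 0)"
    using assms basis_mem by (intro sum.cong) (auto simp: coord_scale coord_basis)
  finally show ?thesis using assms by simp
qed

lemma basis_induct:
  assumes "submodule s P" "\<And>x. x \<in> X \<Longrightarrow> e x \<in> P"
  shows "M \<subseteq> P"
proof
  fix u assume u: "u \<in> M"
  then have "(\<Sum>x | k u x \<noteq> 0. s (k u x) (e x)) \<in> P"
    using coord_outside[OF u] assms by (intro submodule_sum[OF assms(1)] submodule_scale[OF assms(1)]) auto
  then show "u \<in> P" using expand[OF u] by simp
qed

lemma span_basis: "span (e ` X) = M"
proof
  show "span (e ` X) \<subseteq> M" using basis_mem subspace by (intro span_minimal) auto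
  show "M \<subseteq> span (e ` X)"
    by (rule basis_induct) (auto intro: submodule_span module_axioms span_base)
qed

lemma linear_extension:
  assumes N: "submodule s' N" and g: "\<And>x. x \<in> X \<Longrightarrow> g x \<in> N"
  shows "\<exists>f. linear_map_on s s' M N f \<and> (\<forall>x\<in>X. f (e x) = g x)"
proof -
  interpret s': module s' using N by (rule submodule_module)
  define f where "f u = (\<Sum>x | k u x \<noteq> 0. s' (k u x) (g x))" for u
  \<comment> \<open>The sum may run over any finite superset of the support, so that two vectors can
    be compared over the union of their supports.\<close>
  have f: "f u = (\<Sum>x\<in>A. s' (k u x) (g x))" if "finite A" "{x. k u x \<noteq> 0} \<subseteq> A" for u A
    unfolding f_def using that by (intro sum.mono_neutral_left) auto
  have "linear_map_on s s' M N f"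
  proof (rule linear_map_onI)
    fix u assume u: "u \<in> M"
    show "f u \<in> N"
      unfolding f_def using coord_outside[OF u] g
      by (intro submodule_sum[OF N] submodule_scale[OF N]) auto
    show "f (s r u) = s' r (f u)" for r
    proof -
      have "{x. k (s r u) x \<noteq> 0} \<subseteq> {x. k u x \<noteq> 0}" using u by (auto simp: coord_scale)
      then have "f (s r u) = (\<Sum>x | k u x \<noteq> 0. s' (k (s r u) x) (g x))"
        using f[OF coord_finite[OF u]] by blast
      then show ?thesis by (simp add: coord_scale u f_def s'.scale_sum_right)
    qed
    fix v assume v: "v \<in> M"
    let ?A = "{x. k u x \<noteq> 0} \<union> {x. k v x \<noteq> 0}"
    have A: "finite ?A" using u v by (simp add: coord_finite)
    have "f (u + v) = (\<Sum>x\<in>?A. s' (k (u + v) x) (g x))"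
      by (rule f[OF A]) (auto simp: coord_add u v)
    also have "\<dots> = (\<Sum>x\<in>?A. s' (k u x) (g x)) + (\<Sum>x\<in>?A. s' (k v x) (g x))"
      by (simp add: coord_add u v s'.scale_left_distrib sum.distrib)
    also have "\<dots> = f u + f v" using f[OF A, of u] f[OF A, of v] by simp
    finally show "f (u + v) = f u + f v" .
  qed
  moreover have "f (e x) = g x" if "x \<in> X" for x
    using f[of "{x}" "e x"] coord_basis[OF that] by simp
  ultimately show ?thesis by blast
qed

end

lemma (in module) free_basis_representation:
  assumes "independent B"
  shows "free_basis scale (span B) B (\<lambda>b. b) (representation B)"
proof unfold_locales
  show "linear_map_on scale (*) (span B) UNIV (\<lambda>u. representation B u x)" for x
    by (rule linear_map_onI) (simp_all add: representation_add representation_scale assms)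
qed (use assms in \<open>auto simp: representation_basis finite_representation span_base
      sum_nonzero_representation_eq dest: representation_ne_zero\<close>)


section \<open>Multigraded free modules\<close>

text \<open>Serves two purposes: extracting the homogeneous parts of coefficients, and splitting off
  the terms that lie in a monomial ideal.\<close>

definition restrict_terms :: "('a \<Rightarrow> bool) \<Rightarrow> ('a \<Rightarrow>\<^sub>0 'b::zero) \<Rightarrow> ('a \<Rightarrow>\<^sub>0 'b)"
  where "restrict_terms Q f = Poly_Mapping.mapp (\<lambda>a c. c when Q a) f"

lemma lookup_restrict_terms:
  "Poly_Mapping.lookup (restrict_terms Q f) a = (Poly_Mapping.lookup f a when Q a)"
  by (simp add: restrict_terms_def lookup_mapp when_def in_keys_iff)

lemma module_constants:
  fixes s :: "('v, 'k::comm_ring_1) mpoly \<Rightarrow> 'm::ab_group_add \<Rightarrow> 'm"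
  assumes "module s"
  shows "module (\<lambda>c. s (Poly_Mapping.single 0 c))"
proof -
  interpret module s by fact
  show ?thesis
    by unfold_locales (simp_all add: scale_right_distrib single_add scale_left_distrib mult_single)
qed

text \<open>Homogeneity is read off the coordinates. The existence and uniqueness of homogeneous
  decompositions then become consequences of having a basis with degrees.\<close>

locale graded_free_basis = free_basis s M X e k
  for s :: "('v, 'k::field) mpoly \<Rightarrow> 'm::ab_group_add \<Rightarrow> 'm"
    and M and X :: "'x set" and e and k +
  fixes H :: "('v \<Rightarrow>\<^sub>0 nat) \<Rightarrow> 'm set" and deg :: "'x \<Rightarrow> 'v \<Rightarrow>\<^sub>0 nat"
  assumes component: "H \<alpha> = {u \<in> M. \<forall>x \<gamma>. Poly_Mapping.lookup (k u x) \<gamma> \<noteq> 0 \<longrightarrow> \<gamma> + deg x = \<alpha>}"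
begin

lemma coord_component:
  "u \<in> H \<alpha> \<Longrightarrow> Poly_Mapping.lookup (k u x) \<gamma> \<noteq> 0 \<Longrightarrow> \<gamma> + deg x = \<alpha>"
  by (auto simp: component)

lemma component_mem: "u \<in> H \<alpha> \<Longrightarrow> u \<in> M"
  by (auto simp: component)

lemma basis_component: "x \<in> X \<Longrightarrow> e x \<in> H (deg x)"
  by (auto simp: component basis_mem coord_basis lookup_one when_def split: if_splits)

lemma component_add: "u \<in> H \<alpha> \<Longrightarrow> v \<in> H \<alpha> \<Longrightarrow> u + v \<in> H \<alpha>"
  unfolding component using submodule_add[OF submodule]
  by (auto simp: coord_add lookup_add) (metis add.right_neutral)

lemma component_zero: "0 \<in> H \<alpha>"
  by (auto simp: component coord_zero submodule_zero[OF submodule])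

lemma component_scale: "u \<in> H \<alpha> \<Longrightarrow> s (Poly_Mapping.single \<beta> c) u \<in> H (\<beta> + \<alpha>)"
proof -
  assume u: "u \<in> H \<alpha>"
  have "\<gamma> + deg x = \<beta> + \<alpha>" if "Poly_Mapping.lookup (k (s (Poly_Mapping.single \<beta> c) u) x) \<gamma> \<noteq> 0" for x \<gamma>
  proof -
    have "\<gamma> \<in> Poly_Mapping.keys (Poly_Mapping.single \<beta> c * k u x)"
      using that component_mem[OF u] by (simp add: coord_scale in_keys_iff)
    then obtain \<delta> where "\<gamma> = \<beta> + \<delta>" "\<delta> \<in> Poly_Mapping.keys (k u x)"
      using subsetD[OF keys_mult] by (fastforce split: if_splits)
    then show ?thesis using coord_component[OF u, of x \<delta>] by (simp add: in_keys_iff add.assoc)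
  qed
  then show ?thesis
    using component_mem[OF u] submodule_scale[OF submodule] unfolding component by blast
qed

text \<open>For fixed \<open>x\<close> and \<open>\<gamma>\<close>, only the summand of degree
  \<open>\<gamma> + deg x\<close> contributes to that coefficient. So the coordinates of every
  summand are determined by those of \<open>u\<close>.\<close>

lemma decomposition_iff:
  assumes u: "u \<in> M" and h: "\<And>\<alpha>. Poly_Mapping.lookup h \<alpha> \<in> H \<alpha>"
  shows "u = (\<Sum>\<alpha>\<in>Poly_Mapping.keys h. Poly_Mapping.lookup h \<alpha>) \<longleftrightarrow>
    (\<forall>\<alpha> x \<gamma>. Poly_Mapping.lookup (k (Poly_Mapping.lookup h \<alpha>) x) \<gamma> =
       (Poly_Mapping.lookup (k u x) \<gamma> when \<gamma> + deg x = \<alpha>))" (is "_ = ?sum \<longleftrightarrow> ?R")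
proof -
  have hM: "Poly_Mapping.lookup h \<alpha> \<in> M" for \<alpha> using h component_mem by blast
  have "?sum \<in> M" using hM by (intro submodule_sum[OF submodule])
  have sum: "Poly_Mapping.lookup (k ?sum x) \<gamma> =
      Poly_Mapping.lookup (k (Poly_Mapping.lookup h (\<gamma> + deg x)) x) \<gamma>" for x \<gamma>
  proof -
    have "Poly_Mapping.lookup (k ?sum x) \<gamma> =
        (\<Sum>\<alpha>\<in>Poly_Mapping.keys h. Poly_Mapping.lookup (k (Poly_Mapping.lookup h \<alpha>) x) \<gamma>)"
      by (simp add: coord_sum hM lookup_sum)
    also have "\<dots> = (\<Sum>\<alpha>\<in>Poly_Mapping.keys h. if \<alpha> = \<gamma> + deg x
        then Poly_Mapping.lookup (k (Poly_Mapping.lookup h (\<gamma> + deg x)) x) \<gamma> else 0)"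
      using coord_component[OF h] by (intro sum.cong) auto
    also have "\<dots> = Poly_Mapping.lookup (k (Poly_Mapping.lookup h (\<gamma> + deg x)) x) \<gamma>"
      by (auto simp: in_keys_iff coord_zero)
    finally show ?thesis .
  qed
  show ?thesis
  proof
    assume "u = ?sum"
    then have "Poly_Mapping.lookup (k u x) \<gamma> = Poly_Mapping.lookup (k (Poly_Mapping.lookup h (\<gamma> + deg x)) x) \<gamma>"
      for x \<gamma> using sum by metis
    moreover have "Poly_Mapping.lookup (k (Poly_Mapping.lookup h \<alpha>) x) \<gamma> = 0" if "\<gamma> + deg x \<noteq> \<alpha>" for \<alpha> x \<gamma>
      using coord_component[OF h] that by blast
    ultimately show ?R by (simp add: when_def)
  next
    assume ?R
    then have "Poly_Mapping.lookup (k u x) \<gamma> = Poly_Mapping.lookup (k ?sum x) \<gamma>" for x \<gamma>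
      unfolding sum by simp
    then have "k u x = k ?sum x" for x by (rule poly_mapping_eqI)
    then show "u = ?sum" by (rule coord_ext[OF u \<open>?sum \<in> M\<close>])
  qed
qed

lemma decomposition_ex1:
  assumes u: "u \<in> M"
  shows "\<exists>!h. (\<forall>\<alpha>. Poly_Mapping.lookup h \<alpha> \<in> H \<alpha>) \<and>
    u = (\<Sum>\<alpha>\<in>Poly_Mapping.keys h. Poly_Mapping.lookup h \<alpha>)"
proof (rule ex_ex1I)
  let ?A = "{x. k u x \<noteq> 0}"
  have A: "finite ?A" "?A \<subseteq> X" using coord_finite[OF u] coord_outside[OF u] by auto
  define part where "part \<alpha> = (\<Sum>x\<in>?A. s (restrict_terms (\<lambda>\<gamma>. \<gamma> + deg x = \<alpha>) (k u x)) (e x))" for \<alpha>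
  have partM: "part \<alpha> \<in> M" for \<alpha> unfolding part_def using A by (intro sum_basis_mem)
  have part: "Poly_Mapping.lookup (k (part \<alpha>) x) \<gamma> = (Poly_Mapping.lookup (k u x) \<gamma> when \<gamma> + deg x = \<alpha>)"
    for \<alpha> x \<gamma>
    unfolding part_def using A by (simp add: coord_sum_basis lookup_restrict_terms)
  have partH: "part \<alpha> \<in> H \<alpha>" for \<alpha> unfolding component using partM part by auto
  \<comment> \<open>Only finitely many degrees occur, so the parts can be packed into a finitely
    supported map.\<close>
  have "{\<alpha>. part \<alpha> \<noteq> 0} \<subseteq> (\<Union>x\<in>?A. (\<lambda>\<gamma>. \<gamma> + deg x) ` Poly_Mapping.keys (k u x))"
  proof
    fix \<alpha> assume "\<alpha> \<in> {\<alpha>. part \<alpha> \<noteq> 0}"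
    then obtain x where "k (part \<alpha>) x \<noteq> k 0 x"
      using coord_ext[OF partM submodule_zero[OF submodule], of \<alpha>] by blast
    then obtain \<gamma> where "Poly_Mapping.lookup (k (part \<alpha>) x) \<gamma> \<noteq> 0"
      by (metis coord_zero lookup_zero poly_mapping_eqI)
    then have "Poly_Mapping.lookup (k u x) \<gamma> \<noteq> 0" "\<alpha> = \<gamma> + deg x" by (auto simp: part)
    then show "\<alpha> \<in> (\<Union>x\<in>?A. (\<lambda>\<gamma>. \<gamma> + deg x) ` Poly_Mapping.keys (k u x))"
      by (intro UN_I[of x]) (auto simp: in_keys_iff)
  qed
  then have "finite {\<alpha>. part \<alpha> \<noteq> 0}" by (rule finite_subset) (use A(1) in auto)
  then have l: "Poly_Mapping.lookup (Abs_poly_mapping part) = part" by (rule lookup_Abs_poly_mapping)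
  have "u = (\<Sum>\<alpha>\<in>Poly_Mapping.keys (Abs_poly_mapping part). part \<alpha>)"
    using decomposition_iff[OF u, of "Abs_poly_mapping part", unfolded l, OF partH] part by simp
  then show "\<exists>h. (\<forall>\<alpha>. Poly_Mapping.lookup h \<alpha> \<in> H \<alpha>) \<and> u = (\<Sum>\<alpha>\<in>Poly_Mapping.keys h. Poly_Mapping.lookup h \<alpha>)"
    using partH by (intro exI[of _ "Abs_poly_mapping part"]) (simp add: l)
next
  fix h h' assume h: "(\<forall>\<alpha>. Poly_Mapping.lookup h \<alpha> \<in> H \<alpha>) \<and> u = (\<Sum>\<alpha>\<in>Poly_Mapping.keys h. Poly_Mapping.lookup h \<alpha>)"
    and h': "(\<forall>\<alpha>. Poly_Mapping.lookup h' \<alpha> \<in> H \<alpha>) \<and> u = (\<Sum>\<alpha>\<in>Poly_Mapping.keys h'. Poly_Mapping.lookup h' \<alpha>)"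
  have "k (Poly_Mapping.lookup h \<alpha>) x = k (Poly_Mapping.lookup h' \<alpha>) x" for \<alpha> x
    using decomposition_iff[OF u, of h] decomposition_iff[OF u, of h'] h h'
    by (intro poly_mapping_eqI) auto
  then have "Poly_Mapping.lookup h \<alpha> = Poly_Mapping.lookup h' \<alpha>" for \<alpha>
    using h h' component_mem coord_ext by metis
  then show "h = h'" by (rule poly_mapping_eqI)
qed

lemma multigraded_free: "multigraded_free_module s M H"
proof -
  have "multigraded_module s M H"
    unfolding multigraded_module_def
    using module_axioms subspace component_mem component_zero component_add component_scale decomposition_ex1
    by blast
  moreover have "e ` X \<subseteq> (\<Union>\<alpha>. H \<alpha>)" using basis_component by blast
  moreover have "independent (e ` X)"
    unfolding independent_explicit_module
  proof (intro allI impI)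
    fix t u v assume t: "finite t" "t \<subseteq> e ` X" and sum: "(\<Sum>v\<in>t. s (u v) v) = 0" and v: "v \<in> t"
    \<comment> \<open>Passing to representatives on which \<open>e\<close> is injective allows the
      sum to be reindexed.\<close>
    obtain A where A: "A \<subseteq> X" "inj_on e A" "t = e ` A" using t(2) by (auto simp: subset_image_inj)
    then obtain x where x: "x \<in> A" "v = e x" using v by blast
    have fin: "finite A" using t(1) A by (simp add: finite_image_iff)
    have "(\<Sum>x\<in>A. s (u (e x)) (e x)) = 0" using sum A by (simp add: sum.reindex)
    then show "u v = 0" using coord_sum_basis[OF fin A(1), of "\<lambda>x. u (e x)" x] x by (simp add: coord_zero)
  qed
  ultimately show ?thesis unfolding multigraded_free_module_def using span_basis by blast
qed

end

text \<open>The given \<open>H\<close> is not described by coordinates; the grading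
  \<open>H'\<close> that is has components inside those of \<open>H\<close>. For \<open>u\<close> in
  \<open>H \<alpha>\<close>, the \<open>H'\<close> decomposition and \<open>u\<close> alone in
  degree \<open>\<alpha>\<close> are both \<open>H\<close> decompositions, and uniqueness identifies
  them.\<close>

lemma multigraded_free_module_basis:
  assumes "multigraded_free_module (s :: ('v, 'k::field) mpoly \<Rightarrow> 'm::ab_group_add \<Rightarrow> 'm) M H"
  shows "\<exists>X k deg. graded_free_basis s M X (\<lambda>x. x) k H deg"
proof -
  have g: "multigraded_module s M H" using assms unfolding multigraded_free_module_def by blast
  interpret module s using g unfolding multigraded_module_def by blast
  obtain B where B: "B \<subseteq> (\<Union>\<alpha>. H \<alpha>)" "independent B" "span B = M"
    using assms unfolding multigraded_free_module_def by blast
  obtain deg where deg: "b \<in> H (deg b)" if "b \<in> B" for b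
    using B(1) by (metis (no_types, lifting) UN_E subsetD)
  interpret F: free_basis s M B "\<lambda>b. b" "representation B"
    using free_basis_representation[OF B(2)] B(3) by simp
  have HM: "u \<in> M" if "u \<in> H \<alpha>" for u \<alpha> using that g unfolding multigraded_module_def by blast
  have H0: "0 \<in> H \<alpha>" for \<alpha> using g unfolding multigraded_module_def by blast
  have Hadd: "x + y \<in> H \<alpha>" if "x \<in> H \<alpha>" "y \<in> H \<alpha>" for x y \<alpha>
    using that g unfolding multigraded_module_def by blast
  have Hsc: "s (Poly_Mapping.single \<beta> c) x \<in> H (\<beta> + \<alpha>)" if "x \<in> H \<alpha>" for x \<alpha> \<beta> c
    using that g unfolding multigraded_module_def by blast
  have Hsum: "sum f A \<in> H \<alpha>" if "\<And>i. i \<in> A \<Longrightarrow> f i \<in> H \<alpha>" for f :: "'i \<Rightarrow> 'm" and A \<alpha>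
    using that by (induction A rule: infinite_finite_induct) (auto intro: H0 Hadd)
  define H' where "H' \<alpha> = {u \<in> M. \<forall>x \<gamma>. Poly_Mapping.lookup (representation B u x) \<gamma> \<noteq> 0 \<longrightarrow> \<gamma> + deg x = \<alpha>}" for \<alpha>
  interpret G: graded_free_basis s M B "\<lambda>b. b" "representation B" H' deg
    by unfold_locales (simp add: H'_def)
  have H'H: "u \<in> H \<alpha>" if u: "u \<in> H' \<alpha>" for u \<alpha>
  proof -
    have "s (representation B u b) b \<in> H \<alpha>" if "b \<in> B" for b
    proof -
      let ?r = "representation B u b"
      have "s ?r b = (\<Sum>\<gamma>\<in>Poly_Mapping.keys ?r. s (Poly_Mapping.single \<gamma> (Poly_Mapping.lookup ?r \<gamma>)) b)"
        by (subst (1) poly_mapping_sum_single[of ?r, symmetric]) (rule scale_sum_left)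
      also have "\<dots> \<in> H \<alpha>"
      proof (rule Hsum)
        fix \<gamma> assume "\<gamma> \<in> Poly_Mapping.keys ?r"
        then have "\<gamma> + deg b = \<alpha>" using G.coord_component[OF u] by (simp add: in_keys_iff)
        then show "s (Poly_Mapping.single \<gamma> (Poly_Mapping.lookup ?r \<gamma>)) b \<in> H \<alpha>"
          using Hsc[OF deg[OF that], of \<gamma>] by metis
      qed
      finally show ?thesis .
    qed
    then have "(\<Sum>b | representation B u b \<noteq> 0. s (representation B u b) b) \<in> H \<alpha>"
      using F.coord_outside[OF G.component_mem[OF u]] by (intro Hsum) blast
    then show ?thesis using F.expand[OF G.component_mem[OF u]] by simp
  qed
  have "u \<in> H' \<alpha>" if u: "u \<in> H \<alpha>" for u \<alpha>
  proof -
    let ?D = "\<lambda>h. (\<forall>\<alpha>. Poly_Mapping.lookup h \<alpha> \<in> H \<alpha>) \<and> u = (\<Sum>\<alpha>\<in>Poly_Mapping.keys h. Poly_Mapping.lookup h \<alpha>)"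
    obtain h where h: "\<And>\<alpha>. Poly_Mapping.lookup h \<alpha> \<in> H' \<alpha>"
      and uh: "u = (\<Sum>\<alpha>\<in>Poly_Mapping.keys h. Poly_Mapping.lookup h \<alpha>)"
      using G.decomposition_ex1[OF HM[OF u]] by blast
    have "?D h" using h uh H'H by blast
    moreover have "?D (Poly_Mapping.single \<alpha> u)"
      using u H0 by (auto simp: lookup_single when_def)
    moreover have "\<exists>!h. ?D h"
      using g HM[OF u] unfolding multigraded_module_def by blast
    ultimately have "h = Poly_Mapping.single \<alpha> u" by blast
    then show ?thesis using h[of \<alpha>] by simp
  qed
  then have "H \<alpha> = H' \<alpha>" for \<alpha> using H'H by blast
  then have "graded_free_basis s M B (\<lambda>x. x) (representation B) H deg"
    using G.graded_free_basis_axioms by presburger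
  then show ?thesis by blast
qed



section \<open>Tensor products of modules\<close>

lemma lookup_free_smul: "Poly_Mapping.lookup (free_smul r p) z = r * Poly_Mapping.lookup p z"
  by (simp add: free_smul_def map.rep_eq when_def)

lemma keys_free_smul: "Poly_Mapping.keys (free_smul r p) \<subseteq> Poly_Mapping.keys p"
  by (auto simp: in_keys_iff lookup_free_smul)

lemma module_free_smul: "module (free_smul :: 'r::comm_ring_1 \<Rightarrow> ('x \<Rightarrow>\<^sub>0 'r) \<Rightarrow> _)"
  by unfold_locales
    (auto intro!: poly_mapping_eqI simp: lookup_free_smul lookup_add algebra_simps)

text \<open>With \<open>t (fst z) (snd z)\<close> for \<open>g z\<close> this is the map whose image
  and kernel are prescribed by \<open>is_tensor_product\<close>.\<close>

definition free_eval ::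
  "('r::comm_ring_1 \<Rightarrow> 'm::ab_group_add \<Rightarrow> 'm) \<Rightarrow> ('x \<Rightarrow> 'm) \<Rightarrow> ('x \<Rightarrow>\<^sub>0 'r) \<Rightarrow> 'm"
  where "free_eval s g p = (\<Sum>z\<in>Poly_Mapping.keys p. s (Poly_Mapping.lookup p z) (g z))"

context module
begin

lemma free_eval_superset:
  "finite A \<Longrightarrow> Poly_Mapping.keys p \<subseteq> A \<Longrightarrow>
   free_eval scale g p = (\<Sum>z\<in>A. scale (Poly_Mapping.lookup p z) (g z))"
  unfolding free_eval_def by (intro sum.mono_neutral_left) (auto simp: in_keys_iff)

lemma free_eval_single: "free_eval scale g (Poly_Mapping.single z c) = scale c (g z)"
  by (subst free_eval_superset[of "{z}"]) auto

lemma free_eval_linear: "linear_map_on free_smul scale UNIV UNIV (free_eval scale g)"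
  for g :: "'x \<Rightarrow> 'b"
proof (rule linear_map_onI)
  fix p q :: "'x \<Rightarrow>\<^sub>0 'a" and r
  let ?A = "Poly_Mapping.keys p \<union> Poly_Mapping.keys q"
  show "free_eval scale g (p + q) = free_eval scale g p + free_eval scale g q"
    using keys_add[of p q]
    by (simp add: free_eval_superset[of ?A] lookup_add scale_left_distrib sum.distrib)
  show "free_eval scale g (free_smul r p) = scale r (free_eval scale g p)"
    using keys_free_smul[of r p]
    by (simp add: free_eval_superset[of "Poly_Mapping.keys p"] lookup_free_smul scale_sum_right)
qed simp

lemma submodule_UNIV: "submodule scale UNIV"
  by (simp add: submodule_def module_axioms)

end

section \<open>Bilinear maps and the universal property of the tensor product\<close>

definition bilinear_on ::
  "('r::comm_ring_1 \<Rightarrow> 'a::ab_group_add \<Rightarrow> 'a) \<Rightarrow> 'a set \<Rightarrow> ('r \<Rightarrow> 'b::ab_group_add \<Rightarrow> 'b) \<Rightarrow> 'b set \<Rightarrow>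
   ('r \<Rightarrow> 'c::ab_group_add \<Rightarrow> 'c) \<Rightarrow> 'c set \<Rightarrow> ('a \<Rightarrow> 'b \<Rightarrow> 'c) \<Rightarrow> bool"
  where "bilinear_on s M s' N s'' P b \<longleftrightarrow>
    (\<forall>y\<in>N. linear_map_on s s'' M P (\<lambda>x. b x y)) \<and> (\<forall>x\<in>M. linear_map_on s' s'' N P (b x))"

locale tensor_product =
  fixes s :: "'r::comm_ring_1 \<Rightarrow> 'a::ab_group_add \<Rightarrow> 'a" and M :: "'a set"
    and s' :: "'r \<Rightarrow> 'b::ab_group_add \<Rightarrow> 'b" and N :: "'b set"
    and s'' :: "'r \<Rightarrow> 'c::ab_group_add \<Rightarrow> 'c" and S :: "'c set" and t :: "'a \<Rightarrow> 'b \<Rightarrow> 'c"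
  assumes tensor: "is_tensor_product s M s' N s'' S t"
    and left: "submodule s M" and right: "submodule s' N"
begin

abbreviation "supported \<equiv> {p :: 'a \<times> 'b \<Rightarrow>\<^sub>0 'r. Poly_Mapping.keys p \<subseteq> M \<times> N}"
abbreviation "eval_t \<equiv> free_eval s'' (\<lambda>z. t (fst z) (snd z))"

sublocale module s''
  using tensor unfolding is_tensor_product_def by (simp add: Let_def)

lemma image_eval_t: "eval_t ` supported = S"
  and kernel_eval_t: "{p \<in> supported. eval_t p = 0} = module.span free_smul (tensor_relations s M s' N)"
  using tensor unfolding is_tensor_product_def free_eval_def by (simp_all add: Let_def)

lemma submodule_supported: "submodule free_smul supported"
  by (intro submoduleI module_free_smul)
    (auto dest!: subsetD[OF keys_add] subsetD[OF keys_free_smul])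

lemma eval_t_linear_on: "linear_map_on free_smul s'' supported UNIV eval_t"
  using free_eval_linear[of "\<lambda>z. t (fst z) (snd z)"] unfolding linear_map_on_def by auto

lemma submodule_S: "submodule s'' S"
  using linear_map_on_image[OF eval_t_linear_on submodule_supported module_axioms] image_eval_t by simp

lemma tensor_mem:
  assumes "x \<in> M" "y \<in> N"
  shows "t x y \<in> S"
proof -
  have "eval_t (Poly_Mapping.single (x, y) 1) \<in> S"
    unfolding image_eval_t[symmetric] using assms by (intro imageI) simp
  then show ?thesis by (simp add: free_eval_single)
qed

lemma tensor_induct:
  assumes "submodule s'' Q" "\<And>x y. x \<in> M \<Longrightarrow> y \<in> N \<Longrightarrow> t x y \<in> Q"
  shows "S \<subseteq> Q"
proof
  fix w assume "w \<in> S"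
  then obtain p where "p \<in> supported" "w = eval_t p" using image_eval_t by auto
  then show "w \<in> Q"
    unfolding free_eval_def using assms(2)
    by (auto intro!: submodule_sum[OF assms(1)] submodule_scale[OF assms(1)])
qed

lemma relation_eval:
  "p \<in> tensor_relations s M s' N \<Longrightarrow> eval_t p = 0"
  using kernel_eval_t module.span_superset[OF module_free_smul] by blast

lemmas free_eval_simps =
  linear_map_on_diff[OF free_eval_linear module.submodule_UNIV[OF module_free_smul] module_axioms UNIV_I UNIV_I]
  linear_map_on_scale[OF free_eval_linear UNIV_I] free_eval_single

text \<open>Each law is the vanishing of \<open>eval_t\<close> on the corresponding
  relation.\<close>

lemma tensor_bilinear: "bilinear_on s M s' N s'' S t"
  unfolding bilinear_on_def
proof (intro conjI ballI linear_map_onI)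
  let ?g = "\<lambda>x y. Poly_Mapping.single (x, y) (1::'r)"
  fix y assume y: "y \<in> N"
  fix x assume x: "x \<in> M"
  show "t x y \<in> S" "t x y \<in> S" using x y by (simp_all add: tensor_mem)
  fix r
  have "?g (s r x) y - free_smul r (?g x y) \<in> tensor_relations s M s' N"
    unfolding tensor_relations_def Let_def using x y by blast
  from relation_eval[OF this] show "t (s r x) y = s'' r (t x y)" by (simp add: free_eval_simps)
  have "?g x (s' r y) - free_smul r (?g x y) \<in> tensor_relations s M s' N"
    unfolding tensor_relations_def Let_def using x y by blast
  from relation_eval[OF this] show "t x (s' r y) = s'' r (t x y)" by (simp add: free_eval_simps)
next
  let ?g = "\<lambda>x y. Poly_Mapping.single (x, y) (1::'r)"
  fix x x' y assume xy: "x \<in> M" "x' \<in> M" "y \<in> N"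
  have "?g (x + x') y - ?g x y - ?g x' y \<in> tensor_relations s M s' N"
    unfolding tensor_relations_def Let_def using xy by blast
  from relation_eval[OF this] have "t (x + x') y - t x y - t x' y = 0" by (simp add: free_eval_simps)
  then show "t (x + x') y = t x y + t x' y" by (simp add: algebra_simps)
next
  let ?g = "\<lambda>x y. Poly_Mapping.single (x, y) (1::'r)"
  fix x y y' assume xy: "x \<in> M" "y \<in> N" "y' \<in> N"
  have "?g x (y + y') - ?g x y - ?g x y' \<in> tensor_relations s M s' N"
    unfolding tensor_relations_def Let_def using xy by blast
  from relation_eval[OF this] have "t x (y + y') - t x y - t x y' = 0" by (simp add: free_eval_simps)
  then show "t x (y + y') = t x y + t x y'" by (simp add: algebra_simps)
qed

lemma tensor_linear_left: "y \<in> N \<Longrightarrow> linear_map_on s s'' M S (\<lambda>x. t x y)"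
  and tensor_linear_right: "x \<in> M \<Longrightarrow> linear_map_on s' s'' N S (t x)"
  using tensor_bilinear unfolding bilinear_on_def by auto

lemmas tensor_scale_left = linear_map_on_scale[OF tensor_linear_left]
  and tensor_scale_right = linear_map_on_scale[OF tensor_linear_right]
  and tensor_zero_left = linear_map_on_zero[OF tensor_linear_left left module_axioms]
  and tensor_zero_right = linear_map_on_zero[OF tensor_linear_right right module_axioms]
  and tensor_add_right = linear_map_on_add[OF tensor_linear_right]
  and tensor_sum_left = linear_map_on_sum[OF tensor_linear_left left module_axioms]
  and tensor_sum_right = linear_map_on_sum[OF tensor_linear_right right module_axioms]

text \<open>The universal property: a bilinear map kills the relations and hence the whole kernel of
  \<open>eval_t\<close>, so evaluating a chosen preimage does not depend on the choice.\<close>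

lemma tensor_lift:
  fixes s3 :: "'r \<Rightarrow> 'd::ab_group_add \<Rightarrow> 'd"
  assumes b: "bilinear_on s M s' N s3 P b" and P: "submodule s3 P"
  shows "\<exists>f. linear_map_on s'' s3 S P f \<and> (\<forall>x\<in>M. \<forall>y\<in>N. f (t x y) = b x y)"
proof -
  interpret s3: module s3 using P by (rule submodule_module)
  let ?e = "free_eval s3 (\<lambda>z. b (fst z) (snd z))"
  note lin_e = s3.free_eval_linear[of "\<lambda>z. b (fst z) (snd z)"]
  note e_simps = linear_map_on_diff[OF lin_e module.submodule_UNIV[OF module_free_smul] s3.module_axioms UNIV_I UNIV_I]
    linear_map_on_scale[OF lin_e UNIV_I] s3.free_eval_single
  have bl: "\<And>y. y \<in> N \<Longrightarrow> linear_map_on s s3 M P (\<lambda>x. b x y)"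
    and br: "\<And>x. x \<in> M \<Longrightarrow> linear_map_on s' s3 N P (b x)"
    using b unfolding bilinear_on_def by auto
  have "module.span free_smul (tensor_relations s M s' N) \<subseteq> {p \<in> UNIV. ?e p \<in> {0}}"
  proof (rule span_subset_submodule)
    show "submodule free_smul {p \<in> UNIV. ?e p \<in> {0}}"
      by (rule linear_map_on_vimage[OF lin_e module.submodule_UNIV[OF module_free_smul] s3.module_axioms])
        (simp add: submodule_def s3.module_axioms)
    show "tensor_relations s M s' N \<subseteq> {p \<in> UNIV. ?e p \<in> {0}}"
      unfolding tensor_relations_def Let_def
      by (auto simp: e_simps linear_map_on_add[OF bl] linear_map_on_add[OF br]
          linear_map_on_scale[OF bl] linear_map_on_scale[OF br])
  qed
  then have ker: "?e p = 0" if "p \<in> supported" "eval_t p = 0" for p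
    using that kernel_eval_t by blast
  define f where "f w = ?e (SOME p. p \<in> supported \<and> eval_t p = w)" for w
  have f: "f (eval_t p) = ?e p" if p: "p \<in> supported" for p
  proof -
    let ?q = "SOME q. q \<in> supported \<and> eval_t q = eval_t p"
    have q: "?q \<in> supported \<and> eval_t ?q = eval_t p" by (rule someI[of _ p]) (use p in simp)
    then have "p - ?q \<in> supported" using submodule_diff[OF submodule_supported] p by blast
    moreover have "eval_t (p - ?q) = 0" using q by (simp add: free_eval_simps)
    ultimately have "?e (p - ?q) = 0" by (rule ker)
    then show ?thesis unfolding f_def by (simp add: e_simps)
  qed
  have "linear_map_on s'' s3 S P f"
  proof (rule linear_map_onI)
    fix w assume "w \<in> S"
    then obtain p where p: "p \<in> supported" "w = eval_t p" using image_eval_t by auto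
    show "f w \<in> P"
      unfolding p(2) f[OF p(1)] unfolding free_eval_def using p(1) linear_map_on_mem[OF bl]
      by (auto intro!: submodule_sum[OF P] submodule_scale[OF P])
    show "f (s'' r w) = s3 r (f w)" for r
      using f[OF submodule_scale[OF submodule_supported p(1)], of r] f[OF p(1)] p(2)
      by (simp add: e_simps free_eval_simps)
    fix w' assume "w' \<in> S"
    then obtain p' where p': "p' \<in> supported" "w' = eval_t p'" using image_eval_t by auto
    show "f (w + w') = f w + f w'"
      using f[OF submodule_add[OF submodule_supported p(1) p'(1)]] f[OF p(1)] f[OF p'(1)] p(2) p'(2)
      by (simp add: linear_map_on_add[OF lin_e] linear_map_on_add[OF free_eval_linear])
  qed
  moreover have "f (t x y) = b x y" if "x \<in> M" "y \<in> N" for x y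
    using f[of "Poly_Mapping.single (x, y) 1"] that by (simp add: free_eval_simps e_simps)
  ultimately show ?thesis by blast
qed

text \<open>The equalizer is a submodule that contains the generating pure tensors. Identities
  between maps out of \<open>S\<close> are checked through this rule; the codomains may differ
  because values are compared in the ambient module.\<close>

lemma tensor_map_eq:
  fixes s3 :: "'r \<Rightarrow> 'd::ab_group_add \<Rightarrow> 'd"
  assumes f: "linear_map_on s'' s3 S P f" and g: "linear_map_on s'' s3 S P' g" and "module s3"
    and eq: "\<And>x y. x \<in> M \<Longrightarrow> y \<in> N \<Longrightarrow> f (t x y) = g (t x y)" and w: "w \<in> S"
  shows "f w = g w"
proof -
  have f': "linear_map_on s'' s3 S UNIV f" and g': "linear_map_on s'' s3 S UNIV g"
    using f g unfolding linear_map_on_def by auto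
  have "submodule s'' {w \<in> S. f w = g w}"
    by (rule linear_map_on_equalizer[OF f' submodule_S assms(3) g'])
      (rule linear_map_on_zero[OF g' submodule_S assms(3)])
  then have "S \<subseteq> {w \<in> S. f w = g w}"
    by (rule tensor_induct) (use eq tensor_mem in blast)
  then show ?thesis using w by blast
qed

end

section \<open>Tensor products with a free left factor\<close>

locale tensor_free_left = tensor_product s M s' N s'' S t + M: free_basis s M X e k
  for s :: "'r::comm_ring_1 \<Rightarrow> 'a::ab_group_add \<Rightarrow> 'a" and M s' N s'' S t
    and X :: "'x set" and e k
begin

text \<open>\<open>S\<close> is the direct sum of copies \<open>e x \<otimes> N\<close> of \<open>N\<close>, and \<open>slice x\<close> is the projection onto
  the copy indexed by \<open>x\<close>.\<close>

definition slice :: "'x \<Rightarrow> 'c \<Rightarrow> 'b"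
  where "slice = (SOME f. \<forall>x. linear_map_on s'' s' S N (f x) \<and>
    (\<forall>m\<in>M. \<forall>n\<in>N. f x (t m n) = s' (k m x) n))"

interpretation s': module s' using right by (rule submodule_module)

text \<open>Taking the coordinate of the left factor at \<open>x\<close> and letting it act on the
  right factor is bilinear, so it factors through the tensor product.\<close>

lemma slice_props:
  "linear_map_on s'' s' S N (slice x) \<and> (\<forall>m\<in>M. \<forall>n\<in>N. slice x (t m n) = s' (k m x) n)"
proof -
  have "bilinear_on s M s' N s' N (\<lambda>m n. s' (k m x) n)" for x
    unfolding bilinear_on_def
    by (auto intro!: linear_map_onI submodule_scale[OF right] submodule_add[OF right]
        simp: M.coord_add M.coord_scale algebra_simps)
  then have "\<exists>f. \<forall>x. linear_map_on s'' s' S N (f x) \<and> (\<forall>m\<in>M. \<forall>n\<in>N. f x (t m n) = s' (k m x) n)"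
    using tensor_lift[OF _ right] by (intro choice allI) blast
  then show ?thesis unfolding slice_def by (rule someI2_ex) blast
qed

lemma slice_linear: "linear_map_on s'' s' S N (slice x)"
  and slice_tensor: "m \<in> M \<Longrightarrow> n \<in> N \<Longrightarrow> slice x (t m n) = s' (k m x) n"
  using slice_props by auto

lemmas slice_mem = linear_map_on_mem[OF slice_linear]
  and slice_add = linear_map_on_add[OF slice_linear]
  and slice_scale = linear_map_on_scale[OF slice_linear]
  and slice_zero = linear_map_on_zero[OF slice_linear submodule_S s'.module_axioms]

lemma slice_outside: "w \<in> S \<Longrightarrow> x \<notin> X \<Longrightarrow> slice x w = 0"
proof (rule tensor_map_eq[OF slice_linear _ s'.module_axioms, where P' = N and g = "\<lambda>_. 0"])
  show "linear_map_on s'' s' S N (\<lambda>_. 0)" by (rule linear_map_onI) (simp_all add: submodule_zero[OF right])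
qed (simp_all add: slice_tensor M.coord_outside)

lemma slice_support: "w \<in> S \<Longrightarrow> {x. slice x w \<noteq> 0} \<subseteq> X"
  using slice_outside by auto

lemma slice_expand_superset_iff:
  assumes "w \<in> S" "finite A" "{x. slice x w \<noteq> 0} \<subseteq> A" "A \<subseteq> X"
  shows "(\<Sum>x\<in>A. t (e x) (slice x w)) = (\<Sum>x | slice x w \<noteq> 0. t (e x) (slice x w))"
  using assms M.basis_mem tensor_zero_right by (intro sum.mono_neutral_right) auto

text \<open>Finiteness of the support belongs to the inductive claim, since a sum over an infinite
  set would be 0. Sums are compared over the union of the two supports.\<close>

lemma slice_expand_aux:
  "S \<subseteq> {w \<in> S. finite {x. slice x w \<noteq> 0} \<and> (\<Sum>x | slice x w \<noteq> 0. t (e x) (slice x w)) = w}"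
  (is "_ \<subseteq> ?Q")
proof (rule tensor_induct)
  show "submodule s'' ?Q"
  proof (rule submoduleI)
    show "0 \<in> ?Q" by (simp add: slice_zero submodule_zero[OF submodule_S])
    fix u assume u: "u \<in> ?Q"
    show "s'' r u \<in> ?Q" for r
    proof -
      have sub: "{x. slice x (s'' r u) \<noteq> 0} \<subseteq> {x. slice x u \<noteq> 0}" using u by (auto simp: slice_scale)
      have "(\<Sum>x | slice x (s'' r u) \<noteq> 0. t (e x) (slice x (s'' r u))) =
          (\<Sum>x | slice x u \<noteq> 0. t (e x) (slice x (s'' r u)))"
        using u sub slice_support[of u] submodule_scale[OF submodule_S]
        by (intro slice_expand_superset_iff[symmetric]) auto
      also have "\<dots> = (\<Sum>x | slice x u \<noteq> 0. s'' r (t (e x) (slice x u)))"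
        using u slice_support[of u] M.basis_mem
        by (intro sum.cong) (auto simp: slice_scale tensor_scale_right slice_mem)
      also have "\<dots> = s'' r u" using u by (simp add: scale_sum_right[symmetric])
      finally show ?thesis
        using u finite_subset[OF sub] submodule_scale[OF submodule_S] by auto
    qed
    fix v assume v: "v \<in> ?Q"
    let ?A = "{x. slice x u \<noteq> 0} \<union> {x. slice x v \<noteq> 0}"
    have uv: "u + v \<in> S" using u v submodule_add[OF submodule_S] by auto
    have sub: "{x. slice x (u + v) \<noteq> 0} \<subseteq> ?A" using u v by (auto simp: slice_add)
    have A: "finite ?A" "?A \<subseteq> X" using u v slice_support[of u] slice_support[of v] by auto
    have "(\<Sum>x | slice x (u + v) \<noteq> 0. t (e x) (slice x (u + v))) = (\<Sum>x\<in>?A. t (e x) (slice x (u + v)))"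
      using uv sub A by (intro slice_expand_superset_iff[symmetric]) auto
    also have "\<dots> = (\<Sum>x\<in>?A. t (e x) (slice x u) + t (e x) (slice x v))"
    proof (rule sum.cong)
      fix x assume "x \<in> ?A"
      then have "e x \<in> M" using A(2) M.basis_mem by blast
      then show "t (e x) (slice x (u + v)) = t (e x) (slice x u) + t (e x) (slice x v)"
        using u v by (simp add: slice_add tensor_add_right slice_mem)
    qed simp
    also have "\<dots> = u + v"
      using u v A slice_expand_superset_iff[of u ?A] slice_expand_superset_iff[of v ?A]
      by (simp add: sum.distrib)
    finally show "u + v \<in> ?Q" using uv finite_subset[OF sub A(1)] by blast
  qed (rule module_axioms)
next
  fix m n assume mn: "m \<in> M" "n \<in> N"
  have sub: "{x. slice x (t m n) \<noteq> 0} \<subseteq> {x. k m x \<noteq> 0}" using mn by (auto simp: slice_tensor)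
  have A: "finite {x. k m x \<noteq> 0}" "{x. k m x \<noteq> 0} \<subseteq> X"
    using mn M.coord_finite M.coord_outside by auto
  have "(\<Sum>x | slice x (t m n) \<noteq> 0. t (e x) (slice x (t m n))) = (\<Sum>x | k m x \<noteq> 0. t (e x) (slice x (t m n)))"
    using mn tensor_mem sub A by (intro slice_expand_superset_iff[symmetric]) auto
  \<comment> \<open>The coefficient moves across the tensor sign, after which the expansion of
    \<open>m\<close> can be reassembled in the left factor.\<close>
  also have "\<dots> = (\<Sum>x | k m x \<noteq> 0. t (s (k m x) (e x)) n)"
  proof (rule sum.cong)
    fix x assume "x \<in> {x. k m x \<noteq> 0}"
    then have "e x \<in> M" using A(2) M.basis_mem by blast
    then show "t (e x) (slice x (t m n)) = t (s (k m x) (e x)) n"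
      using mn by (simp add: slice_tensor tensor_scale_right tensor_scale_left)
  qed simp
  also have "\<dots> = t (\<Sum>x | k m x \<noteq> 0. s (k m x) (e x)) n"
    using mn A M.basis_mem submodule_scale[OF left] by (intro tensor_sum_left[symmetric]) auto
  also have "\<dots> = t m n" using mn by (simp add: M.expand)
  finally show "t m n \<in> ?Q" using mn tensor_mem finite_subset[OF sub A(1)] by blast
qed

lemma slice_finite: "w \<in> S \<Longrightarrow> finite {x. slice x w \<noteq> 0}"
  and slice_expand: "w \<in> S \<Longrightarrow> (\<Sum>x | slice x w \<noteq> 0. t (e x) (slice x w)) = w"
  using slice_expand_aux by auto

text \<open>Expanding first into slices and then each slice in the basis of \<open>N\<close> gives
  the double sum over the product basis.\<close>

lemma free_basis_tensor:
  assumes "free_basis s' N Y e' k'"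
  shows "free_basis s'' S (X \<times> Y) (\<lambda>(x, y). t (e x) (e' y)) (\<lambda>w (x, y). k' (slice x w) y)"
proof -
  interpret N: free_basis s' N Y e' k' by fact
  have supp: "{(x, y). k' (slice x w) y \<noteq> 0} =
      (SIGMA x:{x. slice x w \<noteq> 0}. {y. k' (slice x w) y \<noteq> 0})" for w
    by (auto simp: N.coord_zero)
  show ?thesis
  proof unfold_locales
    show "subspace S" using submodule_S by (simp add: submodule_def)
    fix z assume z: "z \<in> X \<times> Y"
    show "(\<lambda>(x, y). t (e x) (e' y)) z \<in> S"
      using z by (auto intro: tensor_mem M.basis_mem N.basis_mem)
    show "(\<lambda>(x, y). k' (slice x ((\<lambda>(x, y). t (e x) (e' y)) z)) y) z' = (if z' = z then 1 else 0)" for z'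
      using z by (cases z') (auto simp: slice_tensor M.basis_mem N.basis_mem M.coord_basis N.coord_basis
          N.coord_zero N.coord_scale split: if_splits)
  next
    show "linear_map_on s'' (*) S UNIV (\<lambda>w. (\<lambda>(x, y). k' (slice x w) y) z)" for z
      by (cases z) (auto intro!: linear_map_onI simp: slice_add slice_scale N.coord_add N.coord_scale slice_mem)
  next
    fix w assume w: "w \<in> S"
    show "(\<lambda>(x, y). k' (slice x w) y) z = 0" if "z \<notin> X \<times> Y" for z
      using that slice_outside[OF w, of "fst z"] N.coord_outside[OF slice_mem[OF w], of "snd z" "fst z"]
      by (cases z; cases "fst z \<in> X") (auto simp: N.coord_zero)
    have fin: "finite {y. k' (slice x w) y \<noteq> 0}" for x using w by (simp add: N.coord_finite slice_mem)
    show "finite {z. (\<lambda>(x, y). k' (slice x w) y) z \<noteq> 0}"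
    proof -
      have "finite (SIGMA x:{x. slice x w \<noteq> 0}. {y. k' (slice x w) y \<noteq> 0})"
        by (intro finite_SigmaI slice_finite[OF w] fin)
      then show ?thesis by (rule finite_subset[rotated]) (auto simp: N.coord_zero)
    qed
    have "(\<Sum>z | (\<lambda>(x, y). k' (slice x w) y) z \<noteq> 0.
        s'' ((\<lambda>(x, y). k' (slice x w) y) z) ((\<lambda>(x, y). t (e x) (e' y)) z)) =
        (\<Sum>(x, y)\<in>(SIGMA x:{x. slice x w \<noteq> 0}. {y. k' (slice x w) y \<noteq> 0}). s'' (k' (slice x w) y) (t (e x) (e' y)))"
      using supp[of w] by (intro sum.cong) auto
    also have "\<dots> = (\<Sum>x | slice x w \<noteq> 0. \<Sum>y | k' (slice x w) y \<noteq> 0. s'' (k' (slice x w) y) (t (e x) (e' y)))"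
      using slice_finite[OF w] fin by (intro sum.Sigma[symmetric]) auto
    also have "\<dots> = (\<Sum>x | slice x w \<noteq> 0. t (e x) (slice x w))"
    proof (rule sum.cong)
      fix x assume "x \<in> {x. slice x w \<noteq> 0}"
      then have x: "e x \<in> M" using slice_support[OF w] M.basis_mem by blast
      have Y: "y \<in> Y" if "k' (slice x w) y \<noteq> 0" for y
        using that N.coord_outside[OF slice_mem[OF w]] by blast
      have "(\<Sum>y | k' (slice x w) y \<noteq> 0. s'' (k' (slice x w) y) (t (e x) (e' y))) =
          (\<Sum>y | k' (slice x w) y \<noteq> 0. t (e x) (s' (k' (slice x w) y) (e' y)))"
        using x Y N.basis_mem by (intro sum.cong) (auto simp: tensor_scale_right)
      also have "\<dots> = t (e x) (\<Sum>y | k' (slice x w) y \<noteq> 0. s' (k' (slice x w) y) (e' y))"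
        using x Y N.basis_mem submodule_scale[OF right] by (intro tensor_sum_right[symmetric]) auto
      also have "\<dots> = t (e x) (slice x w)" using w by (simp add: N.expand slice_mem)
      finally show "(\<Sum>y | k' (slice x w) y \<noteq> 0. s'' (k' (slice x w) y) (t (e x) (e' y))) = t (e x) (slice x w)" .
    qed simp
    also have "\<dots> = w" by (rule slice_expand[OF w])
    finally show "(\<Sum>z | (\<lambda>(x, y). k' (slice x w) y) z \<noteq> 0.
        s'' ((\<lambda>(x, y). k' (slice x w) y) z) ((\<lambda>(x, y). t (e x) (e' y)) z)) = w" .
  qed
qed

end



section \<open>Minimal resolutions with chosen bases\<close>

lemma lookup_single_mult:
  fixes f :: "('a::cancel_comm_monoid_add) \<Rightarrow>\<^sub>0 'k::comm_ring_1"
  shows "Poly_Mapping.lookup (Poly_Mapping.single \<beta> c * f) (\<beta> + \<gamma>) = c * Poly_Mapping.lookup f \<gamma>"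
proof -
  have "Poly_Mapping.single \<beta> c * f =
      (\<Sum>\<delta>\<in>Poly_Mapping.keys f. Poly_Mapping.single (\<beta> + \<delta>) (c * Poly_Mapping.lookup f \<delta>))"
    by (subst (1) poly_mapping_sum_single[of f, symmetric]) (simp add: sum_distrib_left mult_single)
  then show ?thesis
    by (simp add: lookup_sum lookup_single when_def in_keys_iff)
qed

lemma single_mult_cancel:
  fixes f :: "('a::cancel_comm_monoid_add) \<Rightarrow>\<^sub>0 'k::comm_ring_1"
  shows "Poly_Mapping.single \<beta> 1 * f = 0 \<Longrightarrow> f = 0"
  by (rule poly_mapping_eqI) (metis lookup_single_mult lookup_zero mult_1)

lemma variable_dvd:
  fixes f :: "('v, 'k::comm_ring_1) mpoly"
  assumes "\<And>\<gamma>. Poly_Mapping.lookup f \<gamma> \<noteq> 0 \<Longrightarrow> Poly_Mapping.lookup \<gamma> v > 0"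
  shows "\<exists>g. f = monomial (Poly_Mapping.single v 1) * g"
proof -
  let ?v = "Poly_Mapping.single v (1::nat)"
  have "f = (\<Sum>\<gamma>\<in>Poly_Mapping.keys f. Poly_Mapping.single \<gamma> (Poly_Mapping.lookup f \<gamma>))"
    by (simp add: poly_mapping_sum_single)
  also have "\<dots> = (\<Sum>\<gamma>\<in>Poly_Mapping.keys f. monomial ?v * Poly_Mapping.single (\<gamma> - ?v) (Poly_Mapping.lookup f \<gamma>))"
  proof (rule sum.cong)
    fix \<gamma> assume "\<gamma> \<in> Poly_Mapping.keys f"
    \<comment> \<open>The truncated subtraction is exact because \<open>v\<close> occurs in
      \<open>\<gamma>\<close>.\<close>
    then have "?v + (\<gamma> - ?v) = \<gamma>"
      using assms[of \<gamma>]
      by (intro poly_mapping_eqI) (auto simp: in_keys_iff lookup_add lookup_minus lookup_single when_def)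
    then show "Poly_Mapping.single \<gamma> (Poly_Mapping.lookup f \<gamma>) =
        monomial ?v * Poly_Mapping.single (\<gamma> - ?v) (Poly_Mapping.lookup f \<gamma>)"
      by (simp add: monomial_def mult_single)
  qed simp
  finally show ?thesis by (simp flip: sum_distrib_left) blast
qed

text \<open>\<open>rho\<close> lifts the augmentation \<open>C\<^sub>0 \<rightarrow> R/I\<close> to \<open>R\<close>.\<close>

locale based_resolution =
  fixes C :: "('v, 'k::field, 'm::ab_group_add) mg_complex" and X :: "nat \<Rightarrow> 'm set"
    and k :: "nat \<Rightarrow> 'm \<Rightarrow> 'm \<Rightarrow> ('v, 'k) mpoly" and deg :: "nat \<Rightarrow> 'm \<Rightarrow> 'v \<Rightarrow>\<^sub>0 nat"
    and I :: "('v, 'k) mpoly set" and rho :: "'m \<Rightarrow> ('v, 'k) mpoly"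
  assumes complex: "is_mg_complex C"
    and basis: "graded_free_basis (smul C) (chain C i) (X i) (\<lambda>x. x) (k i) (hcomp C i) (deg i)"
    and exact: "i \<ge> 1 \<Longrightarrow> {x \<in> chain C i. bd C i x = 0} = bd C (i + 1) ` chain C (i + 1)"
    and minimal: "i \<ge> 1 \<Longrightarrow> bd C i ` chain C i \<subseteq> ideal_smult (smul C) irrelevant_ideal (chain C (i - 1))"
    and ideal: "submodule (*) I"
    and rho_linear: "linear_map_on (smul C) (*) (chain C 0) UNIV rho"
    and rho_one: "\<exists>y\<in>chain C 0. rho y - 1 \<in> I"
    and rho_graded: "x \<in> hcomp C 0 \<alpha> \<Longrightarrow> \<exists>c. rho x - Poly_Mapping.single \<alpha> c \<in> I"
    and rho_kernel: "{x \<in> chain C 0. rho x \<in> I} = bd C 1 ` chain C 1"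
begin

sublocale B: graded_free_basis "smul C" "chain C i" "X i" "\<lambda>x. x" "k i" "hcomp C i" "deg i" for i
  by (rule basis)

lemma bd_linear: "linear_map_on (smul C) (smul C) (chain C i) (chain C (i - 1)) (bd C i)"
  and bd_graded: "x \<in> hcomp C i \<alpha> \<Longrightarrow> bd C i x \<in> hcomp C (i - 1) \<alpha>"
  and bd_bd: "x \<in> chain C i \<Longrightarrow> bd C (i - 1) (bd C i x) = 0"
  and bd_0: "x \<in> chain C 0 \<Longrightarrow> bd C 0 x = 0"
  using complex unfolding is_mg_complex_def by auto

lemmas bd_mem = linear_map_on_mem[OF bd_linear]
  and bd_scale = linear_map_on_scale[OF bd_linear]
  and bd_diff = linear_map_on_diff[OF bd_linear B.submodule B.module_axioms]
  and bd_sum = linear_map_on_sum[OF bd_linear B.submodule B.module_axioms]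

lemmas rho_add = linear_map_on_add[OF rho_linear]
  and rho_scale = linear_map_on_scale[OF rho_linear]
  and rho_diff = linear_map_on_diff[OF rho_linear B.submodule module_mult]

text \<open>Elements of the irrelevant ideal times the module have all coordinates in that ideal,
  but \<open>x\<close> has coordinate 1 at itself.\<close>

lemma basis_not_in_irrelevant:
  assumes "x \<in> X i"
  shows "x \<notin> ideal_smult (smul C) irrelevant_ideal (chain C i)"
proof
  assume x: "x \<in> ideal_smult (smul C) irrelevant_ideal (chain C i)"
  have irr: "submodule (*) (irrelevant_ideal :: ('v, 'k) mpoly set)"
    unfolding irrelevant_ideal_def by (rule submodule_span[OF module_mult])
  have "ideal_smult (smul C) irrelevant_ideal (chain C i) \<subseteq> {u \<in> chain C i. k i u x \<in> irrelevant_ideal}"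
    unfolding ideal_smult_def
  proof (rule span_subset_submodule)
    show "submodule (smul C) {u \<in> chain C i. k i u x \<in> irrelevant_ideal}"
      by (rule linear_map_on_vimage[OF B.coord_linear B.submodule module_mult irr])
    show "{smul C r x | r x. r \<in> irrelevant_ideal \<and> x \<in> chain C i} \<subseteq> {u \<in> chain C i. k i u x \<in> irrelevant_ideal}"
      using submodule_scale[OF irr] submodule_scale[OF B.submodule]
      by (auto simp: B.coord_scale mult.commute)
  qed
  then have "k i x x \<in> irrelevant_ideal" using x by blast
  then show False using B.coord_basis[OF assms] irrelevant_ideal_lookup_0 by fastforce
qed

lemma ideal_smult_submodule: "submodule (smul C) (ideal_smult (smul C) K (chain C i))"
  unfolding ideal_smult_def by (rule submodule_span[OF B.module_axioms])

lemma ideal_smult_mem: "r \<in> K \<Longrightarrow> x \<in> chain C i \<Longrightarrow> smul C r x \<in> ideal_smult (smul C) K (chain C i)"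
  unfolding ideal_smult_def by (rule B.span_base) blast

lemma variable_irrelevant: "monomial (Poly_Mapping.single v 1) \<in> irrelevant_ideal"
  unfolding irrelevant_ideal_def by (intro module.span_base[OF module_mult] rangeI)

text \<open>
  If the degree of a basis element \<open>x\<close> involved a variable \<open>v\<close> modulo which \<open>I\<close> is saturated,
  then \<open>x\<close> would differ from a multiple of \<open>v\<close> by a boundary, contradicting minimality.
\<close>

lemma deg_saturated_variable:
  assumes sat: "\<And>f. monomial (Poly_Mapping.single v 1) * f \<in> I \<Longrightarrow> f \<in> I" and "x \<in> X i"
  shows "Poly_Mapping.lookup (deg i x) v = 0"
  using assms(2)
proof (induction i arbitrary: x)
  let ?v = "Poly_Mapping.single v (1::nat)"
  let ?irr = "\<lambda>i. ideal_smult (smul C) irrelevant_ideal (chain C i)"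
  \<comment> \<open>By minimality boundaries have coefficients in the irrelevant ideal, as does a
    multiple of \<open>v\<close>; a basis element cannot be their sum.\<close>
  have contra: False if "x \<in> X i" "u \<in> chain C i" "x - smul C (monomial ?v) u \<in> bd C (i + 1) ` chain C (i + 1)" for x u i
  proof -
    have "x - smul C (monomial ?v) u \<in> ?irr i" using that(3) minimal[of "i + 1"] by auto
    moreover have "smul C (monomial ?v) u \<in> ?irr i" using that(2) variable_irrelevant by (intro ideal_smult_mem)
    ultimately have "x \<in> ?irr i" using submodule_add[OF ideal_smult_submodule] by fastforce
    then show False using basis_not_in_irrelevant[OF that(1)] by blast
  qed
  {
    case 0
    show ?case
    proof (rule ccontr)
      assume pos: "Poly_Mapping.lookup (deg 0 x) v \<noteq> 0"
      have x: "x \<in> chain C 0" using B.basis_mem[OF 0] .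
      obtain c where c: "rho x - Poly_Mapping.single (deg 0 x) c \<in> I"
        using rho_graded B.basis_component[OF 0] by blast
      have "\<exists>g. Poly_Mapping.single (deg 0 x) c = monomial ?v * g"
        by (rule variable_dvd) (use pos in \<open>auto simp: lookup_single when_def split: if_splits\<close>)
      then obtain g where g: "Poly_Mapping.single (deg 0 x) c = monomial ?v * g" by blast
      \<comment> \<open>\<open>y\<close> represents 1 in R/I, so \<open>smul C g y\<close> is a
        preimage of \<open>g\<close> modulo \<open>I\<close>.\<close>
      obtain y where y: "y \<in> chain C 0" "rho y - 1 \<in> I" using rho_one by blast
      have gy: "smul C g y \<in> chain C 0" using y(1) submodule_scale[OF B.submodule] by blast
      have "rho (x - smul C (monomial ?v) (smul C g y)) =
          (rho x - Poly_Mapping.single (deg 0 x) c) - (monomial ?v * g) * (rho y - 1)"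
      proof -
        have "rho (x - smul C (monomial ?v) (smul C g y)) = rho x - rho (smul C (monomial ?v) (smul C g y))"
          by (rule rho_diff[OF x submodule_scale[OF B.submodule gy]])
        also have "rho (smul C (monomial ?v) (smul C g y)) = monomial ?v * (g * rho y)"
          by (simp only: rho_scale[OF gy] rho_scale[OF y(1)])
        finally show ?thesis by (simp only: g) (simp add: algebra_simps)
      qed
      then have "rho (x - smul C (monomial ?v) (smul C g y)) \<in> I"
        using submodule_diff[OF ideal c] submodule_scale[OF ideal y(2)] by presburger
      moreover have "x - smul C (monomial ?v) (smul C g y) \<in> chain C 0"
        using x gy submodule_scale[OF B.submodule] submodule_diff[OF B.submodule] by blast
      ultimately show False using contra[OF 0 gy] rho_kernel by auto
    qed
  next
    case (Suc i)
    show ?case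
    proof (rule ccontr)
      assume pos: "Poly_Mapping.lookup (deg (Suc i) x) v \<noteq> 0"
      have x: "x \<in> chain C (Suc i)" using B.basis_mem[OF Suc.prems] .
      have dx: "bd C (Suc i) x \<in> chain C i" "bd C (Suc i) x \<in> hcomp C i (deg (Suc i) x)"
        using bd_mem[OF x] bd_graded[OF B.basis_component[OF Suc.prems]] by simp_all
      \<comment> \<open>An exponent of the entry plus \<open>deg i b\<close> equals the degree of
        \<open>x\<close>, and by induction \<open>deg i b\<close> avoids \<open>v\<close>. So the
        whole positive power of \<open>v\<close> sits in the entry, and \<open>v\<close> divides the
        boundary of \<open>x\<close>.\<close>
      have "\<exists>g. k i (bd C (Suc i) x) b = monomial ?v * g" if "b \<in> X i" for b
      proof (rule variable_dvd)
        fix \<gamma> assume "Poly_Mapping.lookup (k i (bd C (Suc i) x) b) \<gamma> \<noteq> 0"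
        from B.coord_component[OF dx(2) this]
        have "Poly_Mapping.lookup \<gamma> v + Poly_Mapping.lookup (deg i b) v = Poly_Mapping.lookup (deg (Suc i) x) v"
          by (metis lookup_add)
        then show "Poly_Mapping.lookup \<gamma> v > 0" using pos Suc.IH[OF that] by simp
      qed
      then obtain g where g: "\<And>b. b \<in> X i \<Longrightarrow> k i (bd C (Suc i) x) b = monomial ?v * g b" by metis
      let ?A = "{b. k i (bd C (Suc i) x) b \<noteq> 0}"
      have A: "?A \<subseteq> X i" using B.coord_outside[OF dx(1)] by blast
      define y where "y = (\<Sum>b\<in>?A. smul C (g b) b)"
      have y: "y \<in> chain C i" unfolding y_def by (rule B.sum_basis_mem[OF A])
      have dx_y: "bd C (Suc i) x = smul C (monomial ?v) y"
      proof -
        have "smul C (monomial ?v) y = (\<Sum>b\<in>?A. smul C (k i (bd C (Suc i) x) b) b)"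
          unfolding y_def B.scale_sum_right using g A by (intro sum.cong) auto
        then show ?thesis using B.expand[OF dx(1)] by simp
      qed
      \<comment> \<open>Here \<open>bd x\<close> is \<open>v\<close> times \<open>y\<close>. For
        \<open>i = 0\<close>, applying \<open>rho\<close> and saturation puts \<open>rho y\<close>
        in \<open>I\<close>; for positive \<open>i\<close>, applying the differential and cancelling
        \<open>v\<close> in a free module makes \<open>y\<close> a cycle. Then
        \<open>y = bd z\<close>, and \<open>x - v z\<close> is a cycle, hence a boundary.\<close>
      have "y \<in> bd C (Suc i) ` chain C (Suc i)"
      proof (cases "i = 0")
        case True
        have "bd C 1 x \<in> {x \<in> chain C 0. rho x \<in> I}"
          unfolding rho_kernel using x True by simp
        then have "monomial ?v * rho y \<in> I"
          using dx_y y True rho_scale[of y "monomial ?v"] by simp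
        then have "rho y \<in> I" by (rule sat)
        then show ?thesis using y rho_kernel True by auto
      next
        case False
        have "smul C (monomial ?v) (bd C i y) = 0"
          using bd_bd[OF x] bd_scale[OF y] dx_y by simp
        then have "monomial ?v * k (i - 1) (bd C i y) b = 0" for b
          using B.coord_scale[OF bd_mem[OF y], of "monomial ?v" b] B.coord_zero by metis
        then have "k (i - 1) (bd C i y) b = 0" for b
          unfolding monomial_def by (rule single_mult_cancel)
        then have "bd C i y = 0"
          using bd_mem[OF y] submodule_zero[OF B.submodule] by (intro B.coord_ext[where i = "i - 1"]) (auto simp: B.coord_zero)
        then show ?thesis using exact[of i] False y by auto
      qed
      then obtain z where z: "z \<in> chain C (Suc i)" "y = bd C (Suc i) z" by blast
      have vz: "smul C (monomial ?v) z \<in> chain C (Suc i)" using z(1) submodule_scale[OF B.submodule] by blast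
      have "bd C (Suc i) (x - smul C (monomial ?v) z) = 0"
        using x vz z dx_y by (simp add: bd_diff bd_scale)
      moreover have "x - smul C (monomial ?v) z \<in> chain C (Suc i)"
        using x vz submodule_diff[OF B.submodule] by blast
      ultimately show False using contra[OF Suc.prems z(1)] exact[of "Suc i"] by auto
    qed
  }
qed

text \<open>The differential as a matrix acting on coordinates; bounding exponents of boundaries
  reduces to the exponents of its entries.\<close>

lemma coord_bd:
  assumes "u \<in> chain C i"
  shows "k (i - 1) (bd C i u) b = (\<Sum>x | k i u x \<noteq> 0. k i u x * k (i - 1) (bd C i x) b)"
proof -
  let ?A = "{x. k i u x \<noteq> 0}"
  have A: "x \<in> chain C i" if "x \<in> ?A" for x
    using that B.coord_outside[OF assms] B.basis_mem by blast
  have "bd C i (\<Sum>x\<in>?A. smul C (k i u x) x) = (\<Sum>x\<in>?A. bd C i (smul C (k i u x) x))"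
    using A submodule_scale[OF B.submodule] by (intro bd_sum) blast
  also have "\<dots> = (\<Sum>x\<in>?A. smul C (k i u x) (bd C i x))"
    using A by (intro sum.cong bd_scale) auto
  finally have "bd C i u = (\<Sum>x\<in>?A. smul C (k i u x) (bd C i x))"
    by (simp only: B.expand[OF assms])
  moreover have "k (i - 1) \<dots> b = (\<Sum>x\<in>?A. k (i - 1) (smul C (k i u x) (bd C i x)) b)"
    using A bd_mem submodule_scale[OF B.submodule] by (intro B.coord_sum) blast
  moreover have "\<dots> = (\<Sum>x\<in>?A. k i u x * k (i - 1) (bd C i x) b)"
    using A bd_mem by (intro sum.cong) (auto simp: B.coord_scale)
  ultimately show ?thesis by simp
qed

text \<open>
  The vanishing of \<open>Tor\<^sub>i(R/I, R/J)\<close>, where \<open>J\<close> is the ideal of polynomials with exponents in \<open>E\<close>.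
  The entries of the differentials only involve variables outside \<open>W\<close>, which do not
  influence membership in \<open>E\<close>. So splitting the coefficients of \<open>x\<close> into terms inside and
  outside \<open>J\<close> is compatible with the differential.
\<close>

lemma exact_modulo:
  assumes W: "\<And>v i x. v \<in> W \<Longrightarrow> x \<in> X i \<Longrightarrow> Poly_Mapping.lookup (deg i x) v = 0"
    and up: "\<And>\<gamma> \<delta>. \<gamma> \<in> E \<Longrightarrow> \<gamma> + \<delta> \<in> E"
    and remove: "\<And>\<gamma> \<delta>. (\<And>v. v \<in> W \<Longrightarrow> Poly_Mapping.lookup \<delta> v = 0) \<Longrightarrow> \<gamma> + \<delta> \<in> E \<Longrightarrow> \<gamma> \<in> E"
    and i: "i \<ge> 1" and x: "x \<in> chain C i"
    and dx: "\<And>b. Poly_Mapping.keys (k (i - 1) (bd C i x) b) \<subseteq> E"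
  shows "\<exists>z\<in>chain C (i + 1). \<forall>b. Poly_Mapping.keys (k i (x - bd C (i + 1) z) b) \<subseteq> E"
proof -
  let ?J = "{f :: ('v, 'k) mpoly. Poly_Mapping.keys f \<subseteq> E}"
  have J: "submodule (*) ?J"
    using subspace_keys[of E] up module_mult unfolding submodule_def by blast
  let ?A = "{b. k i x b \<noteq> 0}"
  have A: "finite ?A" "?A \<subseteq> X i" using B.coord_finite[OF x] B.coord_outside[OF x] by auto
  \<comment> \<open>\<open>x2\<close> collects the terms of the coefficients that lie in
    \<open>J\<close>; the aim is that the rest, \<open>x1\<close>, is a genuine cycle.\<close>
  define x2 where "x2 = (\<Sum>b\<in>?A. smul C (restrict_terms (\<lambda>\<gamma>. \<gamma> \<in> E) (k i x b)) b)"
  define x1 where "x1 = x - x2"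
  have x2: "x2 \<in> chain C i" unfolding x2_def by (rule B.sum_basis_mem[OF A(2)])
  have x1: "x1 \<in> chain C i" unfolding x1_def using x x2 by (rule submodule_diff[OF B.submodule])
  have k2: "Poly_Mapping.lookup (k i x2 b) \<gamma> = (Poly_Mapping.lookup (k i x b) \<gamma> when \<gamma> \<in> E)" for b \<gamma>
    unfolding x2_def by (simp add: B.coord_sum_basis[OF A] lookup_restrict_terms)
  have k1: "Poly_Mapping.lookup (k i x1 b) \<gamma> = (Poly_Mapping.lookup (k i x b) \<gamma> when \<gamma> \<notin> E)" for b \<gamma>
    unfolding x1_def using x x2 by (simp add: B.coord_diff lookup_minus k2 when_def)
  have k2J: "k i x2 b \<in> ?J" for b
    using k2 by (auto simp: in_keys_iff when_def split: if_splits)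
  have "k (i - 1) (bd C i x2) b \<in> ?J" for b
    unfolding coord_bd[OF x2]
    by (rule submodule_sum[OF J], subst mult.commute, rule submodule_scale[OF J k2J])
  then have "k (i - 1) (bd C i x1) b \<in> ?J" for b
    using submodule_diff[OF J, of "k (i - 1) (bd C i x) b" "k (i - 1) (bd C i x2) b"] dx[of b]
    unfolding x1_def bd_diff[OF x x2] B.coord_diff[OF bd_mem[OF x] bd_mem[OF x2]] by blast
  \<comment> \<open>Such an exponent is \<open>\<gamma>' + \<delta>\<close> with
    \<open>\<gamma>'\<close> outside \<open>E\<close> and \<open>\<delta>\<close> from a matrix
    entry. Both basis degrees vanish on \<open>W\<close>, hence so does \<open>\<delta>\<close>, and
    adding it cannot lead into \<open>E\<close>. But the boundary of \<open>x1\<close> also has all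
    exponents in \<open>E\<close>, so it is 0.\<close>
  moreover have "\<gamma> \<notin> E" if \<gamma>: "\<gamma> \<in> Poly_Mapping.keys (k (i - 1) (bd C i x1) b)" for \<gamma> b
  proof -
    let ?A1 = "{y. k i x1 y \<noteq> 0}"
    obtain y where y: "y \<in> ?A1" "\<gamma> \<in> Poly_Mapping.keys (k i x1 y * k (i - 1) (bd C i y) b)"
      using \<gamma> keys_sum unfolding coord_bd[OF x1] by fast
    then obtain \<gamma>' \<delta> where \<gamma>': "\<gamma> = \<gamma>' + \<delta>" "\<gamma>' \<in> Poly_Mapping.keys (k i x1 y)"
        "\<delta> \<in> Poly_Mapping.keys (k (i - 1) (bd C i y) b)"
      using keys_mult by blast
    have yX: "y \<in> X i" using y(1) B.coord_outside[OF x1] by blast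
    have dy: "bd C i y \<in> hcomp C (i - 1) (deg i y)" by (rule bd_graded[OF B.basis_component[OF yX]])
    have bX: "b \<in> X (i - 1)"
      using \<gamma>'(3) B.coord_outside[OF B.component_mem[OF dy]] by fastforce
    have "\<delta> + deg (i - 1) b = deg i y"
      using B.coord_component[OF dy] \<gamma>'(3) by (simp add: in_keys_iff)
    then have "Poly_Mapping.lookup \<delta> v = 0" if "v \<in> W" for v
      using W[OF that yX] W[OF that bX] by (metis add_is_0 lookup_add)
    then show ?thesis
      using remove[of \<delta> \<gamma>'] \<gamma>' k1[of y \<gamma>'] by (auto simp: in_keys_iff)
  qed
  ultimately have "Poly_Mapping.keys (k (i - 1) (bd C i x1) b) = {}" for b by blast
  then have "k (i - 1) (bd C i x1) b = 0" for b by simp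
  then have "bd C i x1 = 0"
    using bd_mem[OF x1] submodule_zero[OF B.submodule]
    by (intro B.coord_ext[where i = "i - 1"]) (auto simp: B.coord_zero)
  then obtain z where z: "z \<in> chain C (i + 1)" "x1 = bd C (i + 1) z"
    using exact[OF i] x1 by blast
  have "x - bd C (i + 1) z = x2" unfolding z(2)[symmetric] x1_def by simp
  then show ?thesis using z(1) k2J by auto
qed

end


lemma compose_linear:
  "linear_map_on s s' A B f \<Longrightarrow> linear_map_on s' s'' B C g \<Longrightarrow> linear_map_on s s'' A C (\<lambda>w. g (f w))"
  by (rule linear_map_onI) (simp_all add: linear_map_onD)


section \<open>Internal direct sums\<close>

locale direct_sum = module s for s :: "'r::comm_ring_1 \<Rightarrow> 'm::ab_group_add \<Rightarrow> 'm" +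
  fixes C :: "'m set" and n :: nat and U :: "nat \<Rightarrow> 'm set"
  assumes summand: "i \<le> n \<Longrightarrow> submodule s (U i)"
    and total: "C = {\<Sum>i\<le>n. u i | u. \<forall>i\<le>n. u i \<in> U i}"
    and independent: "(\<forall>i\<le>n. u i \<in> U i) \<Longrightarrow> (\<Sum>i\<le>n. u i) = 0 \<Longrightarrow> i \<le> n \<Longrightarrow> u i = 0"
begin

definition component :: "nat \<Rightarrow> 'm \<Rightarrow> 'm"
  where "component i w = (SOME u. (\<forall>i\<le>n. u i \<in> U i) \<and> w = (\<Sum>i\<le>n. u i)) i"

lemma component_props:
  assumes "w \<in> C"
  shows "(\<forall>i\<le>n. component i w \<in> U i) \<and> w = (\<Sum>i\<le>n. component i w)"
proof -
  have "\<exists>u. (\<forall>i\<le>n. u i \<in> U i) \<and> w = (\<Sum>i\<le>n. u i)" using assms total by blast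
  then show ?thesis unfolding component_def by (rule someI_ex)
qed

lemma component_mem: "w \<in> C \<Longrightarrow> i \<le> n \<Longrightarrow> component i w \<in> U i"
  and sum_component: "w \<in> C \<Longrightarrow> (\<Sum>i\<le>n. component i w) = w"
  using component_props by auto

lemma sum_mem: "(\<And>i. i \<le> n \<Longrightarrow> u i \<in> U i) \<Longrightarrow> (\<Sum>i\<le>n. u i) \<in> C"
  unfolding total by blast

lemma component_sum:
  assumes u: "\<And>i. i \<le> n \<Longrightarrow> u i \<in> U i" and "i \<le> n"
  shows "component i (\<Sum>i\<le>n. u i) = u i"
proof -
  let ?w = "\<Sum>i\<le>n. u i"
  have w: "?w \<in> C" by (rule sum_mem[OF u])
  have "(\<Sum>i\<le>n. component i ?w - u i) = 0" using sum_component[OF w] by (simp add: sum_subtractf)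
  moreover have "\<forall>i\<le>n. component i ?w - u i \<in> U i"
    using component_mem[OF w] u submodule_diff[OF summand] by blast
  ultimately show ?thesis using independent[of "\<lambda>i. component i ?w - u i" i] assms(2) by simp
qed

lemma
  assumes "i \<le> n" "w \<in> U i"
  shows summand_mem: "w \<in> C" and component_summand: "j \<le> n \<Longrightarrow> component j w = (if j = i then w else 0)"
proof -
  let ?u = "\<lambda>j. if j = i then w else 0"
  have u: "?u j \<in> U j" if "j \<le> n" for j using assms(2) submodule_zero[OF summand[OF that]] by simp
  have sum: "(\<Sum>j\<le>n. ?u j) = w" using assms(1) by simp
  show "w \<in> C" using sum_mem[OF u] sum by simp
  show "component j w = ?u j" if "j \<le> n" using component_sum[OF u that] sum by simp
qed

lemma submodule_total: "submodule s C"
proof (intro submoduleI)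
  show "module s" by (rule module_axioms)
  show "0 \<in> C" using sum_mem[of "\<lambda>_. 0"] submodule_zero[OF summand] by simp
  fix x y assume xy: "x \<in> C" "y \<in> C"
  have "(\<Sum>i\<le>n. component i x + component i y) \<in> C"
    using component_mem[OF xy(1)] component_mem[OF xy(2)] submodule_add[OF summand] by (intro sum_mem) blast
  then show "x + y \<in> C" by (simp add: sum.distrib sum_component xy)
next
  fix r x assume x: "x \<in> C"
  have "(\<Sum>i\<le>n. s r (component i x)) \<in> C"
    using component_mem[OF x] submodule_scale[OF summand] by (intro sum_mem) blast
  then show "s r x \<in> C" by (simp add: scale_sum_right[symmetric] sum_component x)
qed

lemma component_linear:
  assumes i: "i \<le> n"
  shows "linear_map_on s s C (U i) (component i)"
proof (rule linear_map_onI)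
  fix x assume x: "x \<in> C"
  then show "component i x \<in> U i" using component_mem i by blast
  have "component i (\<Sum>i\<le>n. s r (component i x)) = s r (component i x)" for r
    using component_mem[OF x] submodule_scale[OF summand] i by (intro component_sum) blast
  then show "component i (s r x) = s r (component i x)" for r
    by (simp add: scale_sum_right[symmetric] sum_component x)
  fix y assume y: "y \<in> C"
  have "component i (\<Sum>i\<le>n. component i x + component i y) = component i x + component i y"
    using component_mem[OF x] component_mem[OF y] submodule_add[OF summand] i by (intro component_sum) blast
  then show "component i (x + y) = component i x + component i y"
    by (simp add: sum.distrib sum_component x y)
qed

lemma total_induct:
  assumes "submodule s Q" "\<And>i. i \<le> n \<Longrightarrow> U i \<subseteq> Q"
  shows "C \<subseteq> Q"
proof
  fix w assume w: "w \<in> C"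
  have "(\<Sum>i\<le>n. component i w) \<in> Q"
    using component_mem[OF w] assms(2) by (intro submodule_sum[OF assms(1)]) auto
  then show "w \<in> Q" by (simp add: sum_component w)
qed

text \<open>The guard on \<open>i\<close> makes coordinates vanish beyond \<open>n\<close>, where
  \<open>component\<close> is an arbitrary value.\<close>

lemma free_basis_direct_sum:
  fixes X :: "nat \<Rightarrow> 'x set"
  assumes "\<And>i. i \<le> n \<Longrightarrow> free_basis s (U i) (X i) (e i) (k i)"
  shows "free_basis s C (SIGMA i:{..n}. X i) (\<lambda>(i, x). e i x)
    (\<lambda>w (i, x). if i \<le> n then k i (component i w) x else 0)" (is "free_basis s C ?X ?e ?k")
proof
  show "subspace C" using submodule_total by (simp add: submodule_def)
  fix z assume z: "z \<in> ?X"
  obtain i x where ix: "z = (i, x)" "i \<le> n" "x \<in> X i" using z by auto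
  interpret Ui: free_basis s "U i" "X i" "e i" "k i" by (rule assms[OF ix(2)])
  show "?e z \<in> C" using summand_mem[OF ix(2) Ui.basis_mem[OF ix(3)]] ix(1) by simp
  fix z' :: "nat \<times> 'x"
  obtain j y where jy: "z' = (j, y)" by (cases z')
  show "?k (?e z) z' = (if z' = z then 1 else 0)"
  proof (cases "j \<le> n")
    case True
    interpret Uj: free_basis s "U j" "X j" "e j" "k j" by (rule assms[OF True])
    show ?thesis
      using ix jy True component_summand[OF ix(2) Ui.basis_mem[OF ix(3)] True] Ui.coord_basis[OF ix(3)]
      by (auto simp: Uj.coord_zero)
  qed (use ix jy in auto)
next
  fix z :: "nat \<times> 'x"
  obtain i x where z: "z = (i, x)" by (cases z)
  show "linear_map_on s (*) C UNIV (\<lambda>u. ?k u z)"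
  proof (cases "i \<le> n")
    case True
    interpret Ui: free_basis s "U i" "X i" "e i" "k i" by (rule assms[OF True])
    show ?thesis unfolding z
      by (rule linear_map_onI) (simp_all add: True linear_map_on_add[OF component_linear]
          linear_map_on_scale[OF component_linear] Ui.coord_add Ui.coord_scale component_mem)
  qed (auto intro: linear_map_onI simp: z)
  fix u assume u: "u \<in> C"
  show "?k u z = 0" if "z \<notin> ?X"
    using that free_basis.coord_outside[OF assms component_mem[OF u]] by (auto simp: z)
next
  fix u assume u: "u \<in> C"
  let ?S = "SIGMA i:{..n}. {x. k i (component i u) x \<noteq> 0}"
  have supp: "{z. ?k u z \<noteq> 0} = ?S" by (auto split: if_splits)
  have fin: "finite {x. k i (component i u) x \<noteq> 0}" if "i \<in> {..n}" for i
    using free_basis.coord_finite[OF assms component_mem[OF u]] that by simp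
  show "finite {z. ?k u z \<noteq> 0}" unfolding supp using fin by (intro finite_SigmaI) auto
  have "(\<Sum>z | ?k u z \<noteq> 0. s (?k u z) (?e z)) = (\<Sum>(i, x)\<in>?S. s (k i (component i u) x) (e i x))"
    unfolding supp by (intro sum.cong) auto
  also have "\<dots> = (\<Sum>i\<le>n. \<Sum>x | k i (component i u) x \<noteq> 0. s (k i (component i u) x) (e i x))"
    using fin by (intro sum.Sigma[symmetric]) auto
  also have "\<dots> = (\<Sum>i\<le>n. component i u)"
    using free_basis.expand[OF assms component_mem[OF u]] by (intro sum.cong) auto
  also have "\<dots> = u" by (rule sum_component[OF u])
  finally show "(\<Sum>z | ?k u z \<noteq> 0. s (?k u z) (?e z)) = u" .
qed

end


section \<open>Tensor products of complexes\<close>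

locale tensor_of_resolutions =
  F: based_resolution F XF kF degF I rhoF + G: based_resolution G XG kG degG J rhoG
  for F :: "('v, 'k::field, 'f::ab_group_add) mg_complex" and XF kF degF I rhoF
    and G :: "('v, 'k, 'g::ab_group_add) mg_complex" and XG kG degG J rhoG +
  fixes T :: "('v, 'k, 'h::ab_group_add) mg_complex" and S :: "nat \<Rightarrow> nat \<Rightarrow> 'h set"
    and t :: "nat \<Rightarrow> nat \<Rightarrow> 'f \<Rightarrow> 'g \<Rightarrow> 'h"
  assumes tensors: "is_tensor_product (smul F) (chain F i) (smul G) (chain G j) (smul T) (S i j) (t i j)"
    and chain_T: "chain T n = {\<Sum>i\<le>n. u i | u. \<forall>i\<le>n. u i \<in> S i (n - i)}"
    and independent_T: "(\<forall>i\<le>n. u i \<in> S i (n - i)) \<Longrightarrow> (\<Sum>i\<le>n. u i) = 0 \<Longrightarrow> i \<le> n \<Longrightarrow> u i = 0"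
    and hcomp_T: "hcomp T n \<alpha> = module.span (\<lambda>c. smul T (Poly_Mapping.single 0 c))
      {t i j x y | i j x y \<beta> \<gamma>. i + j = n \<and> \<beta> + \<gamma> = \<alpha> \<and> x \<in> hcomp F i \<beta> \<and> y \<in> hcomp G j \<gamma>}"
    and bd_T_linear: "linear_map_on (smul T) (smul T) (chain T n) (chain T (n - 1)) (bd T n)"
    and bd_T_tensor: "x \<in> chain F i \<Longrightarrow> y \<in> chain G j \<Longrightarrow> bd T (i + j) (t i j x y) =
      t (i - 1) j (bd F i x) y + smul T ((- 1) ^ i) (t i (j - 1) x (bd G j y))"
begin

sublocale P: tensor_free_left "smul F" "chain F i" "smul G" "chain G j" "smul T" "S i j" "t i j"
  "XF i" "\<lambda>x. x" "kF i" for i j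
  by unfold_locales (rule tensors F.B.submodule G.B.submodule)+

sublocale D: direct_sum "smul T" "chain T n" n "\<lambda>i. S i (n - i)" for n
  by unfold_locales (use P.submodule_S chain_T independent_T in auto)

lemma S_mem_chain: "w \<in> S i j \<Longrightarrow> w \<in> chain T (i + j)"
  using D.summand_mem[of i "i + j" w] by simp

lemma chain_T_induct:
  assumes "submodule (smul T) Q"
    "\<And>i j x y. i + j = n \<Longrightarrow> x \<in> chain F i \<Longrightarrow> y \<in> chain G j \<Longrightarrow> t i j x y \<in> Q"
  shows "chain T n \<subseteq> Q"
  by (rule D.total_induct[OF assms(1)], rule P.tensor_induct[OF assms(1)]) (use assms(2) in auto)

lemmas bd_T_mem = linear_map_on_mem[OF bd_T_linear]
  and bd_T_add = linear_map_on_add[OF bd_T_linear]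
  and bd_T_scale = linear_map_on_scale[OF bd_T_linear]
  and bd_T_zero = linear_map_on_zero[OF bd_T_linear D.submodule_total P.module_axioms]
  and bd_T_diff = linear_map_on_diff[OF bd_T_linear D.submodule_total P.module_axioms]
  and bd_T_sum = linear_map_on_sum[OF bd_T_linear D.submodule_total P.module_axioms]

abbreviation sgn_scale :: "nat \<Rightarrow> 'h \<Rightarrow> 'h"
  where "sgn_scale i \<equiv> smul T ((- 1) ^ i)"

lemma sgn_scale_sgn_scale: "sgn_scale i (sgn_scale i w) = w"
  by (simp flip: power_add mult_2)

text \<open>\<open>dl\<close> is \<open>d \<otimes> 1\<close> and \<open>dr\<close> is \<open>1 \<otimes> d\<close>, without the sign.\<close>

definition dl :: "nat \<Rightarrow> nat \<Rightarrow> 'h \<Rightarrow> 'h"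
  where "dl i j = (SOME f. linear_map_on (smul T) (smul T) (S i j) (S (i - 1) j) f \<and>
    (\<forall>x\<in>chain F i. \<forall>y\<in>chain G j. f (t i j x y) = t (i - 1) j (bd F i x) y))"

definition dr :: "nat \<Rightarrow> nat \<Rightarrow> 'h \<Rightarrow> 'h"
  where "dr i j = (SOME f. linear_map_on (smul T) (smul T) (S i j) (S i (j - 1)) f \<and>
    (\<forall>x\<in>chain F i. \<forall>y\<in>chain G j. f (t i j x y) = t i (j - 1) x (bd G j y)))"

lemma dl_props:
  "linear_map_on (smul T) (smul T) (S i j) (S (i - 1) j) (dl i j) \<and>
    (\<forall>x\<in>chain F i. \<forall>y\<in>chain G j. dl i j (t i j x y) = t (i - 1) j (bd F i x) y)"
proof -
  have "bilinear_on (smul F) (chain F i) (smul G) (chain G j) (smul T) (S (i - 1) j)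
      (\<lambda>x y. t (i - 1) j (bd F i x) y)"
    unfolding bilinear_on_def
    using compose_linear[OF F.bd_linear P.tensor_linear_left] P.tensor_linear_right[OF F.bd_mem] by blast
  from someI_ex[OF P.tensor_lift[OF this P.submodule_S]] show ?thesis unfolding dl_def .
qed

lemma dr_props:
  "linear_map_on (smul T) (smul T) (S i j) (S i (j - 1)) (dr i j) \<and>
    (\<forall>x\<in>chain F i. \<forall>y\<in>chain G j. dr i j (t i j x y) = t i (j - 1) x (bd G j y))"
proof -
  have "bilinear_on (smul F) (chain F i) (smul G) (chain G j) (smul T) (S i (j - 1))
      (\<lambda>x y. t i (j - 1) x (bd G j y))"
    unfolding bilinear_on_def
    using compose_linear[OF G.bd_linear P.tensor_linear_right] P.tensor_linear_left[OF G.bd_mem] by blast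
  from someI_ex[OF P.tensor_lift[OF this P.submodule_S]] show ?thesis unfolding dr_def .
qed

lemma dl_linear: "linear_map_on (smul T) (smul T) (S i j) (S (i - 1) j) (dl i j)"
  and dl_tensor: "x \<in> chain F i \<Longrightarrow> y \<in> chain G j \<Longrightarrow> dl i j (t i j x y) = t (i - 1) j (bd F i x) y"
  using dl_props by auto

lemma dr_linear: "linear_map_on (smul T) (smul T) (S i j) (S i (j - 1)) (dr i j)"
  and dr_tensor: "x \<in> chain F i \<Longrightarrow> y \<in> chain G j \<Longrightarrow> dr i j (t i j x y) = t i (j - 1) x (bd G j y)"
  using dr_props by auto

lemmas dl_mem = linear_map_on_mem[OF dl_linear]
  and dl_add = linear_map_on_add[OF dl_linear]
  and dl_scale = linear_map_on_scale[OF dl_linear]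
  and dl_zero = linear_map_on_zero[OF dl_linear P.submodule_S P.module_axioms]

lemmas dr_mem = linear_map_on_mem[OF dr_linear]
  and dr_add = linear_map_on_add[OF dr_linear]
  and dr_scale = linear_map_on_scale[OF dr_linear]
  and dr_zero = linear_map_on_zero[OF dr_linear P.submodule_S P.module_axioms]
  and dr_sum = linear_map_on_sum[OF dr_linear P.submodule_S P.module_axioms]

lemma zero_linear: "submodule (smul T) A \<Longrightarrow> linear_map_on (smul T) (smul T) B A (\<lambda>_. 0)"
  by (rule linear_map_onI) (simp_all add: submodule_zero)

lemma dl_0: "w \<in> S 0 j \<Longrightarrow> dl 0 j w = 0"
  by (rule P.tensor_map_eq[OF dl_linear zero_linear[OF P.submodule_S] P.module_axioms])
    (simp_all add: dl_tensor F.bd_0 P.tensor_zero_left)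

lemma dr_0: "w \<in> S i 0 \<Longrightarrow> dr i 0 w = 0"
  by (rule P.tensor_map_eq[OF dr_linear zero_linear[OF P.submodule_S] P.module_axioms])
    (simp_all add: dr_tensor G.bd_0 P.tensor_zero_right)

lemma dl_dl: "w \<in> S i j \<Longrightarrow> dl (i - 1) j (dl i j w) = 0"
  by (rule P.tensor_map_eq[OF compose_linear[OF dl_linear dl_linear] zero_linear[OF P.submodule_S] P.module_axioms])
    (simp_all add: dl_tensor F.bd_mem F.bd_bd P.tensor_zero_left del: One_nat_def)

lemma dr_dr: "w \<in> S i j \<Longrightarrow> dr i (j - 1) (dr i j w) = 0"
  by (rule P.tensor_map_eq[OF compose_linear[OF dr_linear dr_linear] zero_linear[OF P.submodule_S] P.module_axioms])
    (simp_all add: dr_tensor G.bd_mem G.bd_bd P.tensor_zero_right del: One_nat_def)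

text \<open>The two maps act on different factors and commute; the alternating sign in
  \<open>bd T\<close> turns this into the cancellation behind \<open>bd_T_bd_T\<close>.\<close>

lemma dl_dr: "w \<in> S i j \<Longrightarrow> dl i (j - 1) (dr i j w) = dr (i - 1) j (dl i j w)"
  by (rule P.tensor_map_eq[OF compose_linear[OF dr_linear dl_linear] compose_linear[OF dl_linear dr_linear] P.module_axioms])
    (simp_all add: dr_tensor dl_tensor G.bd_mem F.bd_mem del: One_nat_def)

lemma bd_T_S:
  assumes "w \<in> S i j"
  shows "bd T (i + j) w = dl i j w + sgn_scale i (dr i j w)"
proof (rule P.tensor_map_eq[OF _ _ P.module_axioms _ assms])
  show "linear_map_on (smul T) (smul T) (S i j) UNIV (bd T (i + j))"
    by (rule linear_map_onI) (simp_all add: bd_T_add bd_T_scale S_mem_chain)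
  show "linear_map_on (smul T) (smul T) (S i j) UNIV (\<lambda>w. dl i j w + sgn_scale i (dr i j w))"
    by (rule linear_map_onI)
      (simp_all add: dl_add dl_scale dr_add dr_scale P.scale_right_distrib mult.commute)
qed (simp add: bd_T_tensor dl_tensor dr_tensor del: One_nat_def)

text \<open>\<open>dl\<close> lowers the first index and \<open>dr\<close> keeps it, so position
  \<open>i\<close> of the boundary receives contributions only from positions \<open>Suc i\<close>
  and \<open>i\<close>.\<close>

lemma component_bd_T:
  assumes w: "w \<in> chain T (Suc n)" and i: "i \<le> n"
  shows "D.component n i (bd T (Suc n) w) =
    dl (Suc i) (n - i) (D.component (Suc n) (Suc i) w) + sgn_scale i (dr i (Suc n - i) (D.component (Suc n) i w))"
proof -
  let ?u = "\<lambda>i. D.component (Suc n) i w"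
  have u: "?u i \<in> S i (Suc n - i)" if "i \<le> Suc n" for i using D.component_mem[OF w that] .
  have uC: "?u i \<in> chain T (Suc n)" if "i \<le> Suc n" for i
    using S_mem_chain[OF u[OF that]] that by simp
  have "bd T (Suc n) w = (\<Sum>i\<le>Suc n. bd T (Suc n) (?u i))"
    using uC by (subst (1) D.sum_component[OF w, symmetric]) (intro bd_T_sum, simp)
  also have "\<dots> = (\<Sum>i\<le>Suc n. dl i (Suc n - i) (?u i)) + (\<Sum>i\<le>Suc n. sgn_scale i (dr i (Suc n - i) (?u i)))"
    unfolding sum.distrib[symmetric]
  proof (rule sum.cong)
    fix i assume "i \<in> {..Suc n}"
    then have "i \<le> Suc n" by simp
    from bd_T_S[OF u[OF this]] this
    show "bd T (Suc n) (?u i) = dl i (Suc n - i) (?u i) + sgn_scale i (dr i (Suc n - i) (?u i))"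
      by (metis le_add_diff_inverse)
  qed simp
  \<comment> \<open>The ends of the two sums vanish: \<open>dl\<close> on first index 0 here, and
    \<open>dr\<close> on second index 0 in the next step. After a shift both sums run over the
    positions up to \<open>n\<close>.\<close>
  also have "(\<Sum>i\<le>Suc n. dl i (Suc n - i) (?u i)) = (\<Sum>i\<le>n. dl (Suc i) (n - i) (?u (Suc i)))"
    using dl_0[of "?u 0" "Suc n"] u[of 0] by (subst sum.atMost_Suc_shift) simp
  also have "(\<Sum>i\<le>Suc n. sgn_scale i (dr i (Suc n - i) (?u i))) = (\<Sum>i\<le>n. sgn_scale i (dr i (Suc n - i) (?u i)))"
    using dr_0[of "?u (Suc n)" "Suc n"] u[of "Suc n"] by (subst sum.atMost_Suc) simp
  finally have bd: "bd T (Suc n) w =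
      (\<Sum>i\<le>n. dl (Suc i) (n - i) (?u (Suc i)) + sgn_scale i (dr i (Suc n - i) (?u i)))"
    by (simp add: sum.distrib)
  show ?thesis
    unfolding bd
  proof (rule D.component_sum[OF _ i])
    fix i assume i: "i \<le> n"
    have "dl (Suc i) (n - i) (?u (Suc i)) \<in> S i (n - i)"
      using dl_mem[of "?u (Suc i)" "Suc i" "n - i"] u[of "Suc i"] i by simp
    moreover have "dr i (Suc n - i) (?u i) \<in> S i (n - i)"
      using dr_mem[of "?u i" i "Suc n - i"] u[of i] i by (simp add: Suc_diff_le)
    ultimately show "dl (Suc i) (n - i) (?u (Suc i)) + sgn_scale i (dr i (Suc n - i) (?u i)) \<in> S i (n - i)"
      by (intro submodule_add[OF P.submodule_S] submodule_scale[OF P.submodule_S])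
  qed
qed

lemma bd_T_0: "w \<in> chain T 0 \<Longrightarrow> bd T 0 w = 0"
proof -
  have "linear_map_on (smul T) (smul T) (chain T 0) (chain T 0) (bd T 0)" using bd_T_linear[of 0] by simp
  then have "submodule (smul T) {w \<in> chain T 0. bd T 0 w \<in> {0}}"
    by (rule linear_map_on_vimage[OF _ D.submodule_total P.module_axioms])
      (simp add: submodule_def P.module_axioms)
  then have "chain T 0 \<subseteq> {w \<in> chain T 0. bd T 0 w \<in> {0}}"
    by (rule chain_T_induct)
      (use bd_T_S[of _ 0 0] dl_0[of _ 0] dr_0[of _ 0] S_mem_chain[of _ 0 0] P.tensor_mem in auto)
  then show "w \<in> chain T 0 \<Longrightarrow> bd T 0 w = 0" by blast
qed

lemma bd_T_bd_T:
  assumes w: "w \<in> chain T n"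
  shows "bd T (n - 1) (bd T n w) = 0"
proof -
  have "chain T n \<subseteq> {w \<in> chain T n. bd T (n - 1) (bd T n w) \<in> {0}}"
  proof (rule chain_T_induct)
    show "submodule (smul T) {w \<in> chain T n. bd T (n - 1) (bd T n w) \<in> {0}}"
      by (rule linear_map_on_vimage[OF compose_linear[OF bd_T_linear bd_T_linear] D.submodule_total P.module_axioms])
        (simp add: submodule_def P.module_axioms)
    fix i j x y assume n: "i + j = n" and xy: "x \<in> chain F i" "y \<in> chain G j"
    define w where "w = t i j x y"
    have w: "w \<in> S i j" unfolding w_def using xy by (rule P.tensor_mem)
    \<comment> \<open>For \<open>i = 0\<close> the truncated index \<open>i - 1\<close> would name
      the wrong bidegree, but then \<open>dl i j w\<close> is 0; similarly for \<open>dr\<close> and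
      \<open>j = 0\<close> below.\<close>
    have l: "bd T (n - 1) (dl i j w) = (if i = 0 then 0 else sgn_scale (i - 1) (dr (i - 1) j (dl i j w)))"
    proof (cases "i = 0")
      case False
      then have "bd T (n - 1) (dl i j w) = dl (i - 1) j (dl i j w) + sgn_scale (i - 1) (dr (i - 1) j (dl i j w))"
        using bd_T_S[OF dl_mem[OF w]] n by (simp add: Nat.diff_add_assoc2)
      then show ?thesis using False dl_dl[OF w] by simp
    qed (use w dl_0 bd_T_zero in simp)
    have r: "bd T (n - 1) (dr i j w) = dl i (j - 1) (dr i j w)"
    proof (cases "j = 0")
      case True
      then show ?thesis using w dr_0 bd_T_zero dl_zero by simp
    next
      case False
      then have "bd T (n - 1) (dr i j w) = dl i (j - 1) (dr i j w) + sgn_scale i (dr i (j - 1) (dr i j w))"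
        using bd_T_S[OF dr_mem[OF w]] n by simp
      then show ?thesis using dr_dr[OF w] by simp
    qed
    have mem: "dl i j w \<in> chain T (n - 1)" "dr i j w \<in> chain T (n - 1)"
    proof -
      show "dl i j w \<in> chain T (n - 1)"
      proof (cases "i = 0")
        case True
        then show ?thesis using w dl_0 submodule_zero[OF D.submodule_total] by simp
      next
        case False
        then show ?thesis using S_mem_chain[OF dl_mem[OF w]] n by (simp add: Nat.diff_add_assoc2)
      qed
      show "dr i j w \<in> chain T (n - 1)"
      proof (cases "j = 0")
        case True
        then show ?thesis using w dr_0 submodule_zero[OF D.submodule_total] by simp
      next
        case False
        then show ?thesis using S_mem_chain[OF dr_mem[OF w]] n by simp
      qed
    qed
    have "bd T (n - 1) (bd T n w) = bd T (n - 1) (dl i j w) + sgn_scale i (bd T (n - 1) (dr i j w))"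
      using bd_T_S[OF w] n mem bd_T_add[OF mem(1) submodule_scale[OF D.submodule_total mem(2)]]
      by (simp add: bd_T_scale)
    also have "\<dots> = 0"
      using dl_dr[OF w] dl_0[of w j] w unfolding l r by (cases i) (auto simp: dr_zero)
    finally show "t i j x y \<in> {w \<in> chain T n. bd T (n - 1) (bd T n w) \<in> {0}}"
      using S_mem_chain[OF w] n unfolding w_def by simp
  qed
  then show ?thesis using w by blast
qed

end


section \<open>Bases, grading and minimality of the tensor complex\<close>

context tensor_of_resolutions
begin

abbreviation "XT n \<equiv> (SIGMA i:{..n}. XF i \<times> XG (n - i))"
abbreviation "eT n \<equiv> (\<lambda>(i, z). (\<lambda>(x, y). t i (n - i) x y) z)"
abbreviation "kT n \<equiv> (\<lambda>w (i, z). if i \<le> n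
  then (\<lambda>(x, y). kG (n - i) (P.slice i (n - i) x (D.component n i w)) y) z else 0)"
abbreviation "degT n \<equiv> (\<lambda>(i, x, y). degF i x + degG (n - i) y)"

lemma free_basis_T: "free_basis (smul T) (chain T n) (XT n) (eT n) (kT n)"
  by (rule D.free_basis_direct_sum) (rule P.free_basis_tensor[OF G.B.free_basis_axioms])

lemma coord_T_tensor:
  assumes "x \<in> chain F i" "y \<in> chain G j"
  shows "kT (i + j) (t i j x y) (l, a, b) = (if l = i then kF i x a * kG j y b else 0)"
proof (cases "l \<le> i + j")
  case True
  have "t i j x y \<in> S i (i + j - i)" using P.tensor_mem[OF assms] by simp
  from D.component_summand[OF _ this True]
  have "D.component (i + j) l (t i j x y) = (if l = i then t i j x y else 0)" by simp
  then show ?thesis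
    using assms by (auto simp: P.slice_tensor P.slice_zero G.B.coord_zero G.B.coord_scale)
qed auto

text \<open>The components of \<open>T\<close> are given as spans over K, those of the basis by
  coordinates. Generators have product coordinates, so their degrees add; conversely each term of an
  expansion is a pure tensor of homogeneous elements once its monomial is moved into the left
  factor.\<close>

lemma graded_free_basis_T: "graded_free_basis (smul T) (chain T n) (XT n) (eT n) (kT n) (hcomp T n) (degT n)"
proof -
  define H' where "H' \<alpha> = {u \<in> chain T n. \<forall>x \<gamma>. Poly_Mapping.lookup (kT n u x) \<gamma> \<noteq> 0 \<longrightarrow> \<gamma> + degT n x = \<alpha>}" for \<alpha>
  interpret B: graded_free_basis "smul T" "chain T n" "XT n" "eT n" "kT n" H' "degT n"
    using free_basis_T by (intro graded_free_basis.intro graded_free_basis_axioms.intro) (simp_all only: H'_def)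
  let ?sK = "\<lambda>c. smul T (Poly_Mapping.single 0 c)"
  interpret K: module ?sK by (rule module_constants[OF P.module_axioms])
  have "hcomp T n \<alpha> = H' \<alpha>" for \<alpha>
  proof
    let ?gen = "{t i j x y | i j x y \<beta> \<gamma>. i + j = n \<and> \<beta> + \<gamma> = \<alpha> \<and> x \<in> hcomp F i \<beta> \<and> y \<in> hcomp G j \<gamma>}"
    show "hcomp T n \<alpha> \<subseteq> H' \<alpha>"
      unfolding hcomp_T
    proof (rule K.span_minimal)
      show "K.subspace (H' \<alpha>)"
        using B.component_zero B.component_add B.component_scale[of _ \<alpha> 0] by (intro K.subspaceI) simp_all
      show "?gen \<subseteq> H' \<alpha>"
      proof
        fix w assume "w \<in> ?gen"
        then obtain i j x y \<beta> \<gamma> where w: "w = t i j x y" "i + j = n" "\<beta> + \<gamma> = \<alpha>" "x \<in> hcomp F i \<beta>" "y \<in> hcomp G j \<gamma>"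
          by blast
        have xy: "x \<in> chain F i" "y \<in> chain G j" using w F.B.component_mem G.B.component_mem by blast+
        have "\<delta> + degT n z = \<alpha>" if "Poly_Mapping.lookup (kT n w z) \<delta> \<noteq> 0" for z \<delta>
        proof -
          obtain l a b where z: "z = (l, a, b)" by (cases z)
          have l: "l = i" and \<delta>: "\<delta> \<in> Poly_Mapping.keys (kF i x a * kG j y b)"
            using that coord_T_tensor[OF xy, of l a b] w(1,2) unfolding z by (auto simp: in_keys_iff split: if_splits)
          obtain \<delta>1 \<delta>2 where d: "\<delta> = \<delta>1 + \<delta>2" "\<delta>1 \<in> Poly_Mapping.keys (kF i x a)" "\<delta>2 \<in> Poly_Mapping.keys (kG j y b)"
            using subsetD[OF keys_mult \<delta>] by blast
          have "\<delta>1 + degF i a = \<beta>" "\<delta>2 + degG j b = \<gamma>"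
            using F.B.coord_component[OF w(4)] G.B.coord_component[OF w(5)] d by (auto simp: in_keys_iff)
          then show ?thesis using w(2,3) d(1) l z by (auto simp: ac_simps)
        qed
        moreover have "w \<in> chain T n" using S_mem_chain[OF P.tensor_mem[OF xy]] w by simp
        ultimately show "w \<in> H' \<alpha>" unfolding H'_def by blast
      qed
    qed
    show "H' \<alpha> \<subseteq> hcomp T n \<alpha>"
    proof
      fix w assume w: "w \<in> H' \<alpha>"
      have "smul T (kT n w z) (eT n z) \<in> hcomp T n \<alpha>" if "kT n w z \<noteq> 0" for z
      proof -
        let ?c = "kT n w z"
        have "z \<in> XT n" using that B.coord_outside[OF B.component_mem[OF w]] by blast
        then obtain i a b where z: "z = (i, a, b)" "i \<le> n" "a \<in> XF i" "b \<in> XG (n - i)" by auto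
        have ab: "a \<in> chain F i" "b \<in> chain G (n - i)" using z F.B.basis_mem G.B.basis_mem by auto
        have "smul T ?c (eT n z) =
            (\<Sum>\<gamma>\<in>Poly_Mapping.keys ?c. smul T (Poly_Mapping.single \<gamma> (Poly_Mapping.lookup ?c \<gamma>)) (eT n z))"
          by (subst (1) poly_mapping_sum_single[of ?c, symmetric]) (rule P.scale_sum_left)
        also have "\<dots> \<in> hcomp T n \<alpha>"
          unfolding hcomp_T
        proof (rule K.span_sum)
          fix \<gamma> assume "\<gamma> \<in> Poly_Mapping.keys ?c"
          then have \<gamma>: "\<gamma> + degT n z = \<alpha>" using B.coord_component[OF w, of z \<gamma>] by (simp add: in_keys_iff)
          let ?r = "Poly_Mapping.single \<gamma> (Poly_Mapping.lookup ?c \<gamma>)"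
          have "smul T ?r (eT n z) = t i (n - i) (smul F ?r a) b"
            using ab by (simp add: z P.tensor_scale_left)
          moreover have "smul F ?r a \<in> hcomp F i (\<gamma> + degF i a)" "b \<in> hcomp G (n - i) (degG (n - i) b)"
            using F.B.component_scale[OF F.B.basis_component[OF z(3)]] G.B.basis_component[OF z(4)] by auto
          moreover have "(\<gamma> + degF i a) + degG (n - i) b = \<alpha>" "i + (n - i) = n"
            using \<gamma> z by (simp_all add: ac_simps)
          ultimately show "smul T ?r (eT n z) \<in> K.span ?gen"
            by (intro K.span_base) blast
        qed
        finally show ?thesis .
      qed
      then have "(\<Sum>z | kT n w z \<noteq> 0. smul T (kT n w z) (eT n z)) \<in> hcomp T n \<alpha>"
        unfolding hcomp_T by (intro K.span_sum) blast
      then show "w \<in> hcomp T n \<alpha>" using B.expand[OF B.component_mem[OF w]] by simp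
    qed
  qed
  then have "hcomp T n = H'" by blast
  then show ?thesis using B.graded_free_basis_axioms by simp
qed

sublocale BT: graded_free_basis "smul T" "chain T n" "XT n" "eT n" "kT n" "hcomp T n" "degT n" for n
  by (rule graded_free_basis_T)

lemma bd_T_graded:
  assumes "w \<in> hcomp T n \<alpha>"
  shows "bd T n w \<in> hcomp T (n - 1) \<alpha>"
proof -
  let ?sK = "\<lambda>c. smul T (Poly_Mapping.single 0 c)"
  interpret K: module ?sK by (rule module_constants[OF P.module_axioms])
  let ?Q = "{w \<in> chain T n. bd T n w \<in> hcomp T (n - 1) \<alpha>}"
  have K_scale: "smul T (Poly_Mapping.single 0 c) w \<in> hcomp T m \<alpha>" if "w \<in> hcomp T m \<alpha>" for c w m
    using BT.component_scale[OF that, of 0 c] by simp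
  \<comment> \<open>A sign is a constant polynomial, so it preserves multidegree.\<close>
  have sgn: "sgn_scale i w \<in> hcomp T m \<alpha>" if "w \<in> hcomp T m \<alpha>" for i w m
    using K_scale[OF that, of "- 1"] that by (cases "even i") (simp_all add: single_uminus)
  have gen: "t i j x y \<in> hcomp T (i + j) \<alpha>" if "x \<in> hcomp F i \<beta>" "y \<in> hcomp G j \<gamma>" "\<beta> + \<gamma> = \<alpha>" for i j x y \<beta> \<gamma>
    unfolding hcomp_T using that by (intro K.span_base) blast
  have "hcomp T n \<alpha> \<subseteq> ?Q"
    unfolding hcomp_T[of n]
  proof (rule K.span_minimal)
    show "K.subspace ?Q"
    proof (rule K.subspaceI)
      show "0 \<in> ?Q" using BT.component_zero submodule_zero[OF D.submodule_total] by (simp add: bd_T_zero)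
      show "u + v \<in> ?Q" if "u \<in> ?Q" "v \<in> ?Q" for u v
        using that BT.component_add submodule_add[OF D.submodule_total] by (simp add: bd_T_add)
      show "?sK c u \<in> ?Q" if "u \<in> ?Q" for c u
        using that K_scale submodule_scale[OF D.submodule_total] by (simp add: bd_T_scale)
    qed
    show "{t i j x y | i j x y \<beta> \<gamma>. i + j = n \<and> \<beta> + \<gamma> = \<alpha> \<and> x \<in> hcomp F i \<beta> \<and> y \<in> hcomp G j \<gamma>} \<subseteq> ?Q"
    proof
      fix w assume "w \<in> {t i j x y | i j x y \<beta> \<gamma>. i + j = n \<and> \<beta> + \<gamma> = \<alpha> \<and> x \<in> hcomp F i \<beta> \<and> y \<in> hcomp G j \<gamma>}"
      then obtain i j x y \<beta> \<gamma> where w: "w = t i j x y" "i + j = n" "\<beta> + \<gamma> = \<alpha>" "x \<in> hcomp F i \<beta>" "y \<in> hcomp G j \<gamma>"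
        by blast
      have xy: "x \<in> chain F i" "y \<in> chain G j" using w F.B.component_mem G.B.component_mem by blast+
      have "t (i - 1) j (bd F i x) y \<in> hcomp T (n - 1) \<alpha>"
      proof (cases "i = 0")
        case True
        then show ?thesis using xy F.bd_0 P.tensor_zero_left BT.component_zero by simp
      next
        case False
        then show ?thesis using gen[OF F.bd_graded[OF w(4)] w(5,3)] w(2) by (simp add: Nat.diff_add_assoc2)
      qed
      moreover have "t i (j - 1) x (bd G j y) \<in> hcomp T (n - 1) \<alpha>"
      proof (cases "j = 0")
        case True
        then show ?thesis using xy G.bd_0 P.tensor_zero_right BT.component_zero by simp
      next
        case False
        then show ?thesis using gen[OF w(4) G.bd_graded[OF w(5)] w(3)] w(2) by simp
      qed
      ultimately have "bd T n w \<in> hcomp T (n - 1) \<alpha>"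
        using bd_T_tensor[OF xy] w(1,2) BT.component_add sgn by simp
      moreover have "w \<in> chain T n" using S_mem_chain[OF P.tensor_mem[OF xy]] w by simp
      ultimately show "w \<in> ?Q" by blast
    qed
  qed
  then show ?thesis using assms by blast
qed

lemma is_mg_complex_T: "is_mg_complex T"
  unfolding is_mg_complex_def
  using BT.multigraded_free bd_T_linear bd_T_graded bd_T_bd_T bd_T_0
  unfolding multigraded_free_module_def by blast

text \<open>A scalar from the irrelevant ideal in either factor comes out of the tensor. In degree
  0, where minimality of a factor says nothing, the corresponding summand vanishes.\<close>

lemma minimal_T:
  assumes "n \<ge> 1"
  shows "bd T n ` chain T n \<subseteq> ideal_smult (smul T) irrelevant_ideal (chain T (n - 1))"
proof -
  let ?m = "irrelevant_ideal :: ('v, 'k) mpoly set"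
  let ?irr = "ideal_smult (smul T) ?m (chain T (n - 1))"
  have irr: "submodule (smul T) ?irr"
    unfolding ideal_smult_def by (rule submodule_span[OF P.module_axioms])
  have base: "smul T r w \<in> ?irr" if "r \<in> ?m" "w \<in> chain T (n - 1)" for r w
    unfolding ideal_smult_def using that by (intro P.span_base) blast
  have l: "t i j x y \<in> ?irr"
    if ij: "i + j = n - 1" and x: "x \<in> ideal_smult (smul F) ?m (chain F i)" and y: "y \<in> chain G j" for i j x y
  proof -
    have "ideal_smult (smul F) ?m (chain F i) \<subseteq> {x \<in> chain F i. t i j x y \<in> ?irr}"
      unfolding ideal_smult_def[of "smul F"]
      by (intro span_subset_submodule linear_map_on_vimage[OF P.tensor_linear_left[OF y] F.B.submodule P.module_axioms irr])
        (use base S_mem_chain[OF P.tensor_mem[of _ i y j]] ij y submodule_scale[OF F.B.submodule]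
          in \<open>auto simp: P.tensor_scale_left\<close>)
    then show ?thesis using x by blast
  qed
  have r: "t i j x y \<in> ?irr"
    if ij: "i + j = n - 1" and y: "y \<in> ideal_smult (smul G) ?m (chain G j)" and x: "x \<in> chain F i" for i j x y
  proof -
    have "ideal_smult (smul G) ?m (chain G j) \<subseteq> {y \<in> chain G j. t i j x y \<in> ?irr}"
      unfolding ideal_smult_def[of "smul G"]
      by (intro span_subset_submodule linear_map_on_vimage[OF P.tensor_linear_right[OF x] G.B.submodule P.module_axioms irr])
        (use base S_mem_chain[OF P.tensor_mem[of x i _ j]] ij x submodule_scale[OF G.B.submodule]
          in \<open>auto simp: P.tensor_scale_right\<close>)
    then show ?thesis using y by blast
  qed
  have "chain T n \<subseteq> {w \<in> chain T n. bd T n w \<in> ?irr}"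
  proof (rule chain_T_induct)
    show "submodule (smul T) {w \<in> chain T n. bd T n w \<in> ?irr}"
      by (rule linear_map_on_vimage[OF bd_T_linear D.submodule_total P.module_axioms irr])
    fix i j x y assume n: "i + j = n" and xy: "x \<in> chain F i" "y \<in> chain G j"
    have "t (i - 1) j (bd F i x) y \<in> ?irr"
    proof (cases "i = 0")
      case True
      then show ?thesis using xy F.bd_0 P.tensor_zero_left submodule_zero[OF irr] by simp
    next
      case False
      then show ?thesis using F.minimal[of i] xy n by (intro l) auto
    qed
    moreover have "t i (j - 1) x (bd G j y) \<in> ?irr"
    proof (cases "j = 0")
      case True
      then show ?thesis using xy G.bd_0 P.tensor_zero_right submodule_zero[OF irr] by simp
    next
      case False
      then show ?thesis using G.minimal[of j] xy n by (intro r) auto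
    qed
    ultimately have "bd T n (t i j x y) \<in> ?irr"
      using bd_T_tensor[OF xy] n submodule_add[OF irr] submodule_scale[OF irr] by simp
    then show "t i j x y \<in> {w \<in> chain T n. bd T n w \<in> ?irr}"
      using S_mem_chain[OF P.tensor_mem[OF xy]] n by simp
  qed
  then show ?thesis by blast
qed


section \<open>Acyclicity of the tensor product\<close>

text \<open>Row \<open>i\<close> is a direct sum of copies of \<open>G\<close> indexed by
  \<open>XF i\<close>, and its projections are chain maps.\<close>

lemma slice_dr: "w \<in> S i j \<Longrightarrow> P.slice i (j - 1) x (dr i j w) = bd G j (P.slice i j x w)"
  by (rule P.tensor_map_eq[OF compose_linear[OF dr_linear P.slice_linear]
        compose_linear[OF P.slice_linear G.bd_linear] G.B.module_axioms])
    (simp_all add: dr_tensor P.slice_tensor G.bd_mem G.bd_scale del: One_nat_def)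

text \<open>The slices are lifted separately; only finitely many are nonzero, so the lifts can be
  summed.\<close>

lemma row_lift:
  assumes w: "w \<in> S i j"
    and lift: "\<And>x. x \<in> XF i \<Longrightarrow> P.slice i j x w \<in> bd G (Suc j) ` chain G (Suc j)"
  shows "w \<in> dr i (Suc j) ` S i (Suc j)"
proof -
  have "\<forall>x\<in>XF i. \<exists>y. y \<in> chain G (Suc j) \<and> P.slice i j x w = bd G (Suc j) y"
    using lift by blast
  from bchoice[OF this] obtain g
    where g: "\<And>x. x \<in> XF i \<Longrightarrow> g x \<in> chain G (Suc j) \<and> P.slice i j x w = bd G (Suc j) (g x)"
    by blast
  let ?A = "{x. P.slice i j x w \<noteq> 0}"
  have A: "?A \<subseteq> XF i" by (rule P.slice_support[OF w])
  have t: "t i (Suc j) x (g x) \<in> S i (Suc j)" if "x \<in> ?A" for x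
    using that A g F.B.basis_mem by (intro P.tensor_mem) auto
  have "dr i (Suc j) (\<Sum>x\<in>?A. t i (Suc j) x (g x)) = (\<Sum>x\<in>?A. dr i (Suc j) (t i (Suc j) x (g x)))"
    using t by (rule dr_sum)
  also have "\<dots> = (\<Sum>x\<in>?A. t i j x (P.slice i j x w))"
    using A g F.B.basis_mem by (intro sum.cong) (auto simp: dr_tensor subset_iff)
  also have "\<dots> = w" by (rule P.slice_expand[OF w])
  finally have eq: "dr i (Suc j) (\<Sum>x\<in>?A. t i (Suc j) x (g x)) = w" .
  have "(\<Sum>x\<in>?A. t i (Suc j) x (g x)) \<in> S i (Suc j)" using t by (rule submodule_sum[OF P.submodule_S])
  then have "dr i (Suc j) (\<Sum>x\<in>?A. t i (Suc j) x (g x)) \<in> dr i (Suc j) ` S i (Suc j)" by (rule imageI)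
  then show ?thesis unfolding eq .
qed

lemma row_exact:
  assumes w: "w \<in> S i j" and "dr i j w = 0" and j: "j \<ge> 1"
  shows "w \<in> dr i (Suc j) ` S i (Suc j)"
proof (rule row_lift[OF w])
  fix x
  have "bd G j (P.slice i j x w) = 0"
    using slice_dr[OF w, of x] assms(2) P.slice_zero by simp
  then show "P.slice i j x w \<in> bd G (Suc j) ` chain G (Suc j)"
    using G.exact[OF j] P.slice_mem[OF w] by auto
qed

text \<open>The map \<open>F\<^sub>i \<otimes> G\<^sub>0 \<rightarrow> F\<^sub>i\<close> induced by \<open>rhoG\<close>; modulo \<open>J\<close> it is the quotient map of \<open>F\<^sub>i \<otimes> G\<^sub>0\<close>
  by the image of \<open>F\<^sub>i \<otimes> G\<^sub>1\<close>.\<close>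

definition proj :: "nat \<Rightarrow> 'h \<Rightarrow> 'f"
  where "proj i = (SOME f. linear_map_on (smul T) (smul F) (S i 0) (chain F i) f \<and>
    (\<forall>x\<in>chain F i. \<forall>y\<in>chain G 0. f (t i 0 x y) = smul F (rhoG y) x))"

lemma proj_props:
  "linear_map_on (smul T) (smul F) (S i 0) (chain F i) (proj i) \<and>
    (\<forall>x\<in>chain F i. \<forall>y\<in>chain G 0. proj i (t i 0 x y) = smul F (rhoG y) x)"
proof -
  have "bilinear_on (smul F) (chain F i) (smul G) (chain G 0) (smul F) (chain F i) (\<lambda>x y. smul F (rhoG y) x)"
    unfolding bilinear_on_def
    by (auto intro!: linear_map_onI submodule_scale[OF F.B.submodule]
        simp: F.B.scale_right_distrib F.B.scale_left_distrib G.rho_add G.rho_scale mult.commute)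
  from someI_ex[OF P.tensor_lift[OF this F.B.submodule]] show ?thesis unfolding proj_def .
qed

lemma proj_linear: "linear_map_on (smul T) (smul F) (S i 0) (chain F i) (proj i)"
  and proj_tensor: "x \<in> chain F i \<Longrightarrow> y \<in> chain G 0 \<Longrightarrow> proj i (t i 0 x y) = smul F (rhoG y) x"
  using proj_props by auto

lemmas proj_mem = linear_map_on_mem[OF proj_linear]
  and proj_diff = linear_map_on_diff[OF proj_linear P.submodule_S F.B.module_axioms]

text \<open>Coordinatewise, \<open>proj\<close> is the augmentation of each copy of
  \<open>G\<close>, so statements about it reduce to \<open>rhoG\<close>.\<close>

lemma coord_proj: "w \<in> S i 0 \<Longrightarrow> kF i (proj i w) b = rhoG (P.slice i 0 b w)"
  by (rule P.tensor_map_eq[OF compose_linear[OF proj_linear F.B.coord_linear]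
        compose_linear[OF P.slice_linear G.rho_linear] module_mult])
    (simp_all add: proj_tensor P.slice_tensor F.B.coord_scale G.rho_scale mult.commute)

lemma bd_proj: "w \<in> S i 0 \<Longrightarrow> bd F i (proj i w) = proj (i - 1) (dl i 0 w)"
  by (rule P.tensor_map_eq[OF compose_linear[OF proj_linear F.bd_linear]
        compose_linear[OF dl_linear proj_linear] F.B.module_axioms])
    (simp_all add: proj_tensor dl_tensor F.bd_mem F.bd_scale del: One_nat_def)

text \<open>This is the submodule JF_i, in coordinates because F_i is free.\<close>

definition mod_J :: "nat \<Rightarrow> 'f set"
  where "mod_J i = {x \<in> chain F i. \<forall>b. kF i x b \<in> J}"

lemma submodule_mod_J: "submodule (smul F) (mod_J i)"
  unfolding mod_J_def
  by (intro submoduleI F.B.module_axioms)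
    (auto simp: F.B.coord_zero F.B.coord_add F.B.coord_scale submodule_zero[OF F.B.submodule]
      submodule_add[OF F.B.submodule] submodule_scale[OF F.B.submodule]
      submodule_zero[OF G.ideal] submodule_add[OF G.ideal] submodule_scale[OF G.ideal])

lemma scale_mod_J: "r \<in> J \<Longrightarrow> x \<in> chain F i \<Longrightarrow> smul F r x \<in> mod_J i"
  unfolding mod_J_def using submodule_scale[OF F.B.submodule] submodule_scale[OF G.ideal]
  by (auto simp: F.B.coord_scale mult.commute)

lemma proj_dr:
  assumes w: "w \<in> S i 1"
  shows "proj i (dr i 1 w) \<in> mod_J i"
proof -
  have d: "dr i 1 w \<in> S i 0" using dr_mem[OF w] by simp
  have "kF i (proj i (dr i 1 w)) b \<in> J" for b
  proof -
    have "kF i (proj i (dr i 1 w)) b = rhoG (bd G 1 (P.slice i 1 b w))"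
      using coord_proj[OF d] slice_dr[OF w] by simp
    then show ?thesis using P.slice_mem[OF w] G.rho_kernel by auto
  qed
  then show ?thesis unfolding mod_J_def using proj_mem[OF d] by blast
qed

text \<open>Exactness of row \<open>i\<close> at F_i \<otimes> G_0: each slice has augmentation in
  \<open>J\<close> and is therefore a boundary from G_1.\<close>

lemma proj_mod_J_imp:
  assumes w: "w \<in> S i 0" and p: "proj i w \<in> mod_J i"
  shows "w \<in> dr i 1 ` S i 1"
proof -
  have "P.slice i 0 x w \<in> bd G (Suc 0) ` chain G (Suc 0)" for x
  proof -
    have "rhoG (P.slice i 0 x w) \<in> J" using p coord_proj[OF w] unfolding mod_J_def by auto
    then show ?thesis using P.slice_mem[OF w] G.rho_kernel by auto
  qed
  then show ?thesis using row_lift[OF w] by simp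
qed

text \<open>Solves for \<open>w\<close> in the two bottom entries at once: a preimage
  \<open>z\<close> modulo JF_i is lifted to the column of G_0, and what remains projects into JF_i
  and comes from the row.\<close>

lemma proj_step:
  assumes w: "w \<in> S i 0" and z: "z \<in> chain F (Suc i)" and p: "proj i w - bd F (Suc i) z \<in> mod_J i"
  shows "\<exists>a\<in>S (Suc i) 0. \<exists>b\<in>S i 1. w = dl (Suc i) 0 a + dr i 1 b"
proof -
  obtain y where y: "y \<in> chain G 0" "rhoG y - 1 \<in> J" using G.rho_one by blast
  \<comment> \<open>As \<open>rhoG y\<close> is 1 modulo \<open>J\<close>, this element projects to
    \<open>z\<close> modulo JF.\<close>
  define a where "a = t (Suc i) 0 z y"
  have a: "a \<in> S (Suc i) 0" unfolding a_def using z y by (intro P.tensor_mem)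
  have da: "dl (Suc i) 0 a \<in> S i 0" using dl_mem[OF a] by simp
  have dz: "bd F (Suc i) z \<in> chain F i" using F.bd_mem[OF z] by simp
  have "proj i (w - dl (Suc i) 0 a) = proj i w - smul F (rhoG y) (bd F (Suc i) z)"
    using w da z y dz by (simp add: proj_diff) (simp add: a_def dl_tensor proj_tensor)
  also have "\<dots> = (proj i w - bd F (Suc i) z) - smul F (rhoG y - 1) (bd F (Suc i) z)"
    by (simp add: F.B.scale_left_diff_distrib)
  also have "\<dots> \<in> mod_J i"
    using p scale_mod_J[OF y(2) dz] by (rule submodule_diff[OF submodule_mod_J])
  finally have "w - dl (Suc i) 0 a \<in> dr i 1 ` S i 1"
    using w da by (intro proj_mod_J_imp submodule_diff[OF P.submodule_S])
  then obtain b where "b \<in> S i 1" "w - dl (Suc i) 0 a = dr i 1 b" by blast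
  then show ?thesis using a by (metis add.commute diff_add_cancel)
qed

text \<open>The error term left by a correction in position \<open>m\<close> lies in position
  \<open>m - 1\<close>, or is 0 when \<open>m\<close> is 0. So positions from \<open>m\<close> on,
  once cleared, stay cleared.\<close>

lemma
  assumes b: "b \<in> S m (Suc (n - m))" and m: "m \<le> n"
  shows dl_mem_chain: "dl m (Suc (n - m)) b \<in> chain T n"
    and component_dl_0: "m \<le> i \<Longrightarrow> i \<le> n \<Longrightarrow> D.component n i (dl m (Suc (n - m)) b) = 0"
proof -
  have "dl m (Suc (n - m)) b \<in> chain T n \<and>
      (m \<le> i \<longrightarrow> i \<le> n \<longrightarrow> D.component n i (dl m (Suc (n - m)) b) = 0)" for i
  proof (cases m)
    case 0
    then show ?thesis
      using dl_0 b submodule_zero[OF D.submodule_total]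
        linear_map_on_zero[OF D.component_linear D.submodule_total P.module_axioms] by simp
  next
    case (Suc l)
    then have "dl m (Suc (n - m)) b \<in> S l (n - l)" "l \<le> n"
      using dl_mem[OF b] m by (simp_all add: Suc_diff_Suc)
    then show ?thesis
      using D.summand_mem[of l n] D.component_summand[of l n "dl m (Suc (n - m)) b" i] Suc by auto
  qed
  then show "dl m (Suc (n - m)) b \<in> chain T n"
    and "m \<le> i \<Longrightarrow> i \<le> n \<Longrightarrow> D.component n i (dl m (Suc (n - m)) b) = 0" by auto
qed

lemmas component_T_zero = linear_map_on_zero[OF D.component_linear D.submodule_total P.module_axioms]
  and component_T_diff = linear_map_on_diff[OF D.component_linear D.submodule_total P.module_axioms]
  and component_T_add = linear_map_on_add[OF D.component_linear]
  and component_T_scale = linear_map_on_scale[OF D.component_linear]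

text \<open>
  A cycle is reduced modulo boundaries to one with vanishing components in \<open>F\<^sub>i \<otimes> G\<^bsub>n - i\<^esub>\<close> for
  \<open>i \<ge> m\<close>, for decreasing \<open>m\<close>: the first step uses the exactness of \<open>F/JF\<close>, the others the
  exactness of \<open>F\<^sub>i \<otimes> G\<close>.
\<close>

lemma cycle_is_boundary:
  assumes tor: "\<And>i x. i \<ge> 1 \<Longrightarrow> x \<in> chain F i \<Longrightarrow> bd F i x \<in> mod_J (i - 1) \<Longrightarrow>
      \<exists>z\<in>chain F (i + 1). x - bd F (i + 1) z \<in> mod_J i"
    and n: "n \<ge> 1"
  shows "m \<le> Suc n \<Longrightarrow> w \<in> chain T n \<Longrightarrow> bd T n w = 0 \<Longrightarrow>
    (\<And>i. m \<le> i \<Longrightarrow> i \<le> n \<Longrightarrow> D.component n i w = 0) \<Longrightarrow> w \<in> bd T (Suc n) ` chain T (Suc n)"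
proof (induction m arbitrary: w)
  case 0
  have "(\<Sum>i\<le>n. D.component n i w) = 0" by (rule sum.neutral) (use 0 in auto)
  then have "w = bd T (Suc n) 0" using D.sum_component[OF 0(2)] bd_T_zero by simp
  then show ?case using submodule_zero[OF D.submodule_total] by blast
next
  case (Suc m)
  then have m: "m \<le> n" by simp
  obtain n' where n': "n = Suc n'" using n by (cases n) auto
  have w: "w \<in> chain T (Suc n')" using Suc.prems(2) n' by simp
  let ?u = "\<lambda>i. D.component n i w"
  have u: "?u i \<in> S i (n - i)" if "i \<le> n" for i using D.component_mem[OF Suc.prems(2) that] .
  \<comment> \<open>The cycle condition position by position: adjacent components are linked by
    \<open>dl\<close> of the upper and \<open>dr\<close> of the lower one.\<close>
  have cycle: "dl (Suc i) (n' - i) (?u (Suc i)) + sgn_scale i (dr i (n - i) (?u i)) = 0" if "i \<le> n'" for i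
    using component_bd_T[OF w that] Suc.prems(3) component_T_zero[OF that] unfolding n' by simp
  \<comment> \<open>The boundary of \<open>c\<close> cancels the top remaining component and
    otherwise only changes the position below it.\<close>
  have "\<exists>c\<in>chain T (Suc n). \<exists>b\<in>S m (Suc (n - m)). bd T (Suc n) c = ?u m + sgn_scale m (dl m (Suc (n - m)) b)"
  proof (cases "m = n")
    case True
    have un: "?u n \<in> S n 0" using u[of n] by simp
    \<comment> \<open>By the cycle condition \<open>dl\<close> of the top component is in the image
      of \<open>dr\<close>, so its projection is a cycle modulo JF, where the hypothesis
      \<open>tor\<close> applies.\<close>
    have dun: "bd F n (proj n (?u n)) \<in> mod_J (n - 1)"
    proof -
      let ?v = "sgn_scale n' (?u n')"
      have v: "?v \<in> S n' 1" using u[of n'] n' submodule_scale[OF P.submodule_S] by simp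
      have "dl n 0 (?u n) = - dr n' 1 ?v"
        using cycle[of n'] u[of n'] n' by (simp add: dr_scale eq_neg_iff_add_eq_0)
      also have "\<dots> = dr n' 1 (smul T (- 1) ?v)"
        using dr_scale[OF v, of "- 1"] by simp
      finally have "bd F n (proj n (?u n)) = proj n' (dr n' 1 (smul T (- 1) ?v))"
        using bd_proj[OF un] n' by simp
      then show ?thesis
        using proj_dr[OF submodule_scale[OF P.submodule_S v, of "- 1"]] n' by simp
    qed
    then obtain z where "z \<in> chain F (Suc n)" "proj n (?u n) - bd F (Suc n) z \<in> mod_J n"
      using tor[OF n proj_mem[OF un]] by auto
    then obtain a b where a: "a \<in> S (Suc n) 0" and b: "b \<in> S n 1" and ab: "?u n = dl (Suc n) 0 a + dr n 1 b"
      using proj_step[OF un] by blast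
    \<comment> \<open>The extra sign cancels the sign in front of \<open>dr\<close> in the
      differential of \<open>b\<close>.\<close>
    define c where "c = a + sgn_scale n b"
    have aC: "a \<in> chain T (Suc n)" and bC: "b \<in> chain T (Suc n)"
      using S_mem_chain[OF a] S_mem_chain[OF b] by simp_all
    have sbC: "sgn_scale n b \<in> chain T (Suc n)" by (rule submodule_scale[OF D.submodule_total bC])
    have "bd T (Suc n) a = dl (Suc n) 0 a"
      using bd_T_S[OF a] dr_0[OF a] by simp
    moreover have "bd T (Suc n) b = dl n 1 b + sgn_scale n (dr n 1 b)"
      using bd_T_S[OF b] by simp
    ultimately have "bd T (Suc n) c = ?u n + sgn_scale n (dl n 1 b)"
      unfolding c_def bd_T_add[OF aC sbC] bd_T_scale[OF bC] ab
      by (simp add: P.scale_right_distrib sgn_scale_sgn_scale del: P.scale_scale)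
    moreover have "c \<in> chain T (Suc n)" unfolding c_def by (rule submodule_add[OF D.submodule_total aC sbC])
    ultimately show ?thesis using b True by auto
  next
    case False
    then have mn: "m \<le> n'" "Suc m \<le> n" "1 \<le> n - m" using m n' by auto
    \<comment> \<open>Below the top, the component above is already cleared, so this one is a cycle
      of its row, in positive second degree.\<close>
    have "?u (Suc m) = 0" using Suc.prems(4) mn by simp
    then have "sgn_scale m (dr m (n - m) (?u m)) = 0" using cycle[OF mn(1)] dl_zero by simp
    then have "dr m (n - m) (?u m) = 0" using sgn_scale_sgn_scale[of m] P.scale_zero_right by metis
    then obtain b where b: "b \<in> S m (Suc (n - m))" "?u m = dr m (Suc (n - m)) b"
      using row_exact[OF u[OF m] _ mn(3)] by blast
    have bC: "b \<in> chain T (Suc n)" using S_mem_chain[OF b(1)] m by simp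
    have "bd T (Suc n) b = dl m (Suc (n - m)) b + sgn_scale m (?u m)"
      using bd_T_S[OF b(1)] b(2) m by simp
    then have "bd T (Suc n) (sgn_scale m b) = ?u m + sgn_scale m (dl m (Suc (n - m)) b)"
      unfolding bd_T_scale[OF bC] by (simp add: P.scale_right_distrib sgn_scale_sgn_scale del: P.scale_scale)
    then show ?thesis using b(1) submodule_scale[OF D.submodule_total bC] by blast
  qed
  then obtain c b where c: "c \<in> chain T (Suc n)" and b: "b \<in> S m (Suc (n - m))"
    and bd_c: "bd T (Suc n) c = ?u m + sgn_scale m (dl m (Suc (n - m)) b)" by blast
  have umC: "?u m \<in> chain T n" using S_mem_chain[OF u[OF m]] m by simp
  have dlC: "dl m (Suc (n - m)) b \<in> chain T n" by (rule dl_mem_chain[OF b m])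
  have dc: "bd T (Suc n) c \<in> chain T n" using bd_T_mem[OF c] by simp
  have "w - bd T (Suc n) c \<in> bd T (Suc n) ` chain T (Suc n)"
  proof (rule Suc.IH)
    show "m \<le> Suc n" using m by simp
    show "w - bd T (Suc n) c \<in> chain T n" by (rule submodule_diff[OF D.submodule_total Suc.prems(2) dc])
    show "bd T n (w - bd T (Suc n) c) = 0"
      using bd_T_diff[OF Suc.prems(2) dc] Suc.prems(3) bd_T_bd_T[OF c] by simp
    fix i assume i: "m \<le> i" "i \<le> n"
    have "D.component n i (bd T (Suc n) c) = D.component n i (?u m)"
      unfolding bd_c
      using component_T_add[OF i(2) umC submodule_scale[OF D.submodule_total dlC]]
        component_T_scale[OF i(2) dlC] component_dl_0[OF b m i] by simp
    also have "\<dots> = ?u i"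
      using D.component_summand[OF m u[OF m] i(2)] Suc.prems(4)[of i] i by auto
    finally show "D.component n i (w - bd T (Suc n) c) = 0"
      using component_T_diff[OF i(2) Suc.prems(2) dc] by simp
  qed
  then obtain d where d: "d \<in> chain T (Suc n)" "w - bd T (Suc n) c = bd T (Suc n) d" by blast
  then have "w = bd T (Suc n) (d + c)" using bd_T_add[OF d(1) c] by (metis diff_add_cancel)
  then show ?case using submodule_add[OF D.submodule_total d(1) c] by blast
qed

end



section \<open>Augmentations\<close>

lemma coset_eq_iff:
  assumes "submodule (*) (A :: 'r::comm_ring_1 set)"
  shows "a +o A = b +o A \<longleftrightarrow> a - b \<in> A"
proof
  assume "a +o A = b +o A"
  moreover have "a \<in> a +o A" using set_plus_intro2[OF submodule_zero[OF assms], of a] by simp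
  ultimately show "a - b \<in> A" by (simp add: set_minus_plus)
next
  assume ab: "a - b \<in> A"
  have "x - a \<in> A \<longleftrightarrow> x - b \<in> A" for x
    using submodule_add[OF assms _ ab, of "x - a"] submodule_diff[OF assms _ ab, of "x - b"] by auto
  then show "a +o A = b +o A" by (auto simp flip: set_minus_plus)
qed

lemma coset_add:
  assumes "submodule (*) (A :: 'r::comm_ring_1 set)"
  shows "(a +o A) + (b +o A) = (a + b) +o A"
proof -
  have "A + A = A"
    using submodule_add[OF assms] set_zero_plus2[OF submodule_zero[OF assms]]
    by (auto elim!: set_plus_elim)
  then show ?thesis by (simp add: set_plus_rearrange)
qed

text \<open>Multiples of \<open>A\<close> by \<open>r\<close> may be smaller than \<open>A\<close>;
  adding \<open>A\<close> restores a full coset.\<close>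

lemma coset_mult:
  assumes "submodule (*) (A :: 'r::comm_ring_1 set)"
  shows "r *o (a +o A) + A = (r * a) +o A"
proof -
  have "r *o A \<subseteq> A" unfolding elt_set_times_def using submodule_scale[OF assms] by auto
  then have "r *o A + A = A"
  proof -
    have "0 \<in> r *o A" using set_times_intro2[OF submodule_zero[OF assms], of r] by simp
    then have "A \<subseteq> r *o A + A" by (rule set_zero_plus2)
    moreover have "r *o A + A \<subseteq> A"
      using \<open>r *o A \<subseteq> A\<close> submodule_add[OF assms] by (auto elim!: set_plus_elim)
    ultimately show ?thesis by blast
  qed
  then show ?thesis by (simp add: set_times_plus_distrib set_plus_rearrange3)
qed

text \<open>Surjectivity needs just one preimage of the coset of 1: its multiple by \<open>a\<close>
  hits the coset of \<open>a\<close>.\<close>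

lemma mg_surj_quotient_of_lift:
  assumes A: "submodule (*) A" and rho: "linear_map_on s (*) M UNIV rho" and M: "submodule s M"
    and one: "\<exists>y\<in>M. rho y - 1 \<in> A"
    and graded: "\<And>x \<alpha>. x \<in> H \<alpha> \<Longrightarrow> \<exists>c. rho x - Poly_Mapping.single \<alpha> c \<in> A"
  shows "mg_surj_quotient s M H A {x \<in> M. rho x \<in> A} (\<lambda>x. rho x +o A)"
  unfolding mg_surj_quotient_def
proof (intro conjI allI ballI)
  obtain y where y: "y \<in> M" "rho y - 1 \<in> A" using one by blast
  have "a +o A \<in> (\<lambda>x. rho x +o A) ` M" for a
  proof -
    have "a * (rho y - 1) \<in> A" by (rule submodule_scale[OF A y(2)])
    then have "rho (s a y) - a \<in> A"
      using linear_map_on_scale[OF rho y(1)] by (simp add: right_diff_distrib)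
    then have "a +o A = rho (s a y) +o A" using coset_eq_iff[OF A] by blast
    then show ?thesis using submodule_scale[OF M y(1)] by blast
  qed
  then show "(\<lambda>x. rho x +o A) ` M = range (\<lambda>a. a +o A)" by auto
  show "{x \<in> M. rho x +o A = A} = {x \<in> M. rho x \<in> A}"
    using coset_eq_iff[OF A, of _ 0] by simp
qed (use graded coset_eq_iff[OF A] coset_add[OF A] coset_mult[OF A]
    linear_map_on_add[OF rho] linear_map_on_scale[OF rho] in auto)

text \<open>Coset representatives chosen on a basis extend linearly. A polynomial-valued lift
  replaces set arithmetic with cosets by ordinary linear algebra modulo \<open>A\<close>.\<close>

lemma (in free_basis) lift_of_mg_surj_quotient:
  fixes A :: "'r set" and \<epsilon> :: "'m \<Rightarrow> 'r set"
  assumes A: "submodule (*) A" and range: "\<epsilon> ` M = range (\<lambda>a. a +o A)"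
    and add: "\<And>x y. x \<in> M \<Longrightarrow> y \<in> M \<Longrightarrow> \<epsilon> (x + y) = \<epsilon> x + \<epsilon> y"
    and scale: "\<And>r x. x \<in> M \<Longrightarrow> \<epsilon> (s r x) = r *o \<epsilon> x + A"
  shows "\<exists>rho. linear_map_on s (*) M UNIV rho \<and> (\<forall>x\<in>M. \<epsilon> x = rho x +o A)"
proof -
  have "\<exists>r. \<epsilon> (e x) = r +o A" if "x \<in> X" for x
    using imageI[OF basis_mem[OF that], of \<epsilon>] unfolding range by auto
  then have "\<forall>x\<in>X. \<exists>r. \<epsilon> (e x) = r +o A" by blast
  from bchoice[OF this] obtain g where g: "\<And>x. x \<in> X \<Longrightarrow> \<epsilon> (e x) = g x +o A" by blast
  have "submodule (*) (UNIV :: 'r set)" by (rule module.submodule_UNIV[OF module_mult])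
  from linear_extension[OF this, of g] obtain rho
    where rho: "linear_map_on s (*) M UNIV rho" "\<And>x. x \<in> X \<Longrightarrow> rho (e x) = g x" by auto
  let ?Q = "{x \<in> M. \<epsilon> x = rho x +o A}"
  have sc: "s r x \<in> ?Q" if "x \<in> ?Q" for r x
    using that scale coset_mult[OF A] linear_map_on_scale[OF rho(1)] submodule_scale[OF submodule] by simp
  have "M \<subseteq> ?Q"
  proof (rule basis_induct)
    show "e x \<in> ?Q" if "x \<in> X" for x using that g rho(2) basis_mem by simp
    show "submodule s ?Q"
    proof (rule submoduleI)
      show "module s" by (rule module_axioms)
      show "s r x \<in> ?Q" if "x \<in> ?Q" for r x using sc that .
      show "x + y \<in> ?Q" if "x \<in> ?Q" "y \<in> ?Q" for x y
        using that add coset_add[OF A] linear_map_on_add[OF rho(1)] submodule_add[OF submodule] by simp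
      \<comment> \<open>The value of \<open>\<epsilon>\<close> at 0 is obtained from its value on
        the multiple of 0 by the scalar 0.\<close>
      have 0: "0 \<in> M" by (rule submodule_zero[OF submodule])
      obtain r where r: "\<epsilon> 0 = r +o A" using range 0 by blast
      have "\<epsilon> 0 = \<epsilon> (s 0 0)" by simp
      also have "\<dots> = 0 +o A" unfolding scale[OF 0] r coset_mult[OF A] by simp
      finally show "0 \<in> ?Q"
        using 0 linear_map_on_zero[OF rho(1) submodule module_mult] by simp
    qed
  qed
  then show ?thesis using rho(1) by blast
qed

lemma minimal_mg_free_resolution_based:
  assumes res: "minimal_mg_free_resolution I (C :: ('v, 'k::field, 'm::ab_group_add) mg_complex)"
    and I: "submodule (*) I"
  shows "\<exists>X k deg rho. based_resolution C X k deg I rho"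
proof -
  have free: "mg_free_resolution I C"
    and minimal: "\<And>i. i \<ge> 1 \<Longrightarrow> bd C i ` chain C i \<subseteq> ideal_smult (smul C) irrelevant_ideal (chain C (i - 1))"
    using res unfolding minimal_mg_free_resolution_def by auto
  \<comment> \<open>Basis, coordinates and degrees are packed into one triple, so that a single
    choice serves all \<open>i\<close>.\<close>
  have ex: "\<exists>b. graded_free_basis (smul C) (chain C i) (fst b) (\<lambda>x. x) (fst (snd b)) (hcomp C i) (snd (snd b))" for i
  proof -
    have "multigraded_free_module (smul C) (chain C i) (hcomp C i)"
      using free unfolding mg_free_resolution_def by simp
    from multigraded_free_module_basis[OF this] show ?thesis by (metis fst_conv snd_conv)
  qed
  obtain X k deg
    where basis: "\<And>i. graded_free_basis (smul C) (chain C i) (X i) (\<lambda>x. x) (k i) (hcomp C i) (deg i)"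
  proof -
    obtain b where "\<And>i. graded_free_basis (smul C) (chain C i) (fst (b i)) (\<lambda>x. x)
        (fst (snd (b i))) (hcomp C i) (snd (snd (b i)))"
      using choice[of "\<lambda>i b. graded_free_basis (smul C) (chain C i) (fst b) (\<lambda>x. x)
        (fst (snd b)) (hcomp C i) (snd (snd b))"] ex by blast
    then show thesis by (rule that)
  qed
  obtain \<epsilon> where \<epsilon>: "mg_surj_quotient (smul C) (chain C 0) (hcomp C 0) I (bd C 1 ` chain C 1) \<epsilon>"
    using free unfolding mg_free_resolution_def by blast
  interpret B0: graded_free_basis "smul C" "chain C 0" "X 0" "\<lambda>x. x" "k 0" "hcomp C 0" "deg 0"
    by (rule basis)
  have "\<exists>rho. linear_map_on (smul C) (*) (chain C 0) UNIV rho \<and> (\<forall>x\<in>chain C 0. \<epsilon> x = rho x +o I)"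
    by (rule B0.lift_of_mg_surj_quotient[OF I]) (use \<epsilon> in \<open>auto simp: mg_surj_quotient_def\<close>)
  then obtain rho where rho: "linear_map_on (smul C) (*) (chain C 0) UNIV rho"
    and \<epsilon>_rho: "\<And>x. x \<in> chain C 0 \<Longrightarrow> \<epsilon> x = rho x +o I" by blast
  have "based_resolution C X k deg I rho"
  proof (rule based_resolution.intro)
    show "is_mg_complex C" "\<And>i. i \<ge> 1 \<Longrightarrow> {x \<in> chain C i. bd C i x = 0} = bd C (i + 1) ` chain C (i + 1)"
      using free unfolding mg_free_resolution_def by blast+
    show "graded_free_basis (smul C) (chain C i) (X i) (\<lambda>x. x) (k i) (hcomp C i) (deg i)" for i by (rule basis)
    show "\<exists>y\<in>chain C 0. rho y - 1 \<in> I"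
    proof -
      have "\<epsilon> ` chain C 0 = range (\<lambda>a. a +o I)" using \<epsilon> unfolding mg_surj_quotient_def by simp
      then have "1 +o I \<in> \<epsilon> ` chain C 0" by blast
      then obtain y where "y \<in> chain C 0" "rho y +o I = 1 +o I" using \<epsilon>_rho by auto
      then show ?thesis using coset_eq_iff[OF I] by blast
    qed
    show "\<exists>c. rho x - Poly_Mapping.single \<alpha> c \<in> I" if x: "x \<in> hcomp C 0 \<alpha>" for x \<alpha>
    proof -
      obtain c where "\<epsilon> x = Poly_Mapping.single \<alpha> c +o I" using \<epsilon> x unfolding mg_surj_quotient_def by blast
      then show ?thesis using \<epsilon>_rho[OF B0.component_mem[OF x]] coset_eq_iff[OF I] by auto
    qed
    have "{x \<in> chain C 0. \<epsilon> x = I} = bd C 1 ` chain C 1" using \<epsilon> unfolding mg_surj_quotient_def by blast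
    moreover have "\<epsilon> x = I \<longleftrightarrow> rho x \<in> I" if "x \<in> chain C 0" for x
      using \<epsilon>_rho[OF that] coset_eq_iff[OF I, of "rho x" 0] by simp
    ultimately show "{x \<in> chain C 0. rho x \<in> I} = bd C 1 ` chain C 1" by blast
  qed (use I rho minimal in auto)
  then show ?thesis by blast
qed

section \<open>The augmentation of the tensor complex\<close>

context tensor_of_resolutions
begin

text \<open>The product of the two augmentations: on pure tensors its value is
  \<open>rhoF x * rhoG y\<close>.\<close>

definition rhoT :: "'h \<Rightarrow> ('v, 'k) mpoly"
  where "rhoT w = rhoF (proj 0 w)"

lemma chain_T_0: "chain T 0 = S 0 0"
  unfolding chain_T by auto

lemma rhoT_linear: "linear_map_on (smul T) (*) (chain T 0) UNIV rhoT"
  unfolding rhoT_def chain_T_0 by (rule compose_linear[OF proj_linear F.rho_linear])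

lemma rhoT_tensor: "x \<in> chain F 0 \<Longrightarrow> y \<in> chain G 0 \<Longrightarrow> rhoT (t 0 0 x y) = rhoF x * rhoG y"
  by (simp add: rhoT_def proj_tensor F.rho_scale)

lemma submodule_sum_ideals: "submodule (*) (I + J)"
proof (rule submoduleI[OF module_mult])
  show "0 \<in> I + J" using set_plus_intro[OF submodule_zero[OF F.ideal] submodule_zero[OF G.ideal]] by simp
  fix x y assume "x \<in> I + J" "y \<in> I + J"
  then obtain a b c d where "x = a + b" "y = c + d" "a \<in> I" "b \<in> J" "c \<in> I" "d \<in> J"
    by (auto elim!: set_plus_elim)
  then have "x + y = (a + c) + (b + d)" "a + c \<in> I" "b + d \<in> J"
    using submodule_add[OF F.ideal] submodule_add[OF G.ideal] by (simp_all add: algebra_simps)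
  then show "x + y \<in> I + J" by (metis set_plus_intro)
next
  fix r x assume "x \<in> I + J"
  then obtain a b where "x = a + b" "a \<in> I" "b \<in> J" by (auto elim!: set_plus_elim)
  then show "r * x \<in> I + J"
    using submodule_scale[OF F.ideal, of a r] submodule_scale[OF G.ideal, of b r]
    by (simp add: distrib_left set_plus_intro)
qed

lemma ideals_subset_sum: "a \<in> I \<Longrightarrow> a \<in> I + J" "b \<in> J \<Longrightarrow> b \<in> I + J"
  using set_plus_intro[of a I 0 J] set_plus_intro[of 0 I b J]
    submodule_zero[OF F.ideal] submodule_zero[OF G.ideal] by auto

lemma rhoT_one: "\<exists>w\<in>chain T 0. rhoT w - 1 \<in> I + J"
proof -
  obtain x y where x: "x \<in> chain F 0" "rhoF x - 1 \<in> I" and y: "y \<in> chain G 0" "rhoG y - 1 \<in> J"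
    using F.rho_one G.rho_one by blast
  have "rhoT (t 0 0 x y) - 1 = rhoG y * (rhoF x - 1) + (rhoG y - 1)"
    using x y by (simp add: rhoT_tensor algebra_simps)
  also have "\<dots> \<in> I + J" using submodule_scale[OF F.ideal x(2)] y(2) by (rule set_plus_intro)
  finally show ?thesis unfolding chain_T_0 using P.tensor_mem[OF x(1) y(1)] by blast
qed

text \<open>If the factors agree modulo \<open>I\<close> and modulo \<open>J\<close> with terms of
  degrees \<open>\<beta>\<close> and \<open>\<gamma>\<close>, their product agrees modulo I + J with
  the product of these terms, and such congruences are closed under K-linear combinations.\<close>

lemma rhoT_graded:
  assumes "w \<in> hcomp T 0 \<alpha>"
  shows "\<exists>c. rhoT w - Poly_Mapping.single \<alpha> c \<in> I + J"
proof -
  let ?sK = "\<lambda>c. smul T (Poly_Mapping.single 0 c)"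
  interpret K: module ?sK by (rule module_constants[OF P.module_axioms])
  let ?Q = "{w \<in> chain T 0. \<exists>c. rhoT w - Poly_Mapping.single \<alpha> c \<in> I + J}"
  have "hcomp T 0 \<alpha> \<subseteq> ?Q"
    unfolding hcomp_T
  proof (rule K.span_minimal)
    show "K.subspace ?Q"
    proof (rule K.subspaceI)
      show "0 \<in> ?Q"
        using submodule_zero[OF D.submodule_total] submodule_zero[OF submodule_sum_ideals]
          linear_map_on_zero[OF rhoT_linear D.submodule_total module_mult] by (auto intro!: exI[of _ 0])
      fix u assume "u \<in> ?Q"
      then obtain c where u: "u \<in> chain T 0" "rhoT u - Poly_Mapping.single \<alpha> c \<in> I + J" by blast
      show "?sK a u \<in> ?Q" for a
      proof -
        have "rhoT (?sK a u) - Poly_Mapping.single \<alpha> (a * c) =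
            Poly_Mapping.single 0 a * (rhoT u - Poly_Mapping.single \<alpha> c)"
          using linear_map_on_scale[OF rhoT_linear u(1)] by (simp add: right_diff_distrib mult_single)
        then show ?thesis
          using submodule_scale[OF submodule_sum_ideals u(2)] submodule_scale[OF D.submodule_total u(1)]
          by (metis (mono_tags, lifting) mem_Collect_eq)
      qed
      fix v assume "v \<in> ?Q"
      then obtain d where v: "v \<in> chain T 0" "rhoT v - Poly_Mapping.single \<alpha> d \<in> I + J" by blast
      have "rhoT (u + v) - Poly_Mapping.single \<alpha> (c + d) =
          (rhoT u - Poly_Mapping.single \<alpha> c) + (rhoT v - Poly_Mapping.single \<alpha> d)"
        using linear_map_on_add[OF rhoT_linear u(1) v(1)] by (simp add: single_add)
      then show "u + v \<in> ?Q"
        using submodule_add[OF submodule_sum_ideals u(2) v(2)] submodule_add[OF D.submodule_total u(1) v(1)]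
        by (metis (mono_tags, lifting) mem_Collect_eq)
    qed
    show "{t i j x y | i j x y \<beta> \<gamma>. i + j = 0 \<and> \<beta> + \<gamma> = \<alpha> \<and> x \<in> hcomp F i \<beta> \<and> y \<in> hcomp G j \<gamma>} \<subseteq> ?Q"
    proof
      fix w assume "w \<in> {t i j x y | i j x y \<beta> \<gamma>. i + j = 0 \<and> \<beta> + \<gamma> = \<alpha> \<and> x \<in> hcomp F i \<beta> \<and> y \<in> hcomp G j \<gamma>}"
      then obtain x y \<beta> \<gamma> where w: "w = t 0 0 x y" "\<beta> + \<gamma> = \<alpha>" and x: "x \<in> hcomp F 0 \<beta>" and y: "y \<in> hcomp G 0 \<gamma>"
        by auto
      obtain c d where c: "rhoF x - Poly_Mapping.single \<beta> c \<in> I" and d: "rhoG y - Poly_Mapping.single \<gamma> d \<in> J"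
        using F.rho_graded[OF x] G.rho_graded[OF y] by blast
      have xy: "x \<in> chain F 0" "y \<in> chain G 0" using F.B.component_mem[OF x] G.B.component_mem[OF y] by auto
      have "rhoT w - Poly_Mapping.single \<alpha> (c * d) =
          rhoG y * (rhoF x - Poly_Mapping.single \<beta> c) + Poly_Mapping.single \<beta> c * (rhoG y - Poly_Mapping.single \<gamma> d)"
        unfolding w(1) rhoT_tensor[OF xy] w(2)[symmetric] mult_single[symmetric] by (simp add: algebra_simps)
      also have "\<dots> \<in> I + J"
        using submodule_scale[OF F.ideal c] submodule_scale[OF G.ideal d] by (rule set_plus_intro)
      finally show "w \<in> ?Q" unfolding w chain_T_0 using P.tensor_mem[OF xy] by blast
    qed
  qed
  then show ?thesis using assms by blast
qed

text \<open>Right exactness in degree 0: R/I \<otimes> R/J is R/(I + J).\<close>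

lemma rhoT_kernel: "{w \<in> chain T 0. rhoT w \<in> I + J} = bd T 1 ` chain T 1"
proof
  show "{w \<in> chain T 0. rhoT w \<in> I + J} \<subseteq> bd T 1 ` chain T 1"
  proof
    fix w assume "w \<in> {w \<in> chain T 0. rhoT w \<in> I + J}"
    then obtain a b where w: "w \<in> S 0 0" and ab: "rhoF (proj 0 w) = a + b" "a \<in> I" "b \<in> J"
      unfolding chain_T_0 rhoT_def by (auto elim!: set_plus_elim)
    obtain x where x: "x \<in> chain F 0" "rhoF x - 1 \<in> I" using F.rho_one by blast
    have bx: "smul F b x \<in> chain F 0" by (rule submodule_scale[OF F.B.submodule x(1)])
    have pw: "proj 0 w \<in> chain F 0" by (rule proj_mem[OF w])
    \<comment> \<open>\<open>smul F b x\<close> carries the part \<open>b\<close> of the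
      augmentation up to an element of \<open>I\<close> and lies in JF_0. Subtracting it leaves a
      boundary of \<open>F\<close>, so the projection of \<open>w\<close> is a boundary modulo
      JF_0.\<close>
    have "rhoF (proj 0 w - smul F b x) = a - b * (rhoF x - 1)"
      by (simp add: F.rho_diff[OF pw bx] F.rho_scale[OF x(1)] ab(1) algebra_simps)
    also have "\<dots> \<in> I" using ab(2) submodule_scale[OF F.ideal x(2)] by (rule submodule_diff[OF F.ideal])
    finally have "proj 0 w - smul F b x \<in> {x \<in> chain F 0. rhoF x \<in> I}"
      using submodule_diff[OF F.B.submodule pw bx] by blast
    then obtain z where z: "z \<in> chain F 1" "proj 0 w - smul F b x = bd F 1 z"
      unfolding F.rho_kernel by blast
    have "proj 0 w - bd F 1 z = smul F b x" unfolding z(2)[symmetric] by simp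
    then have "proj 0 w - bd F (Suc 0) z \<in> mod_J 0" using scale_mod_J[OF ab(3) x(1)] by simp
    moreover have "z \<in> chain F (Suc 0)" using z(1) by simp
    ultimately obtain c d where c: "c \<in> S (Suc 0) 0" and d: "d \<in> S 0 1" and cd: "w = dl (Suc 0) 0 c + dr 0 1 d"
      using proj_step[OF w] by blast
    have "bd T 1 c = dl (Suc 0) 0 c" using bd_T_S[OF c] dr_0[OF c] by simp
    moreover have "bd T 1 d = dr 0 1 d" using bd_T_S[OF d] dl_0[OF d] by simp
    moreover have "c \<in> chain T 1" "d \<in> chain T 1" using S_mem_chain[OF c] S_mem_chain[OF d] by simp_all
    ultimately have "w = bd T 1 (c + d)" "c + d \<in> chain T 1"
      using cd bd_T_add[of c 1 d] submodule_add[OF D.submodule_total] by simp_all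
    then show "w \<in> bd T 1 ` chain T 1" by blast
  qed
  have "chain T 1 \<subseteq> {w \<in> chain T 1. rhoT (bd T 1 w) \<in> I + J}"
  proof (rule chain_T_induct)
    have bd1: "linear_map_on (smul T) (smul T) (chain T 1) (chain T 0) (bd T 1)"
      using bd_T_linear[of 1] by simp
    show "submodule (smul T) {w \<in> chain T 1. rhoT (bd T 1 w) \<in> I + J}"
      by (rule linear_map_on_vimage[OF compose_linear[OF bd1 rhoT_linear]
            D.submodule_total module_mult submodule_sum_ideals])
    fix i j :: nat and x y assume ij: "i + j = 1" and xy: "x \<in> chain F i" "y \<in> chain G j"
    have "rhoT (bd T 1 (t i j x y)) \<in> I + J"
    proof (cases "i = 0")
      case True
      then have j: "j = 1" using ij by simp
      have "bd T 1 (t 0 1 x y) = t 0 0 x (bd G 1 y)"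
        using bd_T_tensor[OF xy] True j xy by (simp add: F.bd_0 P.tensor_zero_left)
      then have "rhoT (bd T 1 (t 0 1 x y)) = rhoF x * rhoG (bd G 1 y)"
        using xy True j G.bd_mem[of y 1] by (simp add: rhoT_tensor)
      moreover have "rhoG (bd G 1 y) \<in> J" using G.rho_kernel xy(2) j by blast
      ultimately show ?thesis using True j ideals_subset_sum(2) submodule_scale[OF G.ideal] by simp
    next
      case False
      then have i: "i = 1" "j = 0" using ij by simp_all
      have "bd T 1 (t 1 0 x y) = t 0 0 (bd F 1 x) y"
        using bd_T_tensor[OF xy] i xy by (simp add: G.bd_0 P.tensor_zero_right)
      then have "rhoT (bd T 1 (t 1 0 x y)) = rhoG y * rhoF (bd F 1 x)"
        using xy i F.bd_mem[of x 1] by (simp add: rhoT_tensor mult.commute)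
      moreover have "rhoF (bd F 1 x) \<in> I" using F.rho_kernel xy(1) i by blast
      ultimately show ?thesis using i ideals_subset_sum(1) submodule_scale[OF F.ideal] by simp
    qed
    then show "t i j x y \<in> {w \<in> chain T 1. rhoT (bd T 1 w) \<in> I + J}"
      using S_mem_chain[OF P.tensor_mem[OF xy]] ij by simp
  qed
  then show "bd T 1 ` chain T 1 \<subseteq> {w \<in> chain T 0. rhoT w \<in> I + J}"
    using bd_T_mem[of _ 1] by auto
qed

lemma minimal_resolution_T:
  assumes tor: "\<And>i x. i \<ge> 1 \<Longrightarrow> x \<in> chain F i \<Longrightarrow> bd F i x \<in> mod_J (i - 1) \<Longrightarrow>
      \<exists>z\<in>chain F (i + 1). x - bd F (i + 1) z \<in> mod_J i"
  shows "minimal_mg_free_resolution (I + J) T"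
proof -
  have "{x \<in> chain T i. bd T i x = 0} = bd T (i + 1) ` chain T (i + 1)" if i: "i \<ge> 1" for i
  proof
    show "{x \<in> chain T i. bd T i x = 0} \<subseteq> bd T (i + 1) ` chain T (i + 1)"
      \<comment> \<open>The descent starts just above the top position, where the vanishing
        condition is vacuous.\<close>
      using cycle_is_boundary[OF tor i order_refl] by auto
    show "bd T (i + 1) ` chain T (i + 1) \<subseteq> {x \<in> chain T i. bd T i x = 0}"
      using bd_T_mem[of _ "i + 1"] bd_T_bd_T[of _ "i + 1"] by auto
  qed
  moreover have "mg_surj_quotient (smul T) (chain T 0) (hcomp T 0) (I + J) (bd T 1 ` chain T 1) (\<lambda>x. rhoT x +o (I + J))"
    using mg_surj_quotient_of_lift[OF submodule_sum_ideals rhoT_linear D.submodule_total rhoT_one rhoT_graded]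
    unfolding rhoT_kernel by blast
  ultimately have "mg_free_resolution (I + J) T"
    unfolding mg_free_resolution_def using is_mg_complex_T BT.multigraded_free by blast
  then show ?thesis
    unfolding minimal_mg_free_resolution_def using minimal_T by blast
qed

end

theorem corollary3p3:
  fixes I J :: "('v::finite, 'k::field) mpoly set"
    and F :: "('v, 'k, 'f::ab_group_add) mg_complex"
    and G :: "('v, 'k, 'g::ab_group_add) mg_complex"
    and T :: "('v, 'k, 'h::ab_group_add) mg_complex"
  assumes "monomial_ideal I" and "monomial_ideal J"
    and "ideal_prod I J = I \<inter> J"
    and "minimal_mg_free_resolution I F"
    and "minimal_mg_free_resolution J G"
    and "is_tensor_complex F G T"
  shows "minimal_mg_free_resolution (I + J) T"
proof -
  obtain A where A: "\<And>\<alpha> \<beta>. \<alpha> \<in> A \<Longrightarrow> \<alpha> + \<beta> \<in> A" and I: "I = {f. Poly_Mapping.keys f \<subseteq> A}"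
    using monomial_ideal_exponents[OF assms(1)] by blast
  obtain B where B: "\<And>\<alpha> \<beta>. \<alpha> \<in> B \<Longrightarrow> \<alpha> + \<beta> \<in> B" and J: "J = {f. Poly_Mapping.keys f \<subseteq> B}"
    using monomial_ideal_exponents[OF assms(2)] by blast
  have ideals: "submodule (*) I" "submodule (*) J"
    unfolding submodule_def I J using module_mult subspace_keys A B by blast+
  \<comment> \<open>The variables that are nonzerodivisors modulo \<open>I\<close>. The argument is
    asymmetric: \<open>W\<close> bounds the degrees of \<open>F\<close>, while its complement is
    harmless for membership in \<open>J\<close>.\<close>
  define W where "W = {v. \<forall>\<alpha>. \<alpha> + Poly_Mapping.single v 1 \<in> A \<longrightarrow> \<alpha> \<in> A}"
  have AB: "\<exists>\<alpha>\<in>A. \<exists>\<beta>\<in>B. \<gamma> = \<alpha> + \<beta>" if "\<gamma> \<in> A" "\<gamma> \<in> B" for \<gamma>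
  proof (rule ideal_prod_exponents[OF A])
    have "monomial \<gamma> \<in> I \<inter> J" using that by (simp add: I J monomial_def)
    then show "monomial \<gamma> \<in> ideal_prod {f :: ('v, 'k) mpoly. Poly_Mapping.keys f \<subseteq> A} {f. Poly_Mapping.keys f \<subseteq> B}"
      using assms(3) I J by simp
  qed
  \<comment> \<open>A variable outside \<open>W\<close> falls under the other alternative of the
    dichotomy.\<close>
  have satB: "\<beta> \<in> B" if "v \<notin> W" "\<beta> + Poly_Mapping.single v 1 \<in> B" for v \<beta>
    using exponent_saturated_cases[OF A B AB, of v] that unfolding W_def by blast
  have satI: "f \<in> I" if v: "v \<in> W" and f: "monomial (Poly_Mapping.single v 1) * f \<in> I" for v f
  proof -
    have "\<gamma> \<in> A" if "\<gamma> \<in> Poly_Mapping.keys f" for \<gamma>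
    proof -
      have "Poly_Mapping.single v 1 + \<gamma> \<in> Poly_Mapping.keys (monomial (Poly_Mapping.single v 1) * f)"
        using that by (simp add: monomial_def in_keys_iff lookup_single_mult)
      then have "\<gamma> + Poly_Mapping.single v 1 \<in> A" using f unfolding I by (auto simp: add.commute)
      then show ?thesis using v unfolding W_def by blast
    qed
    then show ?thesis unfolding I by blast
  qed
  obtain XF kF degF rhoF where "based_resolution F XF kF degF I rhoF"
    using minimal_mg_free_resolution_based[OF assms(4) ideals(1)] by blast
  then interpret F: based_resolution F XF kF degF I rhoF .
  obtain XG kG degG rhoG where "based_resolution G XG kG degG J rhoG"
    using minimal_mg_free_resolution_based[OF assms(5) ideals(2)] by blast
  then interpret G: based_resolution G XG kG degG J rhoG .
  from assms(6)[unfolded is_tensor_complex_def] show ?thesis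
  proof (elim exE conjE)
    fix S :: "nat \<Rightarrow> nat \<Rightarrow> 'h set" and t
    assume T: "\<forall>i j. is_tensor_product (smul F) (chain F i) (smul G) (chain G j) (smul T) (S i j) (t i j)"
      "\<forall>n. chain T n = {\<Sum>i\<le>n. u i | u. \<forall>i\<le>n. u i \<in> S i (n - i)}"
      "\<forall>n u. (\<forall>i\<le>n. u i \<in> S i (n - i)) \<and> (\<Sum>i\<le>n. u i) = 0 \<longrightarrow> (\<forall>i\<le>n. u i = 0)"
      "\<forall>n \<alpha>. hcomp T n \<alpha> = module.span (\<lambda>c. smul T (Poly_Mapping.single 0 c))
        {t i j x y | i j x y \<beta> \<gamma>. i + j = n \<and> \<beta> + \<gamma> = \<alpha> \<and> x \<in> hcomp F i \<beta> \<and> y \<in> hcomp G j \<gamma>}"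
      "\<forall>n. linear_map_on (smul T) (smul T) (chain T n) (chain T (n - 1)) (bd T n)"
      "\<forall>i j. \<forall>x\<in>chain F i. \<forall>y\<in>chain G j. bd T (i + j) (t i j x y) =
        t (i - 1) j (bd F i x) y + smul T ((- 1) ^ i) (t i (j - 1) x (bd G j y))"
    interpret tensor_of_resolutions F XF kF degF I rhoF G XG kG degG J rhoG T S t
    proof (intro tensor_of_resolutions.intro tensor_of_resolutions_axioms.intro)
      show "u i = 0" if "\<forall>i\<le>n. u i \<in> S i (n - i)" "(\<Sum>i\<le>n. u i) = 0" "i \<le> n" for n u i
        using T(3) that by simp
    qed (fact F.based_resolution_axioms G.based_resolution_axioms T[rule_format])+
    show ?thesis
    proof (rule minimal_resolution_T)
      fix i x assume i: "i \<ge> 1" and x: "x \<in> chain F i" and dx: "bd F i x \<in> mod_J (i - 1)"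
      have "\<exists>z\<in>chain F (i + 1). \<forall>b. Poly_Mapping.keys (kF i (x - bd F (i + 1) z) b) \<subseteq> B"
      proof (rule F.exact_modulo[OF _ B _ i x])
        show "Poly_Mapping.lookup (degF i x) v = 0" if "v \<in> W" "x \<in> XF i" for v i x
          using F.deg_saturated_variable[OF satI[OF that(1)] that(2)] .
        show "\<gamma> \<in> B" if "\<And>v. v \<in> W \<Longrightarrow> Poly_Mapping.lookup \<delta> v = 0" "\<gamma> + \<delta> \<in> B" for \<gamma> \<delta>
          using saturated_remove_exponent[of W B, OF satB that] .
        have "kF (i - 1) (bd F i x) b \<in> J" for b using dx unfolding mod_J_def by blast
        then show "Poly_Mapping.keys (kF (i - 1) (bd F i x) b) \<subseteq> B" for b unfolding J by blast
      qed
      then obtain z where z: "z \<in> chain F (i + 1)" "\<And>b. kF i (x - bd F (i + 1) z) b \<in> J"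
        unfolding J by blast
      have "x - bd F (i + 1) z \<in> chain F i"
        using submodule_diff[OF F.B.submodule x] F.bd_mem[OF z(1)] by simp
      then show "\<exists>z\<in>chain F (i + 1). x - bd F (i + 1) z \<in> mod_J i"
        using z unfolding mod_J_def by blast
    qed
  qed
qed

end
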